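(* Let $n,m\in\mathbb{N}$, let $f:\mathbb{R}^n\times\mathbb{R}^m\to\mathbb{R}^n$ and $r:\mathbb{R}^n\times\mathbb{R}^m\to\mathbb{R}$ be bounded and Lipschitz continuous, let $\gamma\ge\|f\|_{\mathrm{Lip}(\mathbb{R}^n\times\mathbb{R}^m)}+1$, and let $(x,a)\in\mathbb{R}^n\times\mathbb{R}^m$ be given. Assume: (i) there exist $C>0$ and $\sigma>0$ such that $\|f(y,b)\|_2+|r(y,b)|\le \dfrac{C}{\|b\|_2^\sigma}$ for all $y\in\mathbb{R}^n$ and $b\in\mathbb{R}^m\setminus\{0\}$; (ii) there is an optimal control for $Q(x)$, i.e. a measurable $a(\cdot):[0,\infty)\to\mathbb{R}^m$ with $Q(x)=\int_0^\infty e^{-\gamma s}r(x(s),a(s))\,ds$, where $x'(s)=f(x(s),a(s))$ and $x(0)=x$, and there is $\beta>0$ such that $$\|\tilde a-\tilde a*\eta^\varepsilon\|_{L^2(\mathbb{R})}=O(\varepsilon^\beta)\quad\text{as }\varepsilon\to0^+,$$ where $\tilde a:\mathbb{R}\to\mathbb{R}^m$ is the odd extension of $a(\cdot)$. Then, as $L\to\infty$, $$|Q^L(x,a)-Q(x)|=O\left(\frac{\log L}{L^{\sigma/2}}+\left(\frac{\log L}{\sqrt L}\right)^{\beta}+\frac{1}{\sqrt L}\right).$$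
   Context: $\|\cdot\|_2$ is the Euclidean norm, and $\|f\|_{\mathrm{Lip}(\mathbb{R}^n\times\mathbb{R}^m)}$ is the Lipschitz constant of $f$ with respect to Euclidean norms. With $\mathcal{A}$ the set of measurable functions $a(\cdot):[0,\infty)\to\mathbb{R}^m$ and $\mathcal{A}^L$ the set of those satisfying $\|a(s_1)-a(s_2)\|_2\le L|s_1-s_2|$ for all $s_1,s_2\ge0$, the value functions are $$Q(x)=\sup_{a(\cdot)\in\mathcal{A}}\int_0^\infty e^{-\gamma s}r(x(s),a(s))\,ds,\qquad Q^L(x,a)=\sup_{a(\cdot)\in\mathcal{A}^L,\ a(0)=a}\int_0^\infty e^{-\gamma s}r(x(s),a(s))\,ds,$$ where $x'(s)=f(x(s),a(s))$ for $s>0$ and $x(0)=x$. The odd extension satisfies $\tilde a(s)=a(s)$ and $\tilde a(-s)=-a(s)$ for $s>0$. The mollifier on $\mathbb{R}$ is $\eta^\varepsilon(s)=\frac1\varepsilon\eta(s/\varepsilon)$, where $\eta(s)=c\,e^{-1/(1-s^2)}$ for $|s|<1$, $\eta(s)=0$ otherwise, and $c>0$ is chosen so that $\int_{\mathbb{R}}\eta=1$; the convolution is taken componentwise. The implied constant in the conclusion may depend on $f,r,\gamma,x,a$, the control and the constants in (i) and (ii), but not on $L$. *)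

theory Defs
  imports "HOL-Analysis.Analysis" "HOL-Library.Landau_Symbols"
begin

text \<open>The norm of the product type is
  \<open>norm (x, a) = sqrt ((norm x)\<^sup>2 + (norm a)\<^sup>2)\<close>, so this is the Lipschitz constant with
  respect to the Euclidean norm when the domain is \<open>(real ^ 'n) \<times> (real ^ 'm)\<close>.\<close>

definition lip_const :: "('a::metric_space \<Rightarrow> 'b::metric_space) \<Rightarrow> real" where
  "lip_const g = Inf {K. K-lipschitz_on UNIV g}"

text \<open>Controls and trajectories live on \<open>[0, \<infinity>)\<close>; their values at negative times are
  arbitrary and are never used.\<close>

definition controls :: "(real \<Rightarrow> real ^ 'm) set" where
  "controls = borel_measurable (lebesgue_on {0..})"

definition lip_controls :: "real \<Rightarrow> (real \<Rightarrow> real ^ 'm) set" where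
  "lip_controls L = {a \<in> controls. L-lipschitz_on {0..} a}"

text \<open>For a control that is merely measurable, \<open>x'(s) = f (x(s), a(s))\<close>, \<open>x(0) = x0\<close> is understood
  in the sense of Caratheodory, that is, as the corresponding integral equation.\<close>

definition trajectory ::
  "((real ^ 'n) \<times> (real ^ 'm) \<Rightarrow> real ^ 'n) \<Rightarrow> real ^ 'n \<Rightarrow> (real \<Rightarrow> real ^ 'm)
    \<Rightarrow> (real \<Rightarrow> real ^ 'n) \<Rightarrow> bool" where
  "trajectory f x0 a x \<longleftrightarrow>
    (\<forall>t\<ge>0. set_integrable lebesgue {0..t} (\<lambda>s. f (x s, a s)) \<and>
           x t = x0 + (LINT s:{0..t}|lebesgue. f (x s, a s)))"

definition payoff ::
  "((real ^ 'n) \<times> (real ^ 'm) \<Rightarrow> real) \<Rightarrow> real \<Rightarrow> (real \<Rightarrow> real ^ 'n) \<Rightarrow> (real \<Rightarrow> real ^ 'm)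
    \<Rightarrow> real" where
  "payoff r \<gamma> x a = (LINT s:{0..}|lebesgue. exp (- \<gamma> * s) * r (x s, a s))"

text \<open>For bounded Lipschitz \<open>f\<close> every control has a trajectory, unique on \<open>[0, \<infinity>)\<close>, so each control
  contributes exactly one payoff to the suprema below.\<close>

definition value_fn ::
  "((real ^ 'n) \<times> (real ^ 'm) \<Rightarrow> real ^ 'n) \<Rightarrow> ((real ^ 'n) \<times> (real ^ 'm) \<Rightarrow> real) \<Rightarrow> real
    \<Rightarrow> real ^ 'n \<Rightarrow> real" where
  "value_fn f r \<gamma> x0 =
    Sup {payoff r \<gamma> x a | x a. a \<in> controls \<and> trajectory f x0 a x}"

definition lip_value_fn ::
  "((real ^ 'n) \<times> (real ^ 'm) \<Rightarrow> real ^ 'n) \<Rightarrow> ((real ^ 'n) \<times> (real ^ 'm) \<Rightarrow> real) \<Rightarrow> real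
    \<Rightarrow> real \<Rightarrow> real ^ 'n \<Rightarrow> real ^ 'm \<Rightarrow> real" where
  "lip_value_fn f r \<gamma> L x0 a0 =
    Sup {payoff r \<gamma> x a | x a. a \<in> lip_controls L \<and> a 0 = a0 \<and> trajectory f x0 a x}"

definition optimal_control ::
  "((real ^ 'n) \<times> (real ^ 'm) \<Rightarrow> real ^ 'n) \<Rightarrow> ((real ^ 'n) \<times> (real ^ 'm) \<Rightarrow> real) \<Rightarrow> real
    \<Rightarrow> real ^ 'n \<Rightarrow> (real \<Rightarrow> real ^ 'm) \<Rightarrow> bool" where
  "optimal_control f r \<gamma> x0 a \<longleftrightarrow>
    a \<in> controls \<and> (\<exists>x. trajectory f x0 a x \<and> value_fn f r \<gamma> x0 = payoff r \<gamma> x a)"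

definition odd_ext :: "(real \<Rightarrow> real ^ 'm) \<Rightarrow> real \<Rightarrow> real ^ 'm" where
  "odd_ext a s = (if s > 0 then a s else if s < 0 then - a (- s) else 0)"

definition bump :: "real \<Rightarrow> real" where
  "bump s = (if \<bar>s\<bar> < 1 then exp (- 1 / (1 - s\<^sup>2)) else 0)"

text \<open>The normalising constant is \<open>c = 1 / \<integral> bump\<close>.\<close>

definition std_mollifier :: "real \<Rightarrow> real" where
  "std_mollifier s = bump s / (LINT t|lebesgue. bump t)"

lemma bump_measurable: "bump \<in> borel_measurable borel" unfolding bump_def by measurable

lemma bump_integrable: "integrable lborel bump"
proof (rule Bochner_Integration.integrable_bound)
  show "integrable lborel (indicator {-1..1::real} :: real \<Rightarrow> real)" by simp
  show "bump \<in> borel_measurable lborel" using bump_measurable by simp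
  show "AE x in lborel. norm (bump x) \<le> norm (indicator {-1..1::real} x :: real)"
    by (rule AE_I2) (auto simp: bump_def indicator_def abs_square_less_1 divide_simps abs_less_iff less_imp_le)
qed

lemma integral_std_mollifier: "(LINT s|lebesgue. std_mollifier s) = 1"
proof -
  have "(LINT t|lborel. bump t) \<noteq> 0"
  proof
    assume "(LINT t|lborel. bump t) = 0"
    then have "AE t in lborel. bump t = 0"
      using bump_integrable by (subst (asm) integral_nonneg_eq_0_iff_AE) (auto simp: bump_def)
    then have "AE t in lborel. t \<notin> {-1<..<1::real}" by eventually_elim (auto simp: bump_def abs_less_iff split: if_splits)
    then have "emeasure lborel {-1<..<1::real} = 0" 
      by (subst (asm) AE_iff_measurable[of "{-1<..<1::real}"]) auto
    then show False by simp
  qed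
  then have "(LINT t|lebesgue. bump t) \<noteq> 0" using bump_measurable by (simp add: integral_completion)
  then show ?thesis unfolding std_mollifier_def by simp
qed

definition mollifier :: "real \<Rightarrow> real \<Rightarrow> real" where
  "mollifier \<epsilon> s = std_mollifier (s / \<epsilon>) / \<epsilon>"

definition convolution :: "(real \<Rightarrow> real ^ 'm) \<Rightarrow> (real \<Rightarrow> real) \<Rightarrow> real \<Rightarrow> real ^ 'm" where
  "convolution u k t = (\<chi> i. LINT s|lebesgue. u (t - s) $ i * k s)"

definition square_integrable :: "(real \<Rightarrow> real ^ 'm) \<Rightarrow> bool" where
  "square_integrable u \<longleftrightarrow>
    u \<in> borel_measurable lebesgue \<and> integrable lebesgue (\<lambda>t. (norm (u t))\<^sup>2)"

definition L2_norm :: "(real \<Rightarrow> real ^ 'm) \<Rightarrow> real" where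
  "L2_norm u = sqrt (LINT t|lebesgue. (norm (u t))\<^sup>2)"

text \<open>\<open>L2_norm\<close> is meaningful only for square integrable functions, hence the first conjunct.\<close>

definition mollification_rate :: "(real \<Rightarrow> real ^ 'm) \<Rightarrow> real \<Rightarrow> bool" where
  "mollification_rate u \<beta> \<longleftrightarrow>
    (\<forall>\<^sub>F \<epsilon> in at_right 0. square_integrable (\<lambda>t. u t - convolution u (mollifier \<epsilon>) t)) \<and>
    (\<lambda>\<epsilon>. L2_norm (\<lambda>t. u t - convolution u (mollifier \<epsilon>) t)) \<in> O[at_right 0](\<lambda>\<epsilon>. \<epsilon> powr \<beta>)"

end

theory Submission
  imports Defs "HOL-Real_Asymp.Real_Asymp"
begin

text \<open>The odd extension \<open>u\<close> of the optimal control is approximated by \<open>w = u * \<eta>\<^sup>\<epsilon>\<close> with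
  \<open>\<epsilon> = 1 / sqrt L\<close>, stopped at time \<open>ln L\<close> and joined to \<open>a0\<close> on \<open>[0, \<epsilon>]\<close>. Boundedness of
  \<open>f\<close> and \<open>r\<close> and discounting make the initial layer and the tail cost \<open>O(1 / sqrt L)\<close>. In between,
  the payoff changes by at most a multiple of the \<open>L\<^sup>2\<close> distance \<open>O(\<epsilon> powr \<beta>)\<close>: integrating the
  trajectory inequality against \<open>exp (- \<gamma> t)\<close> replaces Gronwall's lemma since \<open>\<gamma>\<close> exceeds the
  Lipschitz constant of \<open>f\<close>.

  The difficulty is the Lipschitz constant of \<open>w\<close>, as \<open>u\<close> is not assumed bounded. Fix one scale
  \<open>e\<close> and put \<open>p = u * \<eta>\<^sup>e\<close>, \<open>g = u - p\<close>. Then \<open>w = p * \<eta>\<^sup>\<epsilon> + g * \<eta>\<^sup>\<epsilon>\<close>, and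
  \<open>g * \<eta>\<^sup>\<epsilon>\<close> has Lipschitz constant \<open>O(\<epsilon> powr (- 3 / 2)) = O(L powr (3 / 4))\<close> because \<open>g\<close> is in
  \<open>L\<^sup>2\<close>. The rate hypothesis bounds \<open>p - p * \<eta>\<^sup>\<tau>\<close> and \<open>p'' - p'' * \<eta>\<^sup>\<tau>\<close> uniformly, for all small
  \<open>\<tau>\<close> at once. As \<open>p - p * \<eta>\<^sup>\<tau>\<close> is essentially a multiple of \<open>\<tau>\<^sup>2 p''\<close>, a maximum argument for
  \<open>(1 - \<bar>s - s0\<bar>)\<^sup>2 \<bar>p'' s\<bar>\<close>, with \<open>\<tau>\<close> proportional to the distance to the boundary, bounds
  \<open>p''\<close>. So \<open>p'\<close> grows at most linearly and is \<open>O(ln L)\<close> up to time \<open>ln L\<close>.\<close>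

section \<open>The standard mollifier\<close>

text \<open>Allowing powers in the denominator makes the span of these functions closed under
  differentiation, so that smoothness of the bump reduces to flatness at \<open>0\<close>.\<close>

definition flat_exp :: "nat \<Rightarrow> real \<Rightarrow> real" where
  "flat_exp n x = (if x > 0 then exp (- 1 / x) / x ^ n else 0)"

text \<open>In the variable \<open>1 / x\<close> the exponential beats every power at infinity; left
  of \<open>0\<close> the function vanishes.\<close>

lemma flat_exp_tendsto_0: "(flat_exp n \<longlongrightarrow> 0) (at 0)"
proof -
  have "((\<lambda>x::real. inverse x ^ n / exp (inverse x)) \<longlongrightarrow> 0) (at_right 0)"
    by (rule filterlim_compose[OF tendsto_power_div_exp_0 filterlim_inverse_at_top_right])
  then have right: "(flat_exp n \<longlongrightarrow> 0) (at_right 0)"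
    by (rule Lim_transform_eventually)
      (auto simp: eventually_at_filter flat_exp_def exp_minus field_simps)
  have "(flat_exp n \<longlongrightarrow> 0) (at_left 0)"
    by (rule tendsto_eventually) (auto simp: eventually_at_filter flat_exp_def)
  with right show ?thesis
    by (simp add: filterlim_split_at)
qed

text \<open>Away from \<open>0\<close> this is the quotient rule. At \<open>0\<close> the difference
  quotient of \<open>flat_exp n\<close> is \<open>flat_exp (n + 1)\<close>, which tends to
  \<open>0\<close>.\<close>

lemma DERIV_flat_exp:
  "(flat_exp n has_real_derivative flat_exp (n + 2) x - real n * flat_exp (n + 1) x) (at x)"
proof -
  consider "x > 0" | "x < 0" | "x = 0" by linarith
  then show ?thesis
  proof cases
    case 1
    have "((\<lambda>x. exp (- 1 / x) / x ^ n) has_real_derivative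
        flat_exp (n + 2) x - real n * flat_exp (n + 1) x) (at x)"
    proof -
      have d: "((\<lambda>x. exp (- 1 / x)) has_real_derivative exp (- 1 / x) / x\<^sup>2) (at x)"
        using 1 by (auto intro!: derivative_eq_intros simp: power2_eq_square)
      from 1 DERIV_divide[OF d DERIV_pow[of n x UNIV]] show ?thesis
        by (cases n) (auto elim!: DERIV_cong simp: flat_exp_def field_simps power2_eq_square)
    qed
    then show ?thesis
      by (rule has_field_derivative_transform_within_open[of _ _ _ "{0<..}"])
        (use 1 in \<open>auto simp: flat_exp_def\<close>)
  next
    case 2
    have "((\<lambda>x. 0) has_real_derivative 0) (at x)" by simp
    then have "(flat_exp n has_real_derivative 0) (at x)"
      by (rule has_field_derivative_transform_within_open[of _ _ _ "{..<0}"])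
        (use 2 in \<open>auto simp: flat_exp_def\<close>)
    then show ?thesis using 2 by (simp add: flat_exp_def)
  next
    case 3
    have "((\<lambda>h. flat_exp n h / h) \<longlongrightarrow> 0) (at 0)"
      by (rule Lim_transform_eventually[OF flat_exp_tendsto_0[of "Suc n"]])
        (auto simp: eventually_at_filter flat_exp_def)
    then show ?thesis using 3 by (simp add: DERIV_def flat_exp_def)
  qed
qed

lemma isCont_flat_exp: "isCont (flat_exp n) x"
  using DERIV_flat_exp DERIV_isCont by blast

lemma continuous_on_flat_exp [continuous_intros]:
  "continuous_on A g \<Longrightarrow> continuous_on A (\<lambda>x. flat_exp n (g x))"
  using continuous_on_compose2[of UNIV "flat_exp n" A g] isCont_flat_exp
  by (auto simp: continuous_on_eq_continuous_at)

lemma bump_eq: "bump s = flat_exp 0 (1 - s\<^sup>2)"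
  by (simp add: bump_def flat_exp_def abs_square_less_1)

definition bump' :: "real \<Rightarrow> real" where
  "bump' s = - 2 * s * flat_exp 2 (1 - s\<^sup>2)"

definition bump'' :: "real \<Rightarrow> real" where
  "bump'' s = 4 * s\<^sup>2 * (flat_exp 4 (1 - s\<^sup>2) - 2 * flat_exp 3 (1 - s\<^sup>2)) - 2 * flat_exp 2 (1 - s\<^sup>2)"

lemma DERIV_bump: "(bump has_real_derivative bump' s) (at s)"
proof -
  have "((\<lambda>s. flat_exp 0 (1 - s\<^sup>2)) has_real_derivative
      (flat_exp (0 + 2) (1 - s\<^sup>2) - real 0 * flat_exp (0 + 1) (1 - s\<^sup>2)) * (- 2 * s)) (at s)"
    by (rule DERIV_chain2[OF DERIV_flat_exp]) (auto intro!: derivative_eq_intros)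
  then show ?thesis
    by (simp add: bump_eq[abs_def] bump'_def mult_ac numeral_2_eq_2)
qed

lemma DERIV_bump': "(bump' has_real_derivative bump'' s) (at s)"
proof -
  have *: "((\<lambda>s. flat_exp 2 (1 - s\<^sup>2)) has_real_derivative
      (flat_exp (2 + 2) (1 - s\<^sup>2) - real 2 * flat_exp (2 + 1) (1 - s\<^sup>2)) * (- 2 * s)) (at s)"
    by (rule DERIV_chain2[OF DERIV_flat_exp]) (auto intro!: derivative_eq_intros)
  have "((\<lambda>s. - 2 * s) has_real_derivative - 2) (at s)"
    by (auto intro!: derivative_eq_intros)
  from DERIV_mult[OF this *] show ?thesis unfolding bump'_def [abs_def]
    by (rule DERIV_cong) (simp add: bump''_def algebra_simps power2_eq_square eval_nat_numeral)
qed

lemma continuous_on_bump'': "continuous_on A bump''"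
  unfolding bump''_def by (intro continuous_intros)

lemma bump_outside:
  assumes "\<bar>s\<bar> \<ge> 1"
  shows "bump s = 0" "bump' s = 0" "bump'' s = 0"
proof -
  have "s\<^sup>2 \<ge> 1" using assms abs_square_less_1 not_less by blast
  then show "bump s = 0" "bump' s = 0" "bump'' s = 0"
    by (simp_all add: bump_eq bump'_def bump''_def flat_exp_def)
qed

lemma bump_pos: "\<bar>s\<bar> < 1 \<Longrightarrow> bump s > 0"
  by (simp add: bump_def)

lemma bump_nonneg: "bump s \<ge> 0"
  by (simp add: bump_def)

lemma bump_minus: "bump (- s) = bump s"
  by (simp add: bump_def)

lemma integral_bump_pos: "(LINT t|lborel. bump t) > 0"
proof -
  have "(LINT t|lborel. std_mollifier t) = 1"
    using integral_std_mollifier bump_measurable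
    by (simp add: std_mollifier_def integral_completion)
  \<comment> \<open>Division by a mass of \<open>0\<close> yields \<open>0\<close> in HOL, so
    \<open>std_mollifier\<close> would vanish, contradicting its integral \<open>1\<close>.\<close>
  then have "(LINT t|lborel. bump t) \<noteq> 0"
    using bump_measurable by (auto simp: std_mollifier_def integral_completion)
  moreover have "(LINT t|lborel. bump t) \<ge> 0"
    by (simp add: bump_nonneg)
  ultimately show ?thesis by simp
qed

abbreviation bump_mass :: real where
  "bump_mass \<equiv> LINT t|lborel. bump t"

lemma mollifier_eq: "mollifier \<epsilon> s = bump (s / \<epsilon>) / (bump_mass * \<epsilon>)"
  using bump_measurable by (simp add: mollifier_def std_mollifier_def integral_completion)

definition mollifier' :: "real \<Rightarrow> real \<Rightarrow> real" where
  "mollifier' \<epsilon> s = bump' (s / \<epsilon>) / (bump_mass * \<epsilon>\<^sup>2)"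

definition mollifier'' :: "real \<Rightarrow> real \<Rightarrow> real" where
  "mollifier'' \<epsilon> s = bump'' (s / \<epsilon>) / (bump_mass * \<epsilon> ^ 3)"

lemma DERIV_mollifier: "\<epsilon> > 0 \<Longrightarrow> (mollifier \<epsilon> has_real_derivative mollifier' \<epsilon> s) (at s)"
  unfolding mollifier_eq[abs_def] mollifier'_def using integral_bump_pos
  by (auto intro!: derivative_eq_intros DERIV_chain2[OF DERIV_bump] simp: power2_eq_square)

lemma DERIV_mollifier': "\<epsilon> > 0 \<Longrightarrow> (mollifier' \<epsilon> has_real_derivative mollifier'' \<epsilon> s) (at s)"
  unfolding mollifier'_def[abs_def] mollifier''_def using integral_bump_pos
  by (auto intro!: derivative_eq_intros DERIV_chain2[OF DERIV_bump']
      simp: power2_eq_square power3_eq_cube)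

lemma mollifier_outside:
  assumes "\<epsilon> > 0" "\<bar>s\<bar> \<ge> \<epsilon>"
  shows "mollifier \<epsilon> s = 0" "mollifier' \<epsilon> s = 0" "mollifier'' \<epsilon> s = 0"
proof -
  have "\<bar>s / \<epsilon>\<bar> \<ge> 1" using assms by simp
  then show "mollifier \<epsilon> s = 0" "mollifier' \<epsilon> s = 0" "mollifier'' \<epsilon> s = 0"
    by (simp_all add: mollifier_eq mollifier'_def mollifier''_def bump_outside)
qed

lemma mollifier_pos: "\<epsilon> > 0 \<Longrightarrow> \<bar>s\<bar> < \<epsilon> \<Longrightarrow> mollifier \<epsilon> s > 0"
  using integral_bump_pos by (simp add: mollifier_eq bump_pos)

lemma mollifier_nonneg: "\<epsilon> > 0 \<Longrightarrow> mollifier \<epsilon> s \<ge> 0"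
  using integral_bump_pos by (simp add: mollifier_eq bump_nonneg)

lemma mollifier_minus: "mollifier \<epsilon> (- s) = mollifier \<epsilon> s"
  by (simp add: mollifier_eq bump_minus)

section \<open>Regularity, scaling and moments of the mollifier\<close>

lemma continuous_on_mollifier:
  assumes "\<epsilon> > 0"
  shows "continuous_on A (mollifier \<epsilon>)" "continuous_on A (mollifier' \<epsilon>)"
    "continuous_on A (mollifier'' \<epsilon>)"
proof -
  show "continuous_on A (mollifier \<epsilon>)"
    using assms by (intro DERIV_continuous_on[OF has_field_derivative_at_within[OF DERIV_mollifier]])
  show "continuous_on A (mollifier' \<epsilon>)"
    using assms by (intro DERIV_continuous_on[OF has_field_derivative_at_within[OF DERIV_mollifier']])
  show "continuous_on A (mollifier'' \<epsilon>)"
    unfolding mollifier''_def using integral_bump_pos assms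
    by (intro continuous_intros continuous_on_compose2[OF continuous_on_bump''[of UNIV]]) auto
qed

text \<open>By scaling, one constant serves all \<open>\<epsilon>\<close>: the bump and its
  derivative are bounded, values of the mollifier carry \<open>1 / \<epsilon>\<close>, and its
  derivative carries one more such factor.\<close>

lemma mollifier_lipschitz:
  obtains B where "B > 0"
    "\<And>\<epsilon> s. \<epsilon> > 0 \<Longrightarrow> \<bar>mollifier \<epsilon> s\<bar> \<le> B / \<epsilon>"
    "\<And>\<epsilon> s t. \<epsilon> > 0 \<Longrightarrow> \<bar>mollifier \<epsilon> s - mollifier \<epsilon> t\<bar> \<le> B / \<epsilon>\<^sup>2 * \<bar>s - t\<bar>"
    "\<And>\<epsilon> s. \<epsilon> > 0 \<Longrightarrow> \<bar>mollifier' \<epsilon> s\<bar> \<le> B / \<epsilon>\<^sup>2"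
proof -
  have c': "continuous_on {-1..1} bump'"
    by (rule DERIV_continuous_on[OF has_field_derivative_at_within[OF DERIV_bump']])
  have "bounded (bump' ` {-1..1})"
    by (intro compact_imp_bounded compact_continuous_image c') simp
  then obtain B0 where B0: "\<And>s. s \<in> {-1..1} \<Longrightarrow> \<bar>bump' s\<bar> \<le> B0"
    unfolding bounded_iff by (metis imageI real_norm_def)
  \<comment> \<open>The maximum with \<open>1\<close> lets the same constant bound
    \<open>bump\<close> itself, whose values are at most \<open>1\<close>.\<close>
  define B where "B = max B0 1"
  have B: "\<bar>bump' s\<bar> \<le> B" for s
  proof (cases "\<bar>s\<bar> \<ge> 1")
    case True
    then show ?thesis using bump_outside(2)[of s] by (simp add: B_def)
  next
    case False
    then have "s \<in> {-1..1}" by auto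
    from B0[OF this] show ?thesis by (simp add: B_def)
  qed
  have B1: "B \<ge> 1" by (simp add: B_def)
  have lip: "\<bar>bump s - bump t\<bar> \<le> B * \<bar>s - t\<bar>" for s t
    using field_differentiable_bound[of UNIV bump bump' B s t] DERIV_bump B
    by auto
  have bd: "\<bar>bump s\<bar> \<le> 1" for s
    by (auto simp: bump_def abs_square_less_1 divide_simps less_imp_le)
  have m: "bump_mass > 0" by (rule integral_bump_pos)
  show ?thesis
  proof (rule that[of "B / bump_mass"])
    show "B / bump_mass > 0" using m B1 by simp
  next
    fix \<epsilon> s :: real assume e: "\<epsilon> > 0"
    have "\<bar>bump (s / \<epsilon>)\<bar> \<le> B" using bd[of "s / \<epsilon>"] B1 by linarith
    then show "\<bar>mollifier \<epsilon> s\<bar> \<le> B / bump_mass / \<epsilon>"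
      using m e by (simp add: mollifier_eq divide_simps)
  next
    fix \<epsilon> s t :: real assume e: "\<epsilon> > 0"
    have "\<bar>bump (s / \<epsilon>) - bump (t / \<epsilon>)\<bar> \<le> B * (\<bar>s - t\<bar> / \<epsilon>)"
      using lip[of "s / \<epsilon>" "t / \<epsilon>"] e by (simp flip: diff_divide_distrib)
    then have "\<bar>bump (s / \<epsilon>) - bump (t / \<epsilon>)\<bar> / (bump_mass * \<epsilon>) \<le> B * (\<bar>s - t\<bar> / \<epsilon>) / (bump_mass * \<epsilon>)"
      using m e by (intro divide_right_mono) auto
    also have "\<bar>bump (s / \<epsilon>) - bump (t / \<epsilon>)\<bar> / (bump_mass * \<epsilon>) = \<bar>mollifier \<epsilon> s - mollifier \<epsilon> t\<bar>"
      using m e by (simp add: mollifier_eq flip: diff_divide_distrib)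
    finally show "\<bar>mollifier \<epsilon> s - mollifier \<epsilon> t\<bar> \<le> B / bump_mass / \<epsilon>\<^sup>2 * \<bar>s - t\<bar>"
      by (simp add: power2_eq_square mult_ac)
  next
    fix \<epsilon> s :: real assume e: "\<epsilon> > 0"
    show "\<bar>mollifier' \<epsilon> s\<bar> \<le> B / bump_mass / \<epsilon>\<^sup>2"
      using m e B[of "s / \<epsilon>"] by (simp add: mollifier'_def abs_mult divide_simps)
  qed
qed

lemma
  assumes e: "\<epsilon> > 0"
  shows integrable_mollifier: "integrable lborel (mollifier \<epsilon>)"
    and integral_mollifier: "(LINT s|lborel. mollifier \<epsilon> s) = 1"
proof -
  have i: "integrable lborel (\<lambda>s. bump (0 + inverse \<epsilon> * s))"
    using e bump_integrable by (subst lborel_integrable_real_affine_iff) auto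
  have eq: "mollifier \<epsilon> = (\<lambda>s. bump (0 + inverse \<epsilon> * s) * (1 / (bump_mass * \<epsilon>)))"
    by (auto simp: mollifier_eq field_simps)
  show "integrable lborel (mollifier \<epsilon>)"
    unfolding eq using i by (rule integrable_mult_left)
  have "bump_mass = inverse \<epsilon> * (LINT s|lborel. bump (0 + inverse \<epsilon> * s))"
    using e lborel_integral_real_affine[of "inverse \<epsilon>" bump 0] by simp
  then have "(LINT s|lborel. bump (0 + inverse \<epsilon> * s)) = bump_mass * \<epsilon>"
    using e by (simp add: field_simps)
  then show "(LINT s|lborel. mollifier \<epsilon> s) = 1"
    unfolding eq using integral_bump_pos e by simp
qed

text \<open>Here \<open>\<kappa>\<close> is the second moment of the mollifier of width
  \<open>1\<close>, and substitution produces \<open>\<epsilon>\<^sup>2\<close>. Its positivity,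
  which comes from the bump being positive on \<open>{0<..<1}\<close>, later allows a second
  derivative to be recovered from a mollification defect.\<close>

lemma second_moment_mollifier:
  obtains \<kappa> where "\<kappa> > 0"
    "\<And>\<epsilon>. \<epsilon> > 0 \<Longrightarrow> (LINT s|lborel. s\<^sup>2 * mollifier \<epsilon> s) = \<kappa> * \<epsilon>\<^sup>2"
proof -
  define \<mu> where "\<mu> = (LINT s|lborel. s\<^sup>2 * bump s)"
  have int: "integrable lborel (\<lambda>s. s\<^sup>2 * bump s)"
    by (rule Bochner_Integration.integrable_bound[OF bump_integrable])
      (use bump_measurable in \<open>auto simp: bump_def abs_mult abs_square_less_1 intro!: mult_left_le_one_le less_imp_le\<close>)
  have "\<mu> \<noteq> 0"
  proof
    assume "\<mu> = 0"
    then have "AE s in lborel. s\<^sup>2 * bump s = 0"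
      using int unfolding \<mu>_def by (subst (asm) integral_nonneg_eq_0_iff_AE) (auto simp: bump_nonneg)
    then have "AE s in lborel. s \<notin> {0<..<1::real}"
    proof eventually_elim
      case (elim s)
      then show ?case using bump_pos[of s] by auto
    qed
    then have "emeasure lborel {0<..<1::real} = 0"
      by (subst (asm) AE_iff_measurable[of "{0<..<1::real}"]) auto
    then show False by simp
  qed
  moreover have "\<mu> \<ge> 0" unfolding \<mu>_def by (simp add: bump_nonneg)
  ultimately have \<mu>: "\<mu> > 0" by simp
  show ?thesis
  proof (rule that[of "\<mu> / bump_mass"])
    show "\<mu> / bump_mass > 0" using \<mu> integral_bump_pos by simp
    fix \<epsilon> :: real assume e: "\<epsilon> > 0"
    have "\<mu> = inverse \<epsilon> * (LINT s|lborel. (0 + inverse \<epsilon> * s)\<^sup>2 * bump (0 + inverse \<epsilon> * s))"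
      unfolding \<mu>_def
      using e lborel_integral_real_affine[of "inverse \<epsilon>" "\<lambda>s. s\<^sup>2 * bump s" 0] by simp
    also have "(LINT s|lborel. (0 + inverse \<epsilon> * s)\<^sup>2 * bump (0 + inverse \<epsilon> * s))
        = (LINT s|lborel. bump_mass / \<epsilon> * (s\<^sup>2 * mollifier \<epsilon> s))"
      using e integral_bump_pos
      by (intro Bochner_Integration.integral_cong)
        (auto simp: mollifier_eq field_simps power2_eq_square)
    also have "\<dots> = bump_mass / \<epsilon> * (LINT s|lborel. s\<^sup>2 * mollifier \<epsilon> s)"
      by (rule integral_mult_right_zero)
    finally show "(LINT s|lborel. s\<^sup>2 * mollifier \<epsilon> s) = \<mu> / bump_mass * \<epsilon>\<^sup>2"
      using e integral_bump_pos by (simp add: field_simps power2_eq_square)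
  qed
qed

section \<open>Convolution with compactly supported kernels\<close>

text \<open>The shift sits in the kernel, so that continuity and derivatives in \<open>t\<close>
  concern the smooth factor only. \<open>convolution_component\<close> identifies this with the
  components of \<open>convolution\<close>.\<close>

definition conv :: "(real \<Rightarrow> real) \<Rightarrow> (real \<Rightarrow> real) \<Rightarrow> real \<Rightarrow> real" where
  "conv u k t = (LINT y|lborel. u y * k (t - y))"

definition loc_integrable :: "(real \<Rightarrow> real) \<Rightarrow> bool" where
  "loc_integrable u \<longleftrightarrow> (\<forall>R. integrable lborel (\<lambda>y. indicator {- R..R} y * u y))"

definition kernel :: "real \<Rightarrow> (real \<Rightarrow> real) \<Rightarrow> bool" where
  "kernel \<rho> k \<longleftrightarrow> continuous_on UNIV k \<and> (\<forall>s. \<bar>s\<bar> \<ge> \<rho> \<longrightarrow> k s = 0)"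

lemma kernel_measurable: "kernel \<rho> k \<Longrightarrow> k \<in> borel_measurable borel"
  by (auto simp: kernel_def intro: borel_measurable_continuous_onI)

lemma kernel_outside: "kernel \<rho> k \<Longrightarrow> \<bar>s\<bar> \<ge> \<rho> \<Longrightarrow> k s = 0"
  by (simp add: kernel_def)

lemma kernel_mono: "kernel \<rho> k \<Longrightarrow> \<rho> \<le> \<rho>' \<Longrightarrow> kernel \<rho>' k"
  by (auto simp: kernel_def)

lemma kernel_bounded:
  assumes "kernel \<rho> k"
  obtains M where "M > 0" "\<And>s. \<bar>k s\<bar> \<le> M"
proof -
  have "continuous_on {- \<rho>..\<rho>} k"
    using assms continuous_on_subset by (auto simp: kernel_def)
  then have "bounded (k ` {- \<rho>..\<rho>})"
    by (intro compact_imp_bounded compact_continuous_image) auto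
  then obtain B where B: "\<And>s. s \<in> {- \<rho>..\<rho>} \<Longrightarrow> \<bar>k s\<bar> \<le> B"
    unfolding bounded_iff by (metis imageI real_norm_def)
  show ?thesis
  proof (rule that[of "max B 1"])
    fix s
    show "\<bar>k s\<bar> \<le> max B 1"
    proof (cases "\<bar>s\<bar> \<ge> \<rho>")
      case True
      then show ?thesis using kernel_outside[OF assms] by simp
    next
      case False
      then have "s \<in> {- \<rho>..\<rho>}" by auto
      from B[OF this] show ?thesis by simp
    qed
  qed simp
qed

text \<open>Truncations to \<open>{- n..n}\<close> are measurable because integrable, and at each
  point they eventually equal \<open>u\<close>.\<close>

lemma loc_integrable_measurable:
  assumes "loc_integrable u"
  shows "u \<in> borel_measurable borel"
proof (rule borel_measurable_LIMSEQ_real)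
  fix y :: real
  obtain N where N: "\<bar>y\<bar> < real N" using reals_Archimedean2 by blast
  show "(\<lambda>n. indicator {- real n..real n} y * u y) \<longlonglongrightarrow> u y"
    by (rule tendsto_eventually, rule eventually_sequentiallyI[of N])
      (use N in \<open>auto simp: indicator_def abs_less_iff\<close>)
next
  show "(\<lambda>y. indicator {- real n..real n} y * u y) \<in> borel_measurable borel" for n
    using assms borel_measurable_integrable unfolding loc_integrable_def by fastforce
qed

lemma loc_integrable_interval:
  assumes "loc_integrable u"
  shows "integrable lborel (\<lambda>y. indicator {a..b} y * u y)"
proof (rule Bochner_Integration.integrable_bound)
  let ?R = "max \<bar>a\<bar> \<bar>b\<bar>"
  show "integrable lborel (\<lambda>y. indicator {- ?R..?R} y * u y)"
    using assms by (simp add: loc_integrable_def)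
qed (use loc_integrable_measurable[OF assms] in \<open>auto simp: indicator_def abs_le_iff max_def\<close>)

lemma loc_integrable_continuous:
  assumes "continuous_on UNIV u"
  shows "loc_integrable u"
proof -
  have "set_integrable lborel {- R..R} u" for R
    using assms continuous_on_subset borel_integrable_atLeastAtMost' by blast
  then show ?thesis by (simp add: loc_integrable_def set_integrable_def)
qed

lemma loc_integrable_diff:
  "loc_integrable u \<Longrightarrow> loc_integrable v \<Longrightarrow> loc_integrable (\<lambda>y. u y - v y)"
  by (auto simp: loc_integrable_def right_diff_distrib)

text \<open>For \<open>t\<close> within \<open>r\<close> of \<open>t0\<close> the support of the
  kernel confines \<open>y\<close> to one fixed interval. The majorant is thus independent of
  \<open>t\<close>, as dominated convergence requires.\<close>

lemma kernel_dominated: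
  assumes k: "kernel \<rho> k" and M: "\<And>s. \<bar>k s\<bar> \<le> M" and t: "\<bar>t - t0\<bar> \<le> r"
  shows "\<bar>u y * k (t - y)\<bar> \<le> M * \<bar>indicator {t0 - r - \<rho>..t0 + r + \<rho>} y * u y\<bar>"
proof (cases "\<bar>t - y\<bar> \<ge> \<rho>")
  case True
  have "0 \<le> M" using M[of 0] by linarith
  with True show ?thesis using kernel_outside[OF k] by simp
next
  case False
  then have "y \<in> {t0 - r - \<rho>..t0 + r + \<rho>}" using t by (auto simp: abs_le_iff)
  then show ?thesis using mult_right_mono[OF M[of "t - y"], of "\<bar>u y\<bar>"]
    by (simp add: abs_mult mult_ac)
qed

lemma conv_integrable:
  assumes u: "loc_integrable u" and k: "kernel \<rho> k"
  shows "integrable lborel (\<lambda>y. u y * k (t - y))"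
proof -
  obtain M where M: "M > 0" "\<And>s. \<bar>k s\<bar> \<le> M" using kernel_bounded[OF k] by blast
  note [measurable] = loc_integrable_measurable[OF u] kernel_measurable[OF k]
  show ?thesis
  proof (rule Bochner_Integration.integrable_bound)
    show "integrable lborel (\<lambda>y. M * \<bar>indicator {t - 0 - \<rho>..t + 0 + \<rho>} y * u y\<bar>)"
      by (intro integrable_mult_right integrable_abs loc_integrable_interval u)
    show "AE y in lborel. norm (u y * k (t - y)) \<le> norm (M * \<bar>indicator {t - 0 - \<rho>..t + 0 + \<rho>} y * u y\<bar>)"
      using kernel_dominated[OF k M(2), of t t 0 u] M(1) by (intro AE_I2) (auto simp: abs_mult)
  qed measurable
qed

lemma conv_shift: "conv u k t = (LINT s|lborel. u (t - s) * k s)"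
  unfolding conv_def by (subst lborel_integral_real_affine[of "-1" _ t]) auto

lemma Bseq_dist_bound:
  fixes X :: "nat \<Rightarrow> real"
  assumes "X \<longlonglongrightarrow> x"
  obtains r where "\<And>n. \<bar>X n - x\<bar> \<le> r"
proof -
  have "Bseq (\<lambda>n. X n - x)"
    using assms by (intro convergent_imp_Bseq convergentI[of _ "x - x"] tendsto_diff tendsto_const)
  then show ?thesis using that by (auto simp: Bseq_def)
qed

lemma continuous_on_conv:
  assumes u: "loc_integrable u" and k: "kernel \<rho> k"
  shows "continuous_on A (conv u k)"
proof (rule continuous_at_imp_continuous_on, rule ballI)
  fix t0
  obtain M where M: "M > 0" "\<And>s. \<bar>k s\<bar> \<le> M" using kernel_bounded[OF k] by blast
  note [measurable] = loc_integrable_measurable[OF u] kernel_measurable[OF k]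
  show "isCont (conv u k) t0"
    unfolding continuous_at_sequentially comp_def
  proof (intro allI impI)
    fix X :: "nat \<Rightarrow> real" assume X: "X \<longlonglongrightarrow> t0"
    then obtain r where r: "\<And>n. \<bar>X n - t0\<bar> \<le> r" by (rule Bseq_dist_bound) blast
    show "(\<lambda>n. conv u k (X n)) \<longlonglongrightarrow> conv u k t0"
      unfolding conv_def
    proof (rule integral_dominated_convergence)
      show "integrable lborel (\<lambda>y. M * \<bar>indicator {t0 - r - \<rho>..t0 + r + \<rho>} y * u y\<bar>)"
        by (intro integrable_mult_right integrable_abs loc_integrable_interval u)
      show "AE y in lborel. norm (u y * k (X n - y)) \<le> M * \<bar>indicator {t0 - r - \<rho>..t0 + r + \<rho>} y * u y\<bar>" for n
        using kernel_dominated[OF k M(2) r] by auto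
      have "isCont k s" for s
        using k by (simp add: kernel_def continuous_on_eq_continuous_at)
      then show "AE y in lborel. (\<lambda>n. u y * k (X n - y)) \<longlonglongrightarrow> u y * k (t0 - y)"
        by (intro AE_I2 tendsto_intros isCont_tendsto_compose[of _ k] X)
    qed measurable
  qed
qed

text \<open>Difference quotients of \<open>k\<close> are bounded by a bound for \<open>k'\<close>
  and, along a bounded sequence of increments, vanish outside one interval. Dominated convergence
  then moves the derivative onto the kernel, although \<open>u\<close> is only locally
  integrable.\<close>

lemma DERIV_conv:
  assumes u: "loc_integrable u" and k: "kernel \<rho> k" and k': "kernel \<rho> k'"
    and deriv: "\<And>s. (k has_real_derivative k' s) (at s)"
  shows "(conv u k has_real_derivative conv u k' t) (at t)"
  unfolding DERIV_def tendsto_at_iff_sequentially comp_def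
proof (intro allI impI)
  obtain M where M: "M > 0" "\<And>s. \<bar>k' s\<bar> \<le> M" using kernel_bounded[OF k'] by blast
  note [measurable] = loc_integrable_measurable[OF u] kernel_measurable[OF k] kernel_measurable[OF k']
  have lip: "\<bar>k a - k b\<bar> \<le> M * \<bar>a - b\<bar>" for a b
    using field_differentiable_bound[of UNIV k k' M a b] deriv M(2) by auto
  fix X :: "nat \<Rightarrow> real" assume X0: "\<forall>n. X n \<in> UNIV - {0}" and X: "X \<longlonglongrightarrow> 0"
  from X obtain r where r: "\<And>n. \<bar>X n - 0\<bar> \<le> r" by (rule Bseq_dist_bound) blast
  have nz: "X n \<noteq> 0" for n using X0 by simp
  have "(\<lambda>n. LINT y|lborel. u y * ((k (t + X n - y) - k (t - y)) / X n)) \<longlonglongrightarrow> conv u k' t"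
    unfolding conv_def
  proof (rule integral_dominated_convergence)
    show "integrable lborel (\<lambda>y. M * \<bar>indicator {t - r - \<rho>..t + r + \<rho>} y * u y\<bar>)"
      by (intro integrable_mult_right integrable_abs loc_integrable_interval u)
    show "AE y in lborel. norm (u y * ((k (t + X n - y) - k (t - y)) / X n))
        \<le> M * \<bar>indicator {t - r - \<rho>..t + r + \<rho>} y * u y\<bar>" for n
    proof (rule AE_I2)
      fix y
      have b: "\<bar>(k (t + X n - y) - k (t - y)) / X n\<bar> \<le> M"
        using lip[of "t + X n - y" "t - y"] nz[of n] by (simp add: field_simps)
      have z: "(k (t + X n - y) - k (t - y)) / X n = 0" if "y \<notin> {t - r - \<rho>..t + r + \<rho>}"
      proof -
        have "\<bar>t + X n - y\<bar> \<ge> \<rho>" "\<bar>t - y\<bar> \<ge> \<rho>" using that r[of n] by (auto simp: abs_le_iff)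
        then show ?thesis using kernel_outside[OF k] by simp
      qed
      show "norm (u y * ((k (t + X n - y) - k (t - y)) / X n))
          \<le> M * \<bar>indicator {t - r - \<rho>..t + r + \<rho>} y * u y\<bar>"
        using z mult_right_mono[OF b, of "\<bar>u y\<bar>"]
        by (cases "y \<in> {t - r - \<rho>..t + r + \<rho>}") (auto simp: abs_mult mult_ac)
    qed
    show "AE y in lborel. (\<lambda>n. u y * ((k (t + X n - y) - k (t - y)) / X n)) \<longlonglongrightarrow> u y * k' (t - y)"
    proof (intro AE_I2 tendsto_intros)
      fix y
      have "((\<lambda>h. (k (t - y + h) - k (t - y)) / h) \<longlongrightarrow> k' (t - y)) (at 0)"
        using deriv[of "t - y"] by (simp add: DERIV_def)
      then show "(\<lambda>n. (k (t + X n - y) - k (t - y)) / X n) \<longlonglongrightarrow> k' (t - y)"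
        using X X0 unfolding tendsto_at_iff_sequentially comp_def
        by (auto simp: algebra_simps)
    qed
  qed measurable
  moreover have "(LINT y|lborel. u y * ((k (t + X n - y) - k (t - y)) / X n)) =
      (conv u k (t + X n) - conv u k t) / X n" for n
    unfolding conv_def
    by (subst Bochner_Integration.integral_diff[symmetric])
      (auto intro!: conv_integrable[OF u k] Bochner_Integration.integral_cong
        simp: right_diff_distrib diff_divide_distrib simp flip: integral_divide_zero)
  ultimately show "(\<lambda>n. (conv u k (t + X n) - conv u k t) / X n) \<longlonglongrightarrow> conv u k' t"
    by (simp only:)
qed

lemma conv_diff:
  assumes "loc_integrable u" "loc_integrable v" "kernel \<rho> k"
  shows "conv (\<lambda>y. u y - v y) k t = conv u k t - conv v k t"
  unfolding conv_def left_diff_distrib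
  by (intro Bochner_Integration.integral_diff conv_integrable[where \<rho> = \<rho>] assms)

text \<open>By Fubini both sides integrate \<open>u\<close> against the convolution of the two
  kernels, which is symmetric under the substitution of \<open>t + z - y\<close> for
  \<open>y\<close>.\<close>

lemma conv_commute:
  assumes u: "loc_integrable u" and k: "kernel \<rho> k" and l: "kernel \<rho> l"
  shows "conv (conv u k) l t = conv (conv u l) k t"
proof -
  note [measurable] = loc_integrable_measurable[OF u] kernel_measurable[OF k] kernel_measurable[OF l]
  have swap: "conv (conv u k) l t = (LINT z|lborel. u z * (LINT y|lborel. k (y - z) * l (t - y)))"
    if k: "kernel \<rho> k" and l: "kernel \<rho> l" for k l
  proof -
    obtain M where M: "M > 0" "\<And>s. \<bar>k s\<bar> \<le> M" using kernel_bounded[OF k] by blast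
    note [measurable] = kernel_measurable[OF k] kernel_measurable[OF l]
    \<comment> \<open>Where both kernels are nonzero, \<open>z\<close> lies within
      \<open>2 * \<rho>\<close> of \<open>t\<close>. This gives a majorant that is a product of a
      function of \<open>y\<close> and a function of \<open>z\<close>.\<close>
    let ?J = "{t - \<rho> - \<rho>..t + \<rho> + \<rho>}"
    have li: "integrable lborel (\<lambda>y. 1 * l (t - y))"
      by (rule conv_integrable[OF loc_integrable_continuous l]) auto
    have dom: "integrable (lborel \<Otimes>\<^sub>M lborel)
        (\<lambda>(y, z). l (t - y) * (M * (indicator ?J z * u z)))"
    proof (rule lborel_pair.Fubini_integrable)
      show "(\<lambda>(y, z). l (t - y) * (M * (indicator ?J z * u z))) \<in> borel_measurable (lborel \<Otimes>\<^sub>M lborel)"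
        by measurable
      have ui: "integrable lborel (\<lambda>z. M * (indicator ?J z * u z))"
        by (intro integrable_mult_right loc_integrable_interval u)
      show "AE y in lborel. integrable lborel
          (\<lambda>z. case (y, z) of (y, z) \<Rightarrow> l (t - y) * (M * (indicator ?J z * u z)))"
        using ui by (intro AE_I2) simp
      show "integrable lborel (\<lambda>y. LINT z|lborel. norm
          (case (y, z) of (y, z) \<Rightarrow> l (t - y) * (M * (indicator ?J z * u z))))"
        using li by (simp add: abs_mult)
    qed
    have int: "integrable (lborel \<Otimes>\<^sub>M lborel) (\<lambda>(y, z). u z * k (y - z) * l (t - y))"
    proof (rule Bochner_Integration.integrable_bound[OF dom])
      show "(\<lambda>(y, z). u z * k (y - z) * l (t - y)) \<in> borel_measurable (lborel \<Otimes>\<^sub>M lborel)"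
        by measurable
      show "AE w in lborel \<Otimes>\<^sub>M lborel. norm (case w of (y, z) \<Rightarrow> u z * k (y - z) * l (t - y)) \<le>
          norm (case w of (y, z) \<Rightarrow> l (t - y) * (M * (indicator ?J z * u z)))"
      proof (intro AE_I2, clarify)
        fix y z
        show "norm (u z * k (y - z) * l (t - y)) \<le> norm (l (t - y) * (M * (indicator ?J z * u z)))"
        proof (cases "\<bar>t - y\<bar> \<ge> \<rho>")
          case True
          then show ?thesis using kernel_outside[OF l] by simp
        next
          case False
          then have "\<bar>u z * k (y - z)\<bar> \<le> M * \<bar>indicator ?J z * u z\<bar>"
            by (intro kernel_dominated[OF k M(2)]) auto
          from mult_right_mono[OF this, of "\<bar>l (t - y)\<bar>"] show ?thesis
            using M(1) by (simp add: abs_mult mult_ac)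
        qed
      qed
    qed
    have "conv (conv u k) l t = (LINT y|lborel. LINT z|lborel. u z * k (y - z) * l (t - y))"
      unfolding conv_def by simp
    also have "\<dots> = (LINT z|lborel. LINT y|lborel. u z * k (y - z) * l (t - y))"
      using lborel_pair.Fubini_integral[OF int] by simp
    finally show ?thesis by (simp add: mult.assoc)
  qed
  have "(LINT y|lborel. k (y - z) * l (t - y)) = (LINT y|lborel. l (y - z) * k (t - y))" for z
    by (subst lborel_integral_real_affine[of "-1" _ "t + z"]) (auto simp: algebra_simps)
  then show ?thesis
    by (simp add: swap[OF k l] swap[OF l k])
qed

section \<open>Cauchy-Schwarz estimates\<close>

lemma integral_interval_const:
  "a \<le> b \<Longrightarrow> (LINT y|lborel. indicator {a..b} y * c) = (b - a) * (c::real)"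
  by simp

text \<open>The integral of \<open>(c * f x - d * g x)\<^sup>2\<close> is a nonnegative quadratic
  form in \<open>c\<close> and \<open>d\<close>; evaluating it at \<open>c = B\<close>,
  \<open>d = A\<close> gives the discriminant inequality when \<open>A\<close> is nonzero.\<close>

lemma integral_Cauchy_Schwarz:
  fixes f g :: "'a \<Rightarrow> real"
  assumes f: "f \<in> borel_measurable M" and g: "g \<in> borel_measurable M"
    and f2: "integrable M (\<lambda>x. (f x)\<^sup>2)" and g2: "integrable M (\<lambda>x. (g x)\<^sup>2)"
  shows "integrable M (\<lambda>x. f x * g x)"
    and "\<bar>LINT x|M. f x * g x\<bar> \<le> sqrt (LINT x|M. (f x)\<^sup>2) * sqrt (LINT x|M. (g x)\<^sup>2)"
proof -
  note [measurable] = f g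
  show i: "integrable M (\<lambda>x. f x * g x)"
  proof (rule Bochner_Integration.integrable_bound)
    show "integrable M (\<lambda>x. (f x)\<^sup>2 + (g x)\<^sup>2)" using f2 g2 by simp
    show "AE x in M. norm (f x * g x) \<le> norm ((f x)\<^sup>2 + (g x)\<^sup>2)"
    proof (rule AE_I2)
      fix x
      have "0 \<le> (\<bar>f x\<bar> - \<bar>g x\<bar>)\<^sup>2" by simp
      then have "2 * (\<bar>f x\<bar> * \<bar>g x\<bar>) \<le> (f x)\<^sup>2 + (g x)\<^sup>2" by (simp add: power2_diff)
      moreover have "0 \<le> \<bar>f x\<bar> * \<bar>g x\<bar>" by simp
      ultimately show "norm (f x * g x) \<le> norm ((f x)\<^sup>2 + (g x)\<^sup>2)"
        unfolding real_norm_def abs_mult by linarith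
    qed
  qed measurable
  define A B C where "A = (LINT x|M. (f x)\<^sup>2)" and "B = (LINT x|M. f x * g x)"
    and "C = (LINT x|M. (g x)\<^sup>2)"
  have A: "A \<ge> 0" and C: "C \<ge> 0" by (simp_all add: A_def C_def)
  have q: "0 \<le> A * c\<^sup>2 - 2 * c * d * B + C * d\<^sup>2" for c d
  proof -
    have "0 \<le> (LINT x|M. (c * f x - d * g x)\<^sup>2)" by simp
    also have "(\<lambda>x. (c * f x - d * g x)\<^sup>2) = (\<lambda>x. c\<^sup>2 * (f x)\<^sup>2 - 2 * c * d * (f x * g x) + d\<^sup>2 * (g x)\<^sup>2)"
      by (auto simp: power2_eq_square algebra_simps)
    also have "(LINT x|M. c\<^sup>2 * (f x)\<^sup>2 - 2 * c * d * (f x * g x) + d\<^sup>2 * (g x)\<^sup>2)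
        = c\<^sup>2 * A - 2 * c * d * B + d\<^sup>2 * C"
      unfolding A_def B_def C_def using f2 g2 i by simp
    finally show ?thesis by (simp add: mult_ac)
  qed
  have "B\<^sup>2 \<le> A * C"
  proof (cases "A = 0")
    case True
    have "B = 0"
    proof (rule ccontr)
      assume "B \<noteq> 0"
      \<comment> \<open>For \<open>A = 0\<close> the form is only linear in \<open>c\<close>; this
        choice gives it the negative value \<open>- C - 2\<close>.\<close>
      have "0 \<le> A * ((C + 1) / B)\<^sup>2 - 2 * ((C + 1) / B) * 1 * B + C * 1\<^sup>2" by (rule q)
      then have "2 * (C + 1) \<le> C" using True \<open>B \<noteq> 0\<close> by simp
      with C show False by simp
    qed
    then show ?thesis using A C by simp
  next
    case False
    have "0 \<le> A * B\<^sup>2 - 2 * B * A * B + C * A\<^sup>2" by (rule q)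
    then have "0 \<le> A * (A * C - B\<^sup>2)" by (simp add: power2_eq_square algebra_simps)
    then show ?thesis using A False by (simp add: zero_le_mult_iff)
  qed
  then have "\<bar>B\<bar> \<le> sqrt (A * C)" by (simp add: real_le_rsqrt)
  then show "\<bar>LINT x|M. f x * g x\<bar> \<le> sqrt (LINT x|M. (f x)\<^sup>2) * sqrt (LINT x|M. (g x)\<^sup>2)"
    by (simp add: real_sqrt_mult A_def B_def C_def)
qed

text \<open>The \<open>L2\<close> norm of the bounded factor is at most \<open>c\<close> times the
  square root of the length of its support. For a kernel of width \<open>\<epsilon>\<close> this
  gains a factor of order \<open>sqrt \<epsilon>\<close>.\<close>

lemma L2_pairing_le:
  assumes g: "g \<in> borel_measurable borel" and g2: "integrable lborel (\<lambda>y. (g y)\<^sup>2)"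
    and gK: "(LINT y|lborel. (g y)\<^sup>2) \<le> K\<^sup>2" and K: "K \<ge> 0"
    and w: "w \<in> borel_measurable borel" and ab: "a \<le> b"
    and wc: "\<And>y. \<bar>w y\<bar> \<le> c * indicator {a..b} y" and c: "c \<ge> 0"
  shows "\<bar>LINT y|lborel. g y * w y\<bar> \<le> K * c * sqrt (b - a)"
proof -
  have le: "(w y)\<^sup>2 \<le> indicator {a..b} y * c\<^sup>2" for y
    using power_mono[OF wc[of y], of 2] by (auto simp: indicator_def split: if_splits)
  have ci: "integrable lborel (\<lambda>y. indicator {a..b} y * c\<^sup>2)"
    by (intro integrable_mult_left integrable_real_indicator) (auto simp: emeasure_lborel_Icc_eq)
  have w2: "integrable lborel (\<lambda>y. (w y)\<^sup>2)"
    by (rule Bochner_Integration.integrable_bound[OF ci]) (use w le in auto)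
  have "(LINT y|lborel. (w y)\<^sup>2) \<le> (LINT y|lborel. indicator {a..b} y * c\<^sup>2)"
    by (rule integral_mono[OF w2 ci le])
  also have "\<dots> = (b - a) * c\<^sup>2" by (rule integral_interval_const[OF ab])
  finally have "sqrt (LINT y|lborel. (w y)\<^sup>2) \<le> sqrt ((b - a) * c\<^sup>2)" by simp
  also have "\<dots> = c * sqrt (b - a)" using c by (simp add: real_sqrt_mult)
  finally have 1: "sqrt (LINT y|lborel. (w y)\<^sup>2) \<le> c * sqrt (b - a)" .
  have 2: "sqrt (LINT y|lborel. (g y)\<^sup>2) \<le> K"
    using gK K real_le_lsqrt by simp
  have "\<bar>LINT y|lborel. g y * w y\<bar> \<le> sqrt (LINT y|lborel. (g y)\<^sup>2) * sqrt (LINT y|lborel. (w y)\<^sup>2)"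
    by (rule integral_Cauchy_Schwarz(2)) (use g w g2 w2 in auto)
  also have "\<dots> \<le> K * (c * sqrt (b - a))"
    by (intro mult_mono 1 2) (use K in auto)
  finally show ?thesis by (simp add: mult.assoc)
qed

lemma kernel_mollifier:
  assumes "\<epsilon> > 0"
  shows "kernel \<epsilon> (mollifier \<epsilon>)" "kernel \<epsilon> (mollifier' \<epsilon>)" "kernel \<epsilon> (mollifier'' \<epsilon>)"
  using assms continuous_on_mollifier[OF assms, of UNIV] mollifier_outside[OF assms]
  by (auto simp: kernel_def)

section \<open>Growth of mollified functions\<close>

lemma abs_integral_le_interval:
  fixes h :: "real \<Rightarrow> real"
  assumes "\<And>y. \<bar>h y\<bar> \<le> c * indicator {a..b} y" and "a \<le> b" and "c \<ge> 0"
  shows "\<bar>LINT y|lborel. h y\<bar> \<le> c * (b - a)"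
proof (cases "integrable lborel h")
  case True
  have "\<bar>LINT y|lborel. h y\<bar> \<le> (LINT y|lborel. \<bar>h y\<bar>)"
    by (rule integral_abs_bound)
  also have "\<dots> \<le> (LINT y|lborel. c * indicator {a..b} y)"
    by (intro integral_mono integrable_abs True integrable_mult_right integrable_real_indicator assms)
      (auto simp: emeasure_lborel_Icc_eq)
  also have "\<dots> = c * (b - a)" using assms by simp
  finally show ?thesis .
next
  \<comment> \<open>A non-integrable function has integral \<open>0\<close> by convention, so the
    bound holds in this case too.\<close>
  case False
  then show ?thesis using assms by (simp add: not_integrable_integral_eq)
qed

lemma integrable_mult_mollifier:
  assumes "\<epsilon> > 0" "continuous_on UNIV h"
  shows "integrable lborel (\<lambda>y. h y * mollifier \<epsilon> y)"
  using conv_integrable[OF loc_integrable_continuous[OF assms(2)] kernel_mollifier(1)[OF assms(1)], of 0]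
  by (simp add: mollifier_minus)

text \<open>Convolutions commute, hence the defect of \<open>u * k\<close> is the defect of
  \<open>u\<close> convolved with \<open>k\<close>, and Cauchy-Schwarz applies. The resulting bound
  does not depend on \<open>\<tau>\<close>.\<close>

lemma mollification_defect_bound:
  assumes u: "loc_integrable u" and k: "kernel \<rho> k" and M: "\<And>s. \<bar>k s\<bar> \<le> M"
    and \<tau>: "0 < \<tau>" "\<tau> \<le> \<rho>" and K: "K \<ge> 0"
    and g2: "integrable lborel (\<lambda>y. (u y - conv u (mollifier \<tau>) y)\<^sup>2)"
    and gK: "(LINT y|lborel. (u y - conv u (mollifier \<tau>) y)\<^sup>2) \<le> K\<^sup>2"
  shows "\<bar>conv u k t - conv (conv u k) (mollifier \<tau>) t\<bar> \<le> K * M * sqrt (2 * \<rho>)"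
proof -
  have m: "kernel \<rho> (mollifier \<tau>)" using kernel_mono kernel_mollifier(1) \<tau> by blast
  have cu: "loc_integrable (conv u (mollifier \<tau>))"
    by (intro loc_integrable_continuous continuous_on_conv[OF u m])
  have g: "loc_integrable (\<lambda>y. u y - conv u (mollifier \<tau>) y)"
    by (rule loc_integrable_diff[OF u cu])
  have "conv u k t - conv (conv u k) (mollifier \<tau>) t = conv (\<lambda>y. u y - conv u (mollifier \<tau>) y) k t"
    by (simp add: conv_diff[OF u cu k] conv_commute[OF u k m])
  moreover have "\<bar>conv (\<lambda>y. u y - conv u (mollifier \<tau>) y) k t\<bar> \<le> K * M * sqrt ((t + \<rho>) - (t - \<rho>))"
    unfolding conv_def [of _ k]
  proof (rule L2_pairing_le[OF loc_integrable_measurable[OF g] g2 gK K])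
    show "(\<lambda>y. k (t - y)) \<in> borel_measurable borel"
      using kernel_measurable[OF k] by measurable
    show "M \<ge> 0" using M[of 0] by linarith
    then show "\<bar>k (t - y)\<bar> \<le> M * indicator {t - \<rho>..t + \<rho>} y" for y
      using M[of "t - y"] kernel_outside[OF k, of "t - y"] by (auto simp: indicator_def abs_le_iff)
  qed (use \<tau> in simp)
  ultimately show ?thesis by simp
qed

text \<open>The two shifted kernels differ by at most \<open>B * \<tau> / \<delta>\<^sup>2\<close>,
  on an interval of length at most \<open>4 * \<delta>\<close>. The point is the ratio
  \<open>\<tau> / \<delta>\<close> in the bound: it can be made small independently of the size of
  \<open>\<delta>\<close>.\<close>

lemma conv_mollifier_oscillation:
  assumes B: "\<And>s t. \<bar>mollifier \<delta> s - mollifier \<delta> t\<bar> \<le> B / \<delta>\<^sup>2 * \<bar>s - t\<bar>" "B \<ge> 0"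
    and q: "continuous_on UNIV q" and S: "\<And>y. \<bar>y - s\<bar> \<le> \<delta> + \<tau> \<Longrightarrow> \<bar>q y\<bar> \<le> S"
    and st: "\<bar>s - t\<bar> \<le> \<tau>" and \<tau>: "\<tau> \<le> \<delta>" and \<delta>: "\<delta> > 0"
  shows "\<bar>conv q (mollifier \<delta>) s - conv q (mollifier \<delta>) t\<bar> \<le> 4 * B * S * \<tau> / \<delta>"
proof -
  have \<tau>0: "\<tau> \<ge> 0" using st by linarith
  then have S0: "S \<ge> 0" using S[of s] \<delta> by simp
  define c where "c = S * (B / \<delta>\<^sup>2 * \<tau>)"
  have c0: "c \<ge> 0" using S0 B(2) \<tau>0 by (simp add: c_def)
  have "\<bar>LINT y|lborel. q y * (mollifier \<delta> (s - y) - mollifier \<delta> (t - y))\<bar>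
      \<le> c * ((s + (\<delta> + \<tau>)) - (s - (\<delta> + \<tau>)))"
  proof (rule abs_integral_le_interval[OF _ _ c0])
    fix y
    show "\<bar>q y * (mollifier \<delta> (s - y) - mollifier \<delta> (t - y))\<bar> \<le> c * indicator {s - (\<delta> + \<tau>)..s + (\<delta> + \<tau>)} y"
    proof (cases "y \<in> {s - (\<delta> + \<tau>)..s + (\<delta> + \<tau>)}")
      case True
      have "\<bar>mollifier \<delta> (s - y) - mollifier \<delta> (t - y)\<bar> \<le> B / \<delta>\<^sup>2 * \<bar>s - t\<bar>"
        using B(1)[of "s - y" "t - y"] by simp
      also have "\<dots> \<le> B / \<delta>\<^sup>2 * \<tau>"
        using st B(2) by (intro mult_left_mono) auto
      finally have "\<bar>q y\<bar> * \<bar>mollifier \<delta> (s - y) - mollifier \<delta> (t - y)\<bar> \<le> c"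
        unfolding c_def using True S[of y] S0 by (intro mult_mono) (auto simp: abs_le_iff)
      with True show ?thesis by (simp add: abs_mult)
    next
      case False
      then have "\<bar>s - y\<bar> \<ge> \<delta>" "\<bar>t - y\<bar> \<ge> \<delta>" using st \<tau>0 by (auto simp: abs_le_iff)
      then show ?thesis using False mollifier_outside(1)[OF \<delta>] by simp
    qed
  qed (use \<delta> \<tau>0 in simp)
  moreover have "conv q (mollifier \<delta>) s - conv q (mollifier \<delta>) t =
      (LINT y|lborel. q y * (mollifier \<delta> (s - y) - mollifier \<delta> (t - y)))"
    unfolding conv_def right_diff_distrib
    by (intro Bochner_Integration.integral_diff[symmetric] conv_integrable[of _ \<delta>]
        loc_integrable_continuous q kernel_mollifier \<delta>)
  moreover have "c * ((s + (\<delta> + \<tau>)) - (s - (\<delta> + \<tau>))) \<le> c * (4 * \<delta>)"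
    using \<tau> c0 by (intro mult_left_mono) auto
  moreover have "c * (4 * \<delta>) = 4 * B * S * \<tau> / \<delta>"
    using \<delta> by (simp add: c_def power2_eq_square)
  ultimately show ?thesis by linarith
qed

section \<open>Recovering second derivatives from mollification defects\<close>

lemma second_difference_estimate:
  assumes p: "\<And>s. (p has_real_derivative p' s) (at s)" "\<And>s. (p' has_real_derivative q s) (at s)"
    and \<omega>: "\<And>z. \<bar>z - s\<bar> \<le> \<bar>y\<bar> \<Longrightarrow> \<bar>q z - q s\<bar> \<le> \<omega>"
  shows "\<bar>p (s + y) + p (s - y) - 2 * p s - y\<^sup>2 * q s\<bar> \<le> \<omega> * y\<^sup>2"
proof -
  \<comment> \<open>The symmetric second difference minus its quadratic part, followed by its first
    two derivatives in \<open>y\<close>. The Taylor coefficients of orders \<open>0\<close> and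
    \<open>1\<close> vanish at \<open>y = 0\<close>, and \<open>D 2 t / 2\<close> is the mean of
    \<open>q (s + t) - q s\<close> and \<open>q (s - t) - q s\<close>.\<close>
  define D where "D m = (if m = 0 then (\<lambda>y. p (s + y) + p (s - y) - 2 * p s - y\<^sup>2 * q s)
    else if m = Suc 0 then (\<lambda>y. p' (s + y) - p' (s - y) - 2 * y * q s)
    else (\<lambda>y. q (s + y) + q (s - y) - 2 * q s))" for m :: nat
  have D0: "(D 0 has_real_derivative D (Suc 0) t) (at t)" for t
    unfolding D_def
    by (auto intro!: derivative_eq_intros DERIV_chain2[OF p(1)])
  have D1: "(D (Suc 0) has_real_derivative D (Suc (Suc 0)) t) (at t)" for t
    unfolding D_def
    by (auto intro!: derivative_eq_intros DERIV_chain2[OF p(2)])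
  have "\<exists>t. \<bar>t\<bar> \<le> \<bar>y\<bar> \<and> D 0 y = (\<Sum>m<2. D m 0 / fact m * y ^ m) + D 2 t / fact 2 * y ^ 2"
    by (rule Maclaurin_bi_le) (use D0 D1 in \<open>auto simp: less_Suc_eq numeral_2_eq_2\<close>)
  then obtain t where t: "\<bar>t\<bar> \<le> \<bar>y\<bar>" and eq: "D 0 y = D 2 t / 2 * y\<^sup>2"
    by (auto simp: D_def numeral_2_eq_2)
  have "\<bar>q (s + t) - q s\<bar> \<le> \<omega>" "\<bar>q (s - t) - q s\<bar> \<le> \<omega>"
    using t by (auto intro!: \<omega>)
  then have "\<bar>D 2 t / 2\<bar> \<le> \<omega>" by (simp add: D_def)
  then have "\<bar>D 2 t / 2\<bar> * y\<^sup>2 \<le> \<omega> * y\<^sup>2" by (rule mult_right_mono) simp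
  then have "\<bar>D 0 y\<bar> \<le> \<omega> * y\<^sup>2" by (simp add: eq abs_mult)
  then show ?thesis by (simp add: D_def)
qed

text \<open>Since the mollifier is even, \<open>p * \<eta>\<^sup>\<tau> - p\<close> averages second differences of \<open>p\<close>, so it
  approximates \<open>p''\<close> up to the factor \<open>\<kappa> \<tau>\<^sup>2 / 2\<close>.\<close>

lemma second_derivative_le_defect:
  assumes p: "\<And>s. (p has_real_derivative p' s) (at s)" "\<And>s. (p' has_real_derivative q s) (at s)"
    and \<omega>: "\<And>z. \<bar>z - s\<bar> \<le> \<tau> \<Longrightarrow> \<bar>q z - q s\<bar> \<le> \<omega>"
    and \<tau>: "\<tau> > 0"
    and \<kappa>: "\<kappa> > 0" "(LINT s|lborel. s\<^sup>2 * mollifier \<tau> s) = \<kappa> * \<tau>\<^sup>2"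
    and defect: "\<bar>p s - conv p (mollifier \<tau>) s\<bar> \<le> K"
  shows "\<bar>q s\<bar> \<le> 2 * K / (\<kappa> * \<tau>\<^sup>2) + \<omega>"
proof -
  let ?m = "mollifier \<tau>"
  have cp: "continuous_on UNIV p"
    using p(1) DERIV_continuous_on has_field_derivative_at_within by blast
  have i1: "integrable lborel (\<lambda>y. p (s + y) * ?m y)" and i2: "integrable lborel (\<lambda>y. p (s - y) * ?m y)"
    and i3: "integrable lborel (\<lambda>y. 2 * p s * ?m y)"
    by (intro integrable_mult_mollifier[OF \<tau>] continuous_intros continuous_on_compose2[OF cp], simp)+
  have i4: "integrable lborel (\<lambda>y. y\<^sup>2 * q s * ?m y)"
    and i5: "integrable lborel (\<lambda>y. y\<^sup>2 * ?m y)"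
    by (intro integrable_mult_mollifier[OF \<tau>] continuous_intros)+
  \<comment> \<open>Evenness of the mollifier gives a second expression for the same convolution;
    the sum of both contains \<open>p (s + y) + p (s - y)\<close>.\<close>
  have c2: "conv p ?m s = (LINT y|lborel. p (s - y) * ?m y)"
    by (rule conv_shift)
  also have "\<dots> = (LINT y|lborel. p (s + y) * ?m y)"
    by (subst lborel_integral_real_affine[of "-1" _ 0]) (auto simp: mollifier_minus)
  finally have c1: "conv p ?m s = (LINT y|lborel. p (s + y) * ?m y)" .
  have "(LINT y|lborel. (p (s + y) + p (s - y) - 2 * p s - y\<^sup>2 * q s) * ?m y)
      = (LINT y|lborel. p (s + y) * ?m y + p (s - y) * ?m y - 2 * p s * ?m y - y\<^sup>2 * q s * ?m y)"
    by (simp add: algebra_simps)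
  also have "\<dots> = conv p ?m s + conv p ?m s - 2 * p s - q s * (\<kappa> * \<tau>\<^sup>2)"
  proof -
    have "(LINT y|lborel. y\<^sup>2 * q s * ?m y) = (LINT y|lborel. q s * (y\<^sup>2 * ?m y))"
      by (simp add: mult_ac)
    also have "\<dots> = q s * (\<kappa> * \<tau>\<^sup>2)"
      using \<kappa>(2) by (subst integral_mult_right_zero) simp
    finally have "(LINT y|lborel. y\<^sup>2 * q s * ?m y) = q s * (\<kappa> * \<tau>\<^sup>2)" .
    moreover have "(LINT y|lborel. 2 * p s * ?m y) = 2 * p s"
      using integral_mollifier[OF \<tau>] by (subst integral_mult_right_zero) simp
    ultimately show ?thesis
      using i1 i2 i3 i4 by (simp add: c1[symmetric] c2[symmetric])
  qed
  finally have eq: "(LINT y|lborel. (p (s + y) + p (s - y) - 2 * p s - y\<^sup>2 * q s) * ?m y)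
      = 2 * (conv p ?m s - p s) - q s * (\<kappa> * \<tau>\<^sup>2)" by simp
  have pt: "\<bar>(p (s + y) + p (s - y) - 2 * p s - y\<^sup>2 * q s) * ?m y\<bar> \<le> \<omega> * (y\<^sup>2 * ?m y)" for y
  proof (cases "\<bar>y\<bar> \<ge> \<tau>")
    case True
    then show ?thesis using mollifier_outside(1)[OF \<tau>] by simp
  next
    case False
    have "\<bar>p (s + y) + p (s - y) - 2 * p s - y\<^sup>2 * q s\<bar> \<le> \<omega> * y\<^sup>2"
      by (rule second_difference_estimate[OF p]) (use False \<omega> in auto)
    from mult_right_mono[OF this mollifier_nonneg[OF \<tau>, of y]] show ?thesis
      using mollifier_nonneg[OF \<tau>, of y] by (simp add: abs_mult mult_ac)
  qed
  have ie: "integrable lborel (\<lambda>y. (p (s + y) + p (s - y) - 2 * p s - y\<^sup>2 * q s) * ?m y)"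
    by (intro integrable_mult_mollifier[OF \<tau>] continuous_intros continuous_on_compose2[OF cp]) auto
  have "\<bar>2 * (conv p ?m s - p s) - q s * (\<kappa> * \<tau>\<^sup>2)\<bar> \<le> (LINT y|lborel. \<omega> * (y\<^sup>2 * ?m y))"
    unfolding eq[symmetric]
    by (rule order_trans[OF integral_abs_bound integral_mono])
      (use ie pt i5 in auto)
  also have "\<dots> = \<omega> * (\<kappa> * \<tau>\<^sup>2)"
    using \<kappa>(2) by (subst integral_mult_right_zero) simp
  finally have "\<bar>q s * (\<kappa> * \<tau>\<^sup>2)\<bar> \<le> 2 * K + \<omega> * (\<kappa> * \<tau>\<^sup>2)"
  proof -
    have "\<bar>2 * (a - b) - c\<bar> \<le> d \<Longrightarrow> \<bar>b - a\<bar> \<le> k \<Longrightarrow> \<bar>c\<bar> \<le> 2 * k + d" for a b c d k :: real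
      by (auto simp: abs_le_iff)
    from this[OF _ defect] show "\<bar>2 * (conv p ?m s - p s) - q s * (\<kappa> * \<tau>\<^sup>2)\<bar> \<le> \<omega> * (\<kappa> * \<tau>\<^sup>2) \<Longrightarrow> ?thesis" .
  qed
  moreover have pos: "\<kappa> * \<tau>\<^sup>2 > 0" using \<kappa>(1) \<tau> by simp
  ultimately have "\<bar>q s\<bar> * (\<kappa> * \<tau>\<^sup>2) \<le> 2 * K + \<omega> * (\<kappa> * \<tau>\<^sup>2)"
    by (simp only: abs_mult[of "q s"] abs_of_pos)
  then have "\<bar>q s\<bar> \<le> (2 * K + \<omega> * (\<kappa> * \<tau>\<^sup>2)) / (\<kappa> * \<tau>\<^sup>2)"
    using pos by (simp add: pos_le_divide_eq)
  also have "\<dots> = 2 * K / (\<kappa> * \<tau>\<^sup>2) + \<omega>"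
    using \<kappa>(1) \<tau> by (simp add: add_divide_distrib)
  finally show ?thesis .
qed

text \<open>The defect of \<open>p\<close> bounds \<open>q\<close> up to the oscillation of
  \<open>q\<close> on scale \<open>\<tau>\<close>, and this oscillation is bounded by
  \<open>\<tau> / \<delta>\<close> times a local supremum of \<open>\<bar>q\<bar>\<close>. To absorb
  that supremum, \<open>\<bar>q\<bar>\<close> is weighted by the squared distance to the ends of
  \<open>{s0 - 1..s0 + 1}\<close>: at the maximum, scales proportional to this distance
  \<open>d\<close> cost a factor \<open>1 / d\<^sup>2\<close>, which the weight cancels. At
  \<open>s0\<close> the weight is \<open>1\<close>.\<close>

lemma second_derivative_mollification_bounded:
  assumes u: "loc_integrable u" and e: "0 < e" "e \<le> 1" and K: "K \<ge> 0"
    and g2: "\<And>\<tau>. 0 < \<tau> \<Longrightarrow> \<tau> \<le> e \<Longrightarrow> integrable lborel (\<lambda>y. (u y - conv u (mollifier \<tau>) y)\<^sup>2)"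
    and gK: "\<And>\<tau>. 0 < \<tau> \<Longrightarrow> \<tau> \<le> e \<Longrightarrow> (LINT y|lborel. (u y - conv u (mollifier \<tau>) y)\<^sup>2) \<le> K\<^sup>2"
  obtains Q where "Q \<ge> 0" "\<And>s. \<bar>conv u (mollifier'' e) s\<bar> \<le> Q"
proof -
  define p p' q where "p = conv u (mollifier e)" and "p' = conv u (mollifier' e)"
    and "q = conv u (mollifier'' e)"
  note kers = kernel_mollifier[OF e(1)]
  have dp: "(p has_real_derivative p' s) (at s)" "(p' has_real_derivative q s) (at s)" for s
    unfolding p_def p'_def q_def
    by (rule DERIV_conv[OF u kers(1,2) DERIV_mollifier[OF e(1)]]
        DERIV_conv[OF u kers(2,3) DERIV_mollifier'[OF e(1)]])+
  have cq: "continuous_on A q" for A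
    unfolding q_def by (rule continuous_on_conv[OF u kers(3)])
  obtain M1 where M1: "M1 > 0" "\<And>s. \<bar>mollifier e s\<bar> \<le> M1" using kernel_bounded[OF kers(1)] by blast
  obtain M2 where M2: "M2 > 0" "\<And>s. \<bar>mollifier'' e s\<bar> \<le> M2" using kernel_bounded[OF kers(3)] by blast
  obtain B where B: "B > 0" "\<And>\<epsilon> s t. \<epsilon> > 0 \<Longrightarrow> \<bar>mollifier \<epsilon> s - mollifier \<epsilon> t\<bar> \<le> B / \<epsilon>\<^sup>2 * \<bar>s - t\<bar>"
    by (rule mollifier_lipschitz) blast
  obtain \<kappa> where \<kappa>: "\<kappa> > 0" "\<And>\<epsilon>. \<epsilon> > 0 \<Longrightarrow> (LINT s|lborel. s\<^sup>2 * mollifier \<epsilon> s) = \<kappa> * \<epsilon>\<^sup>2"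
    by (rule second_moment_mollifier) blast
  \<comment> \<open>Bounds for the defects of \<open>p\<close> and of \<open>q\<close>, valid for
    all \<open>\<tau> \<le> e\<close> at once.\<close>
  define K1 K2 where "K1 = K * M1 * sqrt (2 * e)" and "K2 = K * M2 * sqrt (2 * e)"
  have K0: "K1 \<ge> 0" "K2 \<ge> 0" using K M1(1) M2(1) e by (auto simp: K1_def K2_def)
  have defp: "\<bar>p s - conv p (mollifier \<tau>) s\<bar> \<le> K1" if "0 < \<tau>" "\<tau> \<le> e" for s \<tau>
    unfolding p_def K1_def by (rule mollification_defect_bound[OF u kers(1) M1(2) that K g2[OF that] gK[OF that]])
  have defq: "\<bar>q s - conv q (mollifier \<tau>) s\<bar> \<le> K2" if "0 < \<tau>" "\<tau> \<le> e" for s \<tau>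
    unfolding q_def K2_def by (rule mollification_defect_bound[OF u kers(3) M2(2) that K g2[OF that] gK[OF that]])
  \<comment> \<open>The values \<open>q z\<close> and \<open>q s\<close> are compared through the
    mollification of \<open>q\<close> at the larger scale \<open>\<delta>\<close>: each replacement
    costs \<open>K2\<close>, and the mollified function oscillates little.\<close>
  have local_bound: "\<bar>q s\<bar> \<le> 2 * K1 / (\<kappa> * \<tau>\<^sup>2) + (2 * K2 + 4 * B * S * \<tau> / \<delta>)"
    if \<tau>: "0 < \<tau>" "\<tau> \<le> \<delta>" and \<delta>: "\<delta> \<le> e" and S: "\<And>y. \<bar>y - s\<bar> \<le> \<delta> + \<tau> \<Longrightarrow> \<bar>q y\<bar> \<le> S" for s \<tau> \<delta> S
  proof (rule second_derivative_le_defect[OF dp _ \<tau>(1) \<kappa>(1) \<kappa>(2)])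
    show "\<bar>p s - conv p (mollifier \<tau>) s\<bar> \<le> K1" using \<tau> \<delta> by (intro defp) auto
    show "\<bar>q z - q s\<bar> \<le> 2 * K2 + 4 * B * S * \<tau> / \<delta>" if "\<bar>z - s\<bar> \<le> \<tau>" for z
    proof -
      have "\<bar>conv q (mollifier \<delta>) s - conv q (mollifier \<delta>) z\<bar> \<le> 4 * B * S * \<tau> / \<delta>"
        by (rule conv_mollifier_oscillation[OF B(2) _ cq S]) (use \<tau> that B(1) in auto)
      moreover have "\<bar>q z - conv q (mollifier \<delta>) z\<bar> \<le> K2" "\<bar>q s - conv q (mollifier \<delta>) s\<bar> \<le> K2"
        using \<tau> \<delta> by (auto intro!: defq)
      ultimately show ?thesis by linarith
    qed
  qed (use \<tau> in auto)
  \<comment> \<open>This will be the ratio \<open>\<tau> / \<delta>\<close>, small enough that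
    \<open>16 * B * \<mu> * \<phi> s1\<close> is at most \<open>\<phi> s1 / 2\<close>.\<close>
  define \<mu> where "\<mu> = min 1 (1 / (32 * B))"
  have \<mu>: "0 < \<mu>" "\<mu> \<le> 1" "\<mu> * (32 * B) \<le> 1"
  proof -
    have "\<mu> \<le> 1 / (32 * B)" by (simp add: \<mu>_def)
    then show "\<mu> * (32 * B) \<le> 1" using B(1) by (simp add: field_simps)
  qed (use B(1) in \<open>auto simp: \<mu>_def\<close>)
  \<comment> \<open>The leading factor \<open>2\<close> results from absorbing
    \<open>\<phi> s1 / 2\<close> into the left-hand side; \<open>32\<close> is \<open>2\<close>
    times the \<open>16\<close> from \<open>\<delta>\<^sup>2 = (e * d / 4)\<^sup>2\<close>.\<close>
  define Q where "Q = 2 * (32 * K1 / (\<kappa> * \<mu>\<^sup>2 * e\<^sup>2) + 2 * K2)"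
  have Q0: "Q \<ge> 0" using K0 \<kappa>(1) by (simp add: Q_def)
  have "\<bar>q s0\<bar> \<le> Q" for s0
  proof -
    define \<phi> where "\<phi> s = (1 - \<bar>s - s0\<bar>)\<^sup>2 * \<bar>q s\<bar>" for s
    have "continuous_on {s0 - 1..s0 + 1} \<phi>"
      unfolding \<phi>_def by (intro continuous_intros cq)
    then obtain s1 where s1: "s1 \<in> {s0 - 1..s0 + 1}" and max: "\<And>s. s \<in> {s0 - 1..s0 + 1} \<Longrightarrow> \<phi> s \<le> \<phi> s1"
      using continuous_attains_sup[of "{s0 - 1..s0 + 1}" \<phi>] by auto
    have le: "\<bar>q s0\<bar> \<le> \<phi> s1" using max[of s0] by (simp add: \<phi>_def)
    define d where "d = 1 - \<bar>s1 - s0\<bar>"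
    show ?thesis
    proof (cases "d = 0")
      case True
      then show ?thesis using le Q0 by (simp add: \<phi>_def d_def)
    next
      case False
      then have d: "0 < d" "d \<le> 1" using s1 by (auto simp: d_def abs_le_iff)
      \<comment> \<open>Since \<open>\<mu> \<le> 1\<close>, points within
        \<open>\<delta> + \<mu> * \<delta> \<le> d / 2\<close> of \<open>s1\<close> still have
        distance at least \<open>d / 2\<close> to the ends of the interval.\<close>
      define \<delta> where "\<delta> = e * d / 4"
      \<comment> \<open>Maximality of \<open>\<phi> s1\<close> bounds \<open>\<bar>q\<bar>\<close>
        by this value wherever the weight is at least \<open>(d / 2)\<^sup>2\<close>.\<close>
      define S where "S = 4 * \<phi> s1 / d\<^sup>2"
      have ed: "e * d \<le> d" "e * d \<le> e" "0 < e * d" using e d by (auto simp: mult_left_le mult_left_le_one_le)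
      have \<delta>: "0 < \<delta>" "\<delta> \<le> d / 4" "\<delta> \<le> e" using ed e by (auto simp: \<delta>_def)
      have \<mu>\<delta>: "\<mu> * \<delta> \<le> \<delta>" using \<mu> \<delta> by (simp add: mult_left_le_one_le)
      have "\<bar>q s1\<bar> \<le> 2 * K1 / (\<kappa> * (\<mu> * \<delta>)\<^sup>2) + (2 * K2 + 4 * B * S * (\<mu> * \<delta>) / \<delta>)"
      proof (rule local_bound)
        show "\<bar>q y\<bar> \<le> S" if y: "\<bar>y - s1\<bar> \<le> \<delta> + \<mu> * \<delta>" for y
        proof -
          have dy: "d / 2 \<le> 1 - \<bar>y - s0\<bar>"
          proof -
            have "\<bar>y - s0\<bar> \<le> \<bar>y - s1\<bar> + \<bar>s1 - s0\<bar>" by linarith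
            then show ?thesis using y \<mu>\<delta> \<delta>(2) d_def by linarith
          qed
          then have "\<bar>y - s0\<bar> \<le> 1" using d by linarith
          then have "y \<in> {s0 - 1..s0 + 1}" by (auto simp: abs_le_iff)
          from max[OF this] have "(1 - \<bar>y - s0\<bar>)\<^sup>2 * \<bar>q y\<bar> \<le> \<phi> s1" by (simp add: \<phi>_def)
          moreover have "(d / 2)\<^sup>2 * \<bar>q y\<bar> \<le> (1 - \<bar>y - s0\<bar>)\<^sup>2 * \<bar>q y\<bar>"
            using dy d by (intro mult_right_mono power_mono) auto
          ultimately have "(d / 2)\<^sup>2 * \<bar>q y\<bar> \<le> \<phi> s1" by linarith
          then show ?thesis using d by (simp add: S_def field_simps power2_eq_square)
        qed
      qed (use \<mu> \<delta> \<mu>\<delta> in auto)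
      also have "\<dots> = (32 * K1 / (\<kappa> * \<mu>\<^sup>2 * e\<^sup>2) + 16 * B * \<mu> * \<phi> s1) / d\<^sup>2 + 2 * K2"
        using d e \<mu> \<kappa>(1) by (simp add: \<delta>_def S_def field_simps power2_eq_square)
      finally have "\<bar>q s1\<bar> * d\<^sup>2 \<le> ((32 * K1 / (\<kappa> * \<mu>\<^sup>2 * e\<^sup>2) + 16 * B * \<mu> * \<phi> s1) / d\<^sup>2 + 2 * K2) * d\<^sup>2"
        by (rule mult_right_mono) simp
      also have "\<dots> = 32 * K1 / (\<kappa> * \<mu>\<^sup>2 * e\<^sup>2) + 16 * B * \<mu> * \<phi> s1 + 2 * K2 * d\<^sup>2"
      proof -
        have "(Z / d\<^sup>2 + W) * d\<^sup>2 = Z + W * d\<^sup>2" for Z W :: real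
          using d by (simp add: field_simps)
        then show ?thesis by (simp only:)
      qed
      also have "\<dots> \<le> 32 * K1 / (\<kappa> * \<mu>\<^sup>2 * e\<^sup>2) + \<phi> s1 / 2 + 2 * K2"
      proof -
        have "\<phi> s1 \<ge> 0" by (simp add: \<phi>_def)
        from mult_right_mono[OF \<mu>(3) this] have "16 * B * \<mu> * \<phi> s1 \<le> \<phi> s1 / 2" by (simp add: mult_ac)
        moreover have "2 * K2 * d\<^sup>2 \<le> 2 * K2"
          using d K0 by (intro mult_left_le) (auto simp: power_le_one)
        ultimately show ?thesis by linarith
      qed
      finally have "\<bar>q s1\<bar> * d\<^sup>2 \<le> 32 * K1 / (\<kappa> * \<mu>\<^sup>2 * e\<^sup>2) + \<phi> s1 / 2 + 2 * K2" .
      moreover have "\<phi> s1 = \<bar>q s1\<bar> * d\<^sup>2" by (simp add: \<phi>_def d_def)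
      moreover have "a \<le> b + c / 2 + 2 * k \<Longrightarrow> c = a \<Longrightarrow> c \<le> 2 * (b + 2 * k)" for a b c k :: real
        by simp
      ultimately have "\<phi> s1 \<le> Q" unfolding Q_def by blast
      with le show ?thesis by linarith
    qed
  qed
  then show ?thesis using that Q0 by (simp add: q_def)
qed

text \<open>A bounded second derivative makes the first derivative grow at most linearly, which
  yields a Lipschitz constant linear in the radius \<open>R\<close>.\<close>

lemma mollification_local_lipschitz:
  assumes "loc_integrable u" "0 < e" "e \<le> 1" "K \<ge> 0"
    and "\<And>\<tau>. 0 < \<tau> \<Longrightarrow> \<tau> \<le> e \<Longrightarrow> integrable lborel (\<lambda>y. (u y - conv u (mollifier \<tau>) y)\<^sup>2)"
    and "\<And>\<tau>. 0 < \<tau> \<Longrightarrow> \<tau> \<le> e \<Longrightarrow> (LINT y|lborel. (u y - conv u (mollifier \<tau>) y)\<^sup>2) \<le> K\<^sup>2"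
  obtains C where "C \<ge> 0"
    "\<And>R s t. \<bar>s\<bar> \<le> R \<Longrightarrow> \<bar>t\<bar> \<le> R \<Longrightarrow>
      \<bar>conv u (mollifier e) s - conv u (mollifier e) t\<bar> \<le> C * (1 + R) * \<bar>s - t\<bar>"
proof -
  obtain Q where Q: "Q \<ge> 0" "\<And>s. \<bar>conv u (mollifier'' e) s\<bar> \<le> Q"
    by (rule second_derivative_mollification_bounded[OF assms]) (assumption | rule that)+
  note kers = kernel_mollifier[OF assms(2)]
  have d1: "(conv u (mollifier e) has_real_derivative conv u (mollifier' e) s) (at s)" for s
    by (rule DERIV_conv[OF assms(1) kers(1,2) DERIV_mollifier[OF assms(2)]])
  have d2: "(conv u (mollifier' e) has_real_derivative conv u (mollifier'' e) s) (at s)" for s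
    by (rule DERIV_conv[OF assms(1) kers(2,3) DERIV_mollifier'[OF assms(2)]])
  define A where "A = \<bar>conv u (mollifier' e) 0\<bar>"
  have b1: "\<bar>conv u (mollifier' e) s\<bar> \<le> A + Q * \<bar>s\<bar>" for s
    using field_differentiable_bound[of UNIV "conv u (mollifier' e)" "conv u (mollifier'' e)" Q s 0] d2 Q
    unfolding A_def by fastforce
  show ?thesis
  proof (rule that[of "A + Q"])
    show "A + Q \<ge> 0" using Q by (simp add: A_def)
    fix R s t :: real assume R: "\<bar>s\<bar> \<le> R" "\<bar>t\<bar> \<le> R"
    have "norm (conv u (mollifier e) s - conv u (mollifier e) t) \<le> (A + Q * R) * norm (s - t)"
    proof (rule field_differentiable_bound[of "{- R..R}"])
      show "(conv u (mollifier e) has_field_derivative conv u (mollifier' e) z) (at z within {- R..R})" for z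
        by (rule has_field_derivative_at_within[OF d1])
      show "norm (conv u (mollifier' e) z) \<le> A + Q * R" if "z \<in> {- R..R}" for z
      proof -
        have "Q * \<bar>z\<bar> \<le> Q * R" using that Q by (intro mult_left_mono) auto
        then show ?thesis using b1[of z] by simp
      qed
    qed (use R in \<open>auto simp: abs_le_iff\<close>)
    also have "\<dots> \<le> (A + Q) * (1 + R) * norm (s - t)"
      using R Q by (intro mult_right_mono) (auto simp: A_def algebra_simps)
    finally show "\<bar>conv u (mollifier e) s - conv u (mollifier e) t\<bar> \<le> (A + Q) * (1 + R) * \<bar>s - t\<bar>" by simp
  qed
qed

section \<open>Lipschitz constants of mollified controls\<close>

text \<open>Split \<open>u\<close> into \<open>p\<close>, its mollification at the fixed scale
  \<open>e\<close>, and the square integrable rest \<open>g\<close>. Averaging preserves the local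
  Lipschitz bound of \<open>p\<close>. For \<open>g\<close>, Cauchy-Schwarz combines a kernel
  derivative of size \<open>1 / \<epsilon>\<^sup>2\<close> with a support of length
  \<open>2 * \<epsilon>\<close>. The value at \<open>0\<close> is bounded the same way, since the
  control must be joined to a prescribed initial value.\<close>

lemma mollification_lipschitz_rate:
  assumes "loc_integrable u" "0 < e" "e \<le> 1" "K \<ge> 0"
    and "\<And>\<tau>. 0 < \<tau> \<Longrightarrow> \<tau> \<le> e \<Longrightarrow> integrable lborel (\<lambda>y. (u y - conv u (mollifier \<tau>) y)\<^sup>2)"
    and "\<And>\<tau>. 0 < \<tau> \<Longrightarrow> \<tau> \<le> e \<Longrightarrow> (LINT y|lborel. (u y - conv u (mollifier \<tau>) y)\<^sup>2) \<le> K\<^sup>2"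
  obtains C where "C \<ge> 0"
    "\<And>\<epsilon> T s t. 0 < \<epsilon> \<Longrightarrow> \<epsilon> \<le> 1 \<Longrightarrow> s \<in> {0..T} \<Longrightarrow> t \<in> {0..T} \<Longrightarrow>
      \<bar>conv u (mollifier \<epsilon>) s - conv u (mollifier \<epsilon>) t\<bar> \<le> C * (1 + T + 1 / (\<epsilon> * sqrt \<epsilon>)) * \<bar>s - t\<bar>"
    "\<And>\<epsilon>. 0 < \<epsilon> \<Longrightarrow> \<epsilon> \<le> 1 \<Longrightarrow> \<bar>conv u (mollifier \<epsilon>) 0\<bar> \<le> C * (1 + 1 / sqrt \<epsilon>)"
proof -
  note u = assms(1)
  define p where "p = conv u (mollifier e)"
  define g where "g = (\<lambda>y. u y - p y)"
  obtain C1 where C1: "C1 \<ge> 0"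
    "\<And>R s t. \<bar>s\<bar> \<le> R \<Longrightarrow> \<bar>t\<bar> \<le> R \<Longrightarrow> \<bar>p s - p t\<bar> \<le> C1 * (1 + R) * \<bar>s - t\<bar>"
    by (rule mollification_local_lipschitz[OF assms, folded p_def]) (assumption | rule that)+
  obtain B where B: "B > 0" "\<And>\<epsilon> s. \<epsilon> > 0 \<Longrightarrow> \<bar>mollifier \<epsilon> s\<bar> \<le> B / \<epsilon>"
    "\<And>\<epsilon> s. \<epsilon> > 0 \<Longrightarrow> \<bar>mollifier' \<epsilon> s\<bar> \<le> B / \<epsilon>\<^sup>2"
    by (rule mollifier_lipschitz) blast
  have cp: "continuous_on A p" for A
    unfolding p_def by (rule continuous_on_conv[OF u kernel_mollifier(1)[OF assms(2)]])
  have lp: "loc_integrable p" by (rule loc_integrable_continuous[OF cp])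
  have lg: "loc_integrable g" unfolding g_def by (rule loc_integrable_diff[OF u lp])
  have split: "conv u (mollifier \<epsilon>) t = conv p (mollifier \<epsilon>) t + conv g (mollifier \<epsilon>) t" if "0 < \<epsilon>" for \<epsilon> t
    unfolding g_def by (subst conv_diff[OF u lp kernel_mollifier(1)[OF that]]) simp
  \<comment> \<open>The \<open>L2\<close> bound enters at the single scale \<open>e\<close>; the
    scale \<open>\<epsilon>\<close> appears only through the kernel and may exceed
    \<open>e\<close>.\<close>
  have gpair: "\<bar>conv g k t\<bar> \<le> K * c * sqrt (2 * \<epsilon>)"
    if k: "kernel \<epsilon> k" and c: "\<And>s. \<bar>k s\<bar> \<le> c" and \<epsilon>: "0 < \<epsilon>" for k c t \<epsilon>
  proof -
    have "\<bar>conv g k t\<bar> \<le> K * c * sqrt ((t + \<epsilon>) - (t - \<epsilon>))"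
      unfolding conv_def
    proof (rule L2_pairing_le[OF loc_integrable_measurable[OF lg] _ _ assms(4)])
      show "integrable lborel (\<lambda>y. (g y)\<^sup>2)" "(LINT y|lborel. (g y)\<^sup>2) \<le> K\<^sup>2"
        unfolding g_def p_def using assms(2) by (auto intro!: assms(5,6))
      show "(\<lambda>y. k (t - y)) \<in> borel_measurable borel"
        using kernel_measurable[OF k] by measurable
      show "c \<ge> 0" using c[of 0] by linarith
      then show "\<bar>k (t - y)\<bar> \<le> c * indicator {t - \<epsilon>..t + \<epsilon>} y" for y
        using c[of "t - y"] kernel_outside[OF k, of "t - y"] by (auto simp: indicator_def abs_le_iff)
    qed (use \<epsilon> in simp)
    then show ?thesis by simp
  qed
  have pavg: "\<bar>LINT y|lborel. h y * mollifier \<epsilon> y\<bar> \<le> c"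
    if \<epsilon>: "0 < \<epsilon>" and h: "continuous_on UNIV h" and c: "\<And>y. \<bar>y\<bar> \<le> \<epsilon> \<Longrightarrow> \<bar>h y\<bar> \<le> c" for h c \<epsilon>
  proof -
    have "\<bar>LINT y|lborel. h y * mollifier \<epsilon> y\<bar> \<le> (LINT y|lborel. c * mollifier \<epsilon> y)"
    proof (rule order_trans[OF integral_abs_bound integral_mono])
      show "\<bar>h y * mollifier \<epsilon> y\<bar> \<le> c * mollifier \<epsilon> y" for y
        using c[of y] mollifier_outside(1)[OF \<epsilon>, of y] mollifier_nonneg[OF \<epsilon>, of y]
        by (cases "\<bar>y\<bar> \<le> \<epsilon>") (auto simp: abs_mult intro: mult_right_mono)
    qed (use \<epsilon> integrable_mollifier in \<open>auto intro!: integrable_mult_mollifier h\<close>)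
    also have "\<dots> = c" using integral_mollifier[OF \<epsilon>] by simp
    finally show ?thesis .
  qed
  define D where "D = 2 * K * B"
  have D0: "D \<ge> 0" using assms(4) B(1) by (simp add: D_def)
  have sqrt2: "sqrt (2 * \<epsilon>) \<le> 2 * sqrt \<epsilon>" if "0 < \<epsilon>" for \<epsilon>
  proof -
    have "sqrt (2 * \<epsilon>) \<le> sqrt (4 * \<epsilon>)" using that by simp
    also have "\<dots> = 2 * sqrt \<epsilon>" by (simp add: real_sqrt_mult)
    finally show ?thesis .
  qed
  show ?thesis
  proof (rule that[of "2 * C1 + D + \<bar>p 0\<bar>"])
    show "2 * C1 + D + \<bar>p 0\<bar> \<ge> 0" using C1(1) D0 by simp
  next
    fix \<epsilon> T s t :: real assume \<epsilon>: "0 < \<epsilon>" "\<epsilon> \<le> 1" and st: "s \<in> {0..T}" "t \<in> {0..T}"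
    note m = kernel_mollifier[OF \<epsilon>(1)]
    have eq: "\<epsilon>\<^sup>2 = (\<epsilon> * sqrt \<epsilon>) * sqrt \<epsilon>" using \<epsilon> by (simp add: power2_eq_square)
    have "\<bar>conv g (mollifier' \<epsilon>) z\<bar> \<le> D / (\<epsilon> * sqrt \<epsilon>)" for z
    proof -
      have "\<bar>conv g (mollifier' \<epsilon>) z\<bar> \<le> K * (B / \<epsilon>\<^sup>2) * sqrt (2 * \<epsilon>)"
        by (rule gpair[OF m(2) B(3)[OF \<epsilon>(1)] \<epsilon>(1)])
      also have "\<dots> \<le> K * (B / \<epsilon>\<^sup>2) * (2 * sqrt \<epsilon>)"
        using assms(4) B(1) by (intro mult_left_mono sqrt2 \<epsilon>) auto
      also have "\<dots> = D / (\<epsilon> * sqrt \<epsilon>)"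
        unfolding eq D_def using \<epsilon> by simp
      finally show ?thesis .
    qed
    then have "norm (conv g (mollifier \<epsilon>) s - conv g (mollifier \<epsilon>) t) \<le> D / (\<epsilon> * sqrt \<epsilon>) * norm (s - t)"
      by (intro field_differentiable_bound[of UNIV _ "conv g (mollifier' \<epsilon>)"])
        (auto intro!: has_field_derivative_at_within DERIV_conv[OF lg m(1,2)] DERIV_mollifier \<epsilon>)
    then have 1: "\<bar>conv g (mollifier \<epsilon>) s - conv g (mollifier \<epsilon>) t\<bar> \<le> D / (\<epsilon> * sqrt \<epsilon>) * \<bar>s - t\<bar>" by simp
    have pc: "continuous_on UNIV (\<lambda>y. p (r - y))" for r
      by (intro continuous_on_compose2[OF cp] continuous_intros) auto
    have "conv p (mollifier \<epsilon>) s - conv p (mollifier \<epsilon>) t = (LINT y|lborel. (p (s - y) - p (t - y)) * mollifier \<epsilon> y)"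
      unfolding conv_shift left_diff_distrib
      by (intro Bochner_Integration.integral_diff[symmetric] integrable_mult_mollifier pc \<epsilon>)
    \<comment> \<open>For \<open>\<bar>y\<bar> \<le> \<epsilon> \<le> 1\<close> the points
      \<open>s - y\<close> and \<open>t - y\<close> stay within \<open>1 + T\<close> of the
      origin.\<close>
    also have "\<bar>\<dots>\<bar> \<le> C1 * (1 + (1 + T)) * \<bar>s - t\<bar>"
    proof (rule pavg[OF \<epsilon>(1)])
      show "continuous_on UNIV (\<lambda>y. p (s - y) - p (t - y))"
        by (intro continuous_intros pc)
      show "\<bar>p (s - y) - p (t - y)\<bar> \<le> C1 * (1 + (1 + T)) * \<bar>s - t\<bar>" if "\<bar>y\<bar> \<le> \<epsilon>" for y
        using C1(2)[of "s - y" "1 + T" "t - y"] that \<epsilon> st by (auto simp: abs_le_iff)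
    qed
    finally have 2: "\<bar>conv p (mollifier \<epsilon>) s - conv p (mollifier \<epsilon>) t\<bar> \<le> C1 * (1 + (1 + T)) * \<bar>s - t\<bar>" .
    have "\<bar>conv u (mollifier \<epsilon>) s - conv u (mollifier \<epsilon>) t\<bar>
        \<le> (D / (\<epsilon> * sqrt \<epsilon>) + C1 * (1 + (1 + T))) * \<bar>s - t\<bar>"
      using 1 2 unfolding split[OF \<epsilon>(1)] distrib_right by linarith
    also have "\<dots> \<le> (2 * C1 + D + \<bar>p 0\<bar>) * (1 + T + 1 / (\<epsilon> * sqrt \<epsilon>)) * \<bar>s - t\<bar>"
    proof (intro mult_right_mono)
      have T: "T \<ge> 0" using st by simp
      define w where "w = 1 / (\<epsilon> * sqrt \<epsilon>)"
      have w: "w \<ge> 0" using \<epsilon> by (simp add: w_def)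
      have "D * w + C1 * (1 + (1 + T)) \<le> (2 * C1 + D + \<bar>p 0\<bar>) * (1 + T + w)"
      proof -
        have "0 \<le> C1 * T + 2 * C1 * w + D * (1 + T) + \<bar>p 0\<bar> * (1 + T + w)"
          using T w C1(1) D0 by simp
        then show ?thesis by (simp add: algebra_simps)
      qed
      then show "D / (\<epsilon> * sqrt \<epsilon>) + C1 * (1 + (1 + T)) \<le> (2 * C1 + D + \<bar>p 0\<bar>) * (1 + T + 1 / (\<epsilon> * sqrt \<epsilon>))"
        by (simp add: w_def)
    qed simp
    finally show "\<bar>conv u (mollifier \<epsilon>) s - conv u (mollifier \<epsilon>) t\<bar>
        \<le> (2 * C1 + D + \<bar>p 0\<bar>) * (1 + T + 1 / (\<epsilon> * sqrt \<epsilon>)) * \<bar>s - t\<bar>" .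
  next
    fix \<epsilon> :: real assume \<epsilon>: "0 < \<epsilon>" "\<epsilon> \<le> 1"
    have eq: "\<epsilon> = sqrt \<epsilon> * sqrt \<epsilon>" using \<epsilon> by simp
    have "\<bar>conv g (mollifier \<epsilon>) 0\<bar> \<le> K * (B / \<epsilon>) * sqrt (2 * \<epsilon>)"
      by (rule gpair[OF kernel_mollifier(1)[OF \<epsilon>(1)] B(2)[OF \<epsilon>(1)] \<epsilon>(1)])
    also have "\<dots> \<le> K * (B / \<epsilon>) * (2 * sqrt \<epsilon>)"
      using assms(4) B(1) \<epsilon> by (intro mult_left_mono sqrt2) auto
    also have "\<dots> = D / sqrt \<epsilon>"
      unfolding D_def using \<epsilon> by (subst (1) eq) (simp add: field_simps)
    finally have 1: "\<bar>conv g (mollifier \<epsilon>) 0\<bar> \<le> D / sqrt \<epsilon>" .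
    have 2: "\<bar>conv p (mollifier \<epsilon>) 0\<bar> \<le> \<bar>p 0\<bar> + 2 * C1"
      unfolding conv_shift
    proof (rule pavg[OF \<epsilon>(1)])
      show "continuous_on UNIV (\<lambda>y. p (0 - y))"
        by (intro continuous_on_compose2[OF cp] continuous_intros) auto
      show "\<bar>p (0 - y)\<bar> \<le> \<bar>p 0\<bar> + 2 * C1" if "\<bar>y\<bar> \<le> \<epsilon>" for y
      proof -
        have y: "\<bar>y\<bar> \<le> 1" using that \<epsilon> by simp
        have "\<bar>p (0 - y) - p 0\<bar> \<le> C1 * (1 + 1) * \<bar>0 - y - 0\<bar>"
          using y by (intro C1(2)) auto
        also have "\<dots> \<le> C1 * (1 + 1) * 1" using y C1(1) by (intro mult_left_mono) auto
        finally show ?thesis by simp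
      qed
    qed
    have "\<bar>conv u (mollifier \<epsilon>) 0\<bar> \<le> D / sqrt \<epsilon> + (\<bar>p 0\<bar> + 2 * C1)"
      using 1 2 unfolding split[OF \<epsilon>(1)] by linarith
    also have "\<dots> \<le> (2 * C1 + D + \<bar>p 0\<bar>) * (1 + 1 / sqrt \<epsilon>)"
    proof -
      have "0 \<le> D + (2 * C1 + \<bar>p 0\<bar>) * (1 / sqrt \<epsilon>)" using C1(1) D0 \<epsilon> by simp
      then show ?thesis by (simp add: algebra_simps add_divide_distrib)
    qed
    finally show "\<bar>conv u (mollifier \<epsilon>) 0\<bar> \<le> (2 * C1 + D + \<bar>p 0\<bar>) * (1 + 1 / sqrt \<epsilon>)" .
  qed
qed

section \<open>From Lebesgue measurable vector functions to Borel components\<close>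

lemma conv_mollifier_measurable:
  assumes [measurable]: "v \<in> borel_measurable borel" and "\<epsilon> > 0"
  shows "conv v (mollifier \<epsilon>) \<in> borel_measurable borel"
proof -
  note [measurable] = kernel_measurable[OF kernel_mollifier(1)[OF assms(2)]]
  show ?thesis unfolding conv_def by measurable
qed

text \<open>Where \<open>v\<close> is not integrable, the integral defining the convolution is the junk value \<open>0\<close>
  on a whole neighbourhood, so that there \<open>v = v - v * \<eta>\<^sup>\<epsilon>\<close> is square integrable after all.\<close>

lemma loc_integrable_of_mollification_L2:
  assumes v[measurable]: "v \<in> borel_measurable borel" and \<epsilon>: "\<epsilon> > 0"
    and L2: "integrable lborel (\<lambda>y. (v y - conv v (mollifier \<epsilon>) y)\<^sup>2)"
  shows "loc_integrable v"
proof -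
  let ?m = "mollifier \<epsilon>"
  note [measurable] = kernel_measurable[OF kernel_mollifier(1)[OF \<epsilon>]] conv_mollifier_measurable[OF v \<epsilon>]
  have small: "set_integrable lborel {a..a + \<epsilon> / 2} v" for a
  proof (cases "\<exists>t\<in>{a..a + \<epsilon> / 2}. integrable lborel (\<lambda>y. v y * ?m (t - y))")
    case True
    then obtain t where t: "t \<in> {a..a + \<epsilon> / 2}" and i: "integrable lborel (\<lambda>y. v y * ?m (t - y))" by blast
    \<comment> \<open>For \<open>y\<close> in the short interval, \<open>t - y\<close> stays where
      the mollifier has a positive minimum; dividing by that minimum gives integrability of
      \<open>v\<close>.\<close>
    have "\<exists>x\<in>{- (\<epsilon> / 2)..\<epsilon> / 2}. \<forall>y\<in>{- (\<epsilon> / 2)..\<epsilon> / 2}. ?m x \<le> ?m y"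
      by (rule continuous_attains_inf) (use \<epsilon> continuous_on_mollifier(1) in auto)
    then obtain x where x: "x \<in> {- (\<epsilon> / 2)..\<epsilon> / 2}" and min: "\<And>y. y \<in> {- (\<epsilon> / 2)..\<epsilon> / 2} \<Longrightarrow> ?m x \<le> ?m y"
      by blast
    have pos: "?m x > 0" using x \<epsilon> by (intro mollifier_pos) (auto simp: abs_less_iff)
    show ?thesis
      unfolding set_integrable_def
    proof (rule Bochner_Integration.integrable_bound)
      show "integrable lborel (\<lambda>y. (1 / ?m x) * (v y * ?m (t - y)))"
        by (rule integrable_mult_right[OF i])
      show "AE y in lborel. norm (indicator {a..a + \<epsilon> / 2} y *\<^sub>R v y) \<le> norm ((1 / ?m x) * (v y * ?m (t - y)))"
      proof (rule AE_I2)
        fix y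
        show "norm (indicator {a..a + \<epsilon> / 2} y *\<^sub>R v y) \<le> norm ((1 / ?m x) * (v y * ?m (t - y)))"
        proof (cases "y \<in> {a..a + \<epsilon> / 2}")
          case True
          then have "?m x \<le> ?m (t - y)" using t by (intro min) auto
          then have "\<bar>v y\<bar> * ?m x \<le> \<bar>v y\<bar> * \<bar>?m (t - y)\<bar>" using pos by (intro mult_left_mono) auto
          then show ?thesis using True pos by (simp add: abs_mult pos_le_divide_eq)
        qed simp
      qed
    qed measurable
  next
    case False
    then have z: "conv v ?m t = 0" if "t \<in> {a..a + \<epsilon> / 2}" for t
      using that not_integrable_integral_eq unfolding conv_def by blast
    show ?thesis
      unfolding set_integrable_def
    proof (rule Bochner_Integration.integrable_bound)
      show "integrable lborel (\<lambda>y. indicator {a..a + \<epsilon> / 2} y + (v y - conv v ?m y)\<^sup>2)"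
        by (intro Bochner_Integration.integrable_add L2 integrable_real_indicator)
          (auto simp: emeasure_lborel_Icc_eq)
      show "AE y in lborel. norm (indicator {a..a + \<epsilon> / 2} y *\<^sub>R v y)
          \<le> norm (indicator {a..a + \<epsilon> / 2} y + (v y - conv v ?m y)\<^sup>2 :: real)"
      proof (rule AE_I2)
        fix y
        have "0 \<le> (\<bar>v y\<bar> - 1)\<^sup>2" by simp
        then have "2 * \<bar>v y\<bar> \<le> 1 + (v y)\<^sup>2" by (simp add: power2_diff)
        then have "\<bar>v y\<bar> \<le> 1 + (v y)\<^sup>2" by linarith
        then show "norm (indicator {a..a + \<epsilon> / 2} y *\<^sub>R v y)
          \<le> norm (indicator {a..a + \<epsilon> / 2} y + (v y - conv v ?m y)\<^sup>2 :: real)"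
          using z[of y] by (cases "y \<in> {a..a + \<epsilon> / 2}") auto
      qed
    qed measurable
  qed
  \<comment> \<open>Finitely many adjacent intervals of length \<open>\<epsilon> / 2\<close> cover
    any bounded interval.\<close>
  have chain: "set_integrable lborel {a..a + real n * (\<epsilon> / 2)} v" for a n
  proof (induction n)
    case 0
    show ?case by (rule set_integrable_subset[OF small[of a]]) (use \<epsilon> in auto)
  next
    case (Suc n)
    have eq: "{a..a + real (Suc n) * (\<epsilon> / 2)} =
      {a..a + real n * (\<epsilon> / 2)} \<union> {a + real n * (\<epsilon> / 2)..a + real n * (\<epsilon> / 2) + \<epsilon> / 2}"
      using \<epsilon> by (subst ivl_disj_un_two_touch(4)) (auto simp: algebra_simps add_divide_distrib)
    show ?case unfolding eq by (rule set_integrable_Un[OF Suc.IH small]) auto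
  qed
  show ?thesis unfolding loc_integrable_def
  proof
    fix R :: real
    obtain n where n: "2 * R < real n * (\<epsilon> / 2)"
      using ex_less_of_nat_mult[of "\<epsilon> / 2" "2 * R"] \<epsilon> by auto
    have "set_integrable lborel {- R..R} v"
      by (rule set_integrable_subset[OF chain[of "- R" n]]) (use n in auto)
    then show "integrable lborel (\<lambda>y. indicator {- R..R} y * v y)"
      by (simp add: set_integrable_def)
  qed
qed

text \<open>A component of \<open>u\<close> is only Lebesgue measurable, and \<open>v\<close> is a
  Borel representative. Moving the shift to the kernel first lets one null set serve every
  \<open>t\<close>, so the equality holds everywhere.\<close>

lemma convolution_component:
  assumes u: "(\<lambda>y. u y $ i) \<in> borel_measurable lebesgue" and v: "v \<in> borel_measurable borel"
    and ae: "AE y in lborel. u y $ i = v y" and \<epsilon>: "\<epsilon> > 0"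
  shows "convolution u (mollifier \<epsilon>) t $ i = conv v (mollifier \<epsilon>) t"
proof -
  have m: "mollifier \<epsilon> \<in> borel_measurable borel"
    by (rule kernel_measurable[OF kernel_mollifier(1)[OF \<epsilon>]])
  have m': "(\<lambda>y. mollifier \<epsilon> (t - y)) \<in> borel_measurable borel" using m by measurable
  then have m'': "(\<lambda>y. mollifier \<epsilon> (t - y)) \<in> borel_measurable lebesgue"
    by (simp add: measurable_completion)
  have "convolution u (mollifier \<epsilon>) t $ i = (LINT s|lebesgue. u (t - s) $ i * mollifier \<epsilon> s)"
    by (simp add: convolution_def)
  also have "\<dots> = (LINT y|lebesgue. u y $ i * mollifier \<epsilon> (t - y))"
    by (subst lebesgue_integral_real_affine[of "-1" _ t]) auto
  also have "\<dots> = (LINT y|lebesgue. v y * mollifier \<epsilon> (t - y))"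
  proof (rule integral_cong_AE)
    show "(\<lambda>y. v y * mollifier \<epsilon> (t - y)) \<in> borel_measurable lebesgue"
      using v m' by (intro measurable_completion) auto
    show "AE y in lebesgue. u y $ i * mollifier \<epsilon> (t - y) = v y * mollifier \<epsilon> (t - y)"
      using AE_completion[OF ae] by eventually_elim simp
  qed (use u m'' in \<open>intro borel_measurable_times\<close>)
  also have "\<dots> = conv v (mollifier \<epsilon>) t"
    unfolding conv_def using v m' by (intro integral_completion) auto
  finally show ?thesis .
qed

lemma square_integrable_component:
  fixes w :: "real \<Rightarrow> real ^ 'm"
  assumes w: "square_integrable w" and h: "h \<in> borel_measurable borel" and ae: "AE y in lborel. w y $ i = h y"
  shows "integrable lborel (\<lambda>y. (h y)\<^sup>2)" "(LINT y|lborel. (h y)\<^sup>2) \<le> (L2_norm w)\<^sup>2"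
proof -
  have wi: "integrable lebesgue (\<lambda>t. (norm (w t))\<^sup>2)" using w by (simp add: square_integrable_def)
  have h2: "(\<lambda>y. (h y)\<^sup>2) \<in> borel_measurable borel" using h by measurable
  have h2': "(\<lambda>y. (h y)\<^sup>2) \<in> borel_measurable lebesgue" using h2 by (simp add: measurable_completion)
  have le: "AE y in lebesgue. (h y)\<^sup>2 \<le> (norm (w y))\<^sup>2"
    using AE_completion[OF ae]
  proof eventually_elim
    case (elim y)
    show ?case
      using power_mono[OF component_le_norm_cart[of "w y" i] abs_ge_zero, of 2] elim by simp
  qed
  have i: "integrable lebesgue (\<lambda>y. (h y)\<^sup>2)"
    by (rule Bochner_Integration.integrable_bound[OF wi h2']) (use le in auto)
  then show "integrable lborel (\<lambda>y. (h y)\<^sup>2)"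
    using h2 by (simp add: integrable_completion)
  have "(LINT y|lborel. (h y)\<^sup>2) = (LINT y|lebesgue. (h y)\<^sup>2)"
    using h2 by (simp add: integral_completion)
  also have "\<dots> \<le> (LINT y|lebesgue. (norm (w y))\<^sup>2)"
    by (rule integral_mono_AE[OF i wi le])
  also have "\<dots> = (L2_norm w)\<^sup>2"
    by (simp add: L2_norm_def)
  finally show "(LINT y|lborel. (h y)\<^sup>2) \<le> (L2_norm w)\<^sup>2" .
qed

lemma mollification_rateE:
  fixes u :: "real \<Rightarrow> real ^ 'm"
  assumes rate: "mollification_rate u \<beta>"
  obtains e K where "0 < e" "e \<le> 1" "K \<ge> 0"
    "\<And>\<epsilon>. 0 < \<epsilon> \<Longrightarrow> \<epsilon> \<le> e \<Longrightarrow> square_integrable (\<lambda>t. u t - convolution u (mollifier \<epsilon>) t)"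
    "\<And>\<epsilon>. 0 < \<epsilon> \<Longrightarrow> \<epsilon> \<le> e \<Longrightarrow> L2_norm (\<lambda>t. u t - convolution u (mollifier \<epsilon>) t) \<le> K * \<epsilon> powr \<beta>"
proof -
  from rate obtain K where K: "K > 0" and ev: "\<forall>\<^sub>F \<epsilon> in at_right 0.
      norm (L2_norm (\<lambda>t. u t - convolution u (mollifier \<epsilon>) t)) \<le> K * norm (\<epsilon> powr \<beta>)"
    unfolding mollification_rate_def by (auto elim: landau_o.bigE)
  from rate have "\<forall>\<^sub>F \<epsilon> in at_right 0. square_integrable (\<lambda>t. u t - convolution u (mollifier \<epsilon>) t)"
    by (simp add: mollification_rate_def)
  from eventually_conj[OF ev this] obtain b where b: "b > 0" and
    *: "\<And>\<epsilon>. 0 < \<epsilon> \<Longrightarrow> \<epsilon> < b \<Longrightarrow> norm (L2_norm (\<lambda>t. u t - convolution u (mollifier \<epsilon>) t)) \<le> K * norm (\<epsilon> powr \<beta>)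
      \<and> square_integrable (\<lambda>t. u t - convolution u (mollifier \<epsilon>) t)"
    unfolding eventually_at_right_field by blast
  show ?thesis
  \<comment> \<open>Halving \<open>b\<close> turns the open range of scales into one that includes
    its right end.\<close>
  proof (rule that[of "min 1 (b / 2)" K])
    fix \<epsilon> :: real assume \<epsilon>: "0 < \<epsilon>" "\<epsilon> \<le> min 1 (b / 2)"
    with b have "\<epsilon> < b" by auto
    with *[OF \<epsilon>(1)] show "square_integrable (\<lambda>t. u t - convolution u (mollifier \<epsilon>) t)"
      "L2_norm (\<lambda>t. u t - convolution u (mollifier \<epsilon>) t) \<le> K * \<epsilon> powr \<beta>" by auto
  qed (use b K in auto)
qed

text \<open>The scalar estimate is applied to a Borel representative of each component, whose local
  integrability follows from the \<open>L2\<close> defect. The constants are then summed, as the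
  norm is at most the sum of the moduli of the components.\<close>

lemma convolution_lipschitz_rate:
  fixes u :: "real \<Rightarrow> real ^ 'm"
  assumes u: "u \<in> borel_measurable lebesgue" and e: "0 < e" "e \<le> 1" and K: "K \<ge> 0"
    and sq: "\<And>\<epsilon>. 0 < \<epsilon> \<Longrightarrow> \<epsilon> \<le> e \<Longrightarrow> square_integrable (\<lambda>t. u t - convolution u (mollifier \<epsilon>) t)"
    and nK: "\<And>\<epsilon>. 0 < \<epsilon> \<Longrightarrow> \<epsilon> \<le> e \<Longrightarrow> L2_norm (\<lambda>t. u t - convolution u (mollifier \<epsilon>) t) \<le> K"
  obtains C where "C \<ge> 0"
    "\<And>\<epsilon> T s t. 0 < \<epsilon> \<Longrightarrow> \<epsilon> \<le> 1 \<Longrightarrow> s \<in> {0..T} \<Longrightarrow> t \<in> {0..T} \<Longrightarrow>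
      norm (convolution u (mollifier \<epsilon>) s - convolution u (mollifier \<epsilon>) t)
        \<le> C * (1 + T + 1 / (\<epsilon> * sqrt \<epsilon>)) * \<bar>s - t\<bar>"
    "\<And>\<epsilon>. 0 < \<epsilon> \<Longrightarrow> \<epsilon> \<le> 1 \<Longrightarrow> norm (convolution u (mollifier \<epsilon>) 0) \<le> C * (1 + 1 / sqrt \<epsilon>)"
proof -
  have "\<exists>C\<ge>0. (\<forall>\<epsilon> T s t. 0 < \<epsilon> \<longrightarrow> \<epsilon> \<le> 1 \<longrightarrow> s \<in> {0..T} \<longrightarrow> t \<in> {0..T} \<longrightarrow>
        \<bar>convolution u (mollifier \<epsilon>) s $ i - convolution u (mollifier \<epsilon>) t $ i\<bar>
          \<le> C * (1 + T + 1 / (\<epsilon> * sqrt \<epsilon>)) * \<bar>s - t\<bar>) \<and>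
      (\<forall>\<epsilon>. 0 < \<epsilon> \<longrightarrow> \<epsilon> \<le> 1 \<longrightarrow> \<bar>convolution u (mollifier \<epsilon>) 0 $ i\<bar> \<le> C * (1 + 1 / sqrt \<epsilon>))" for i
  proof -
    have ui: "(\<lambda>y. u y $ i) \<in> borel_measurable lebesgue"
      by (rule measurable_compose[OF u]) (intro borel_measurable_continuous_onI continuous_intros)
    obtain v where v: "v \<in> borel_measurable borel" and ae: "AE y in lborel. u y $ i = v y"
      using completion_ex_borel_measurable_real[OF ui] by auto
    have comp: "convolution u (mollifier \<epsilon>) t $ i = conv v (mollifier \<epsilon>) t" if "\<epsilon> > 0" for \<epsilon> t
      by (rule convolution_component[OF ui v ae that])
    have dm: "(\<lambda>y. v y - conv v (mollifier \<tau>) y) \<in> borel_measurable borel" if "0 < \<tau>" for \<tau>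
      using v conv_mollifier_measurable[OF v that] by measurable
    have dae: "AE y in lborel. (u y - convolution u (mollifier \<tau>) y) $ i = v y - conv v (mollifier \<tau>) y" if "0 < \<tau>" for \<tau>
      using ae by eventually_elim (simp add: comp[OF that])
    have 1: "integrable lborel (\<lambda>y. (v y - conv v (mollifier \<tau>) y)\<^sup>2)" if "0 < \<tau>" "\<tau> \<le> e" for \<tau>
      by (rule square_integrable_component(1)[OF sq[OF that] dm[OF that(1)] dae[OF that(1)]])
    have 2: "(LINT y|lborel. (v y - conv v (mollifier \<tau>) y)\<^sup>2) \<le> K\<^sup>2" if "0 < \<tau>" "\<tau> \<le> e" for \<tau>
    proof -
      have "(LINT y|lborel. (v y - conv v (mollifier \<tau>) y)\<^sup>2)
          \<le> (L2_norm (\<lambda>t. u t - convolution u (mollifier \<tau>) t))\<^sup>2"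
        by (rule square_integrable_component(2)[OF sq[OF that] dm[OF that(1)] dae[OF that(1)]])
      also have "\<dots> \<le> K\<^sup>2"
        using nK[OF that] by (intro power_mono) (auto simp: L2_norm_def)
      finally show ?thesis .
    qed
    have lv: "loc_integrable v"
      by (rule loc_integrable_of_mollification_L2[OF v e(1) 1]) (use e in auto)
    show ?thesis
    proof (rule mollification_lipschitz_rate[OF lv e K 1 2])
      fix C assume C: "C \<ge> 0"
        "\<And>\<epsilon> T s t. 0 < \<epsilon> \<Longrightarrow> \<epsilon> \<le> 1 \<Longrightarrow> s \<in> {0..T} \<Longrightarrow> t \<in> {0..T} \<Longrightarrow>
          \<bar>conv v (mollifier \<epsilon>) s - conv v (mollifier \<epsilon>) t\<bar> \<le> C * (1 + T + 1 / (\<epsilon> * sqrt \<epsilon>)) * \<bar>s - t\<bar>"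
        "\<And>\<epsilon>. 0 < \<epsilon> \<Longrightarrow> \<epsilon> \<le> 1 \<Longrightarrow> \<bar>conv v (mollifier \<epsilon>) 0\<bar> \<le> C * (1 + 1 / sqrt \<epsilon>)"
      show ?thesis
        by (rule exI[of _ C]) (use C comp in auto)
    qed
  qed
  then obtain C where C: "\<And>i. C i \<ge> 0"
    "\<And>i \<epsilon> T s t. 0 < \<epsilon> \<Longrightarrow> \<epsilon> \<le> 1 \<Longrightarrow> s \<in> {0..T} \<Longrightarrow> t \<in> {0..T} \<Longrightarrow>
        \<bar>convolution u (mollifier \<epsilon>) s $ i - convolution u (mollifier \<epsilon>) t $ i\<bar>
          \<le> C i * (1 + T + 1 / (\<epsilon> * sqrt \<epsilon>)) * \<bar>s - t\<bar>"
    "\<And>i \<epsilon>. 0 < \<epsilon> \<Longrightarrow> \<epsilon> \<le> 1 \<Longrightarrow> \<bar>convolution u (mollifier \<epsilon>) 0 $ i\<bar> \<le> C i * (1 + 1 / sqrt \<epsilon>)"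
    by metis
  show ?thesis
  proof (rule that[of "\<Sum>i\<in>UNIV. C i"])
    show "(\<Sum>i\<in>UNIV. C i) \<ge> 0" using C(1) by (intro sum_nonneg) auto
    fix \<epsilon> :: real assume \<epsilon>: "0 < \<epsilon>" "\<epsilon> \<le> 1"
    show "norm (convolution u (mollifier \<epsilon>) s - convolution u (mollifier \<epsilon>) t)
        \<le> (\<Sum>i\<in>UNIV. C i) * (1 + T + 1 / (\<epsilon> * sqrt \<epsilon>)) * \<bar>s - t\<bar>"
      if "s \<in> {0..T}" "t \<in> {0..T}" for s t T
      unfolding sum_distrib_right
      by (rule order_trans[OF norm_le_l1_cart sum_mono]) (use C(2)[OF \<epsilon> that] in simp)
    show "norm (convolution u (mollifier \<epsilon>) 0) \<le> (\<Sum>i\<in>UNIV. C i) * (1 + 1 / sqrt \<epsilon>)"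
      unfolding sum_distrib_right
      by (rule order_trans[OF norm_le_l1_cart sum_mono]) (use C(3)[OF \<epsilon>] in simp)
  qed
qed

section \<open>Trajectories and discounted integrals\<close>

lemma exp_has_integral_Icc:
  assumes "0 \<le> m" "\<Lambda> \<noteq> 0"
  shows "((\<lambda>s::real. exp (\<Lambda> * s)) has_integral (exp (\<Lambda> * m) / \<Lambda> - 1 / \<Lambda>)) {0..m}"
proof -
  have "((\<lambda>s. exp (\<Lambda> * s)) has_integral (exp (\<Lambda> * m) / \<Lambda> - exp (\<Lambda> * 0) / \<Lambda>)) {0..m}"
    by (rule fundamental_theorem_of_calculus)
      (use assms in \<open>auto intro!: derivative_eq_intros
        simp flip: has_real_derivative_iff_has_vector_derivative\<close>)
  then show ?thesis by simp
qed

lemma primitive_lipschitz: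
  fixes h :: "real \<Rightarrow> 'a::banach"
  assumes h: "continuous_on UNIV h" and F: "\<And>s. norm (h s) \<le> F"
  shows "F-lipschitz_on {0..} (\<lambda>m. integral {0..m} h)"
proof -
  have F0: "F \<ge> 0" using norm_ge_zero[of "h 0"] F[of 0] by linarith
  have le: "norm (integral {0..n} h - integral {0..m} h) \<le> F * (n - m)" if "0 \<le> m" "m \<le> n" for m n
  proof -
    have "h integrable_on {0..n}"
      by (intro integrable_continuous_real continuous_on_subset[OF h]) auto
    then have "integral {0..n} h - integral {0..m} h = integral {m..n} h"
      by (simp add: Henstock_Kurzweil_Integration.integral_combine[OF that, symmetric])
    then show ?thesis
      using integral_bound[OF that(2) continuous_on_subset[OF h] F] by simp
  qed
  show ?thesis
  proof (rule lipschitz_onI[OF _ F0])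
    fix m n :: real assume "m \<in> {0..}" "n \<in> {0..}"
    then show "dist (integral {0..m} h) (integral {0..n} h) \<le> F * dist m n"
      using le[of m n] le[of n m] by (cases "m \<le> n") (auto simp: dist_norm norm_minus_commute)
  qed
qed

text \<open>Banach's fixed point theorem for \<open>z t = exp (- \<Lambda> t) (x t - x0)\<close>, where the weight with
  \<open>\<Lambda> > K\<close> makes the integral operator a contraction on the whole half-line.\<close>

lemma trajectory_exists:
  fixes f :: "(real ^ 'n) \<times> (real ^ 'm) \<Rightarrow> real ^ 'n"
  assumes F: "\<And>p. norm (f p) \<le> F" and lip: "K-lipschitz_on UNIV f"
    and b: "continuous_on {0..} b"
  shows "\<exists>x. trajectory f x0 b x"
proof -
  have K0: "K \<ge> 0" using lip lipschitz_on_nonneg by blast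
  have F0: "F \<ge> 0" using norm_ge_zero[of "f 0"] F[of 0] by linarith
  have cf: "continuous_on UNIV f" by (rule lipschitz_on_continuous_on[OF lip])
  define \<Lambda> where "\<Lambda> = K + 1"
  have \<Lambda>: "\<Lambda> > 0" "K < \<Lambda>" using K0 by (auto simp: \<Lambda>_def)
  \<comment> \<open>Freezing \<open>b\<close> at its initial value for negative times extends the
    problem to the whole line, so that the complete space of bounded continuous functions on
    \<open>real\<close> can be used.\<close>
  define h where "h z s = f (x0 + exp (\<Lambda> * s) *\<^sub>R z s, b (max 0 s))" for z :: "real \<Rightarrow> real ^ 'n" and s
  define \<Phi> where "\<Phi> z t = exp (- \<Lambda> * max 0 t) *\<^sub>R integral {0..max 0 t} (h z)"
    for z :: "real \<Rightarrow> real ^ 'n" and t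
  have ch: "continuous_on A (h z)" if "continuous_on UNIV z" for z A
  proof -
    have "continuous_on UNIV (\<lambda>s. b (max 0 s))"
      by (rule continuous_on_compose2[OF b]) (auto intro!: continuous_intros)
    then have "continuous_on UNIV (h z)"
      unfolding h_def using that
      by (intro continuous_on_compose2[OF cf] continuous_intros) auto
    then show ?thesis by (rule continuous_on_subset) simp
  qed
  have hF: "norm (h z s) \<le> F" for z s by (simp add: h_def F)
  have \<Phi>b: "\<Phi> z \<in> bcontfun" if z: "continuous_on UNIV z" for z
  proof (rule bcontfun_normI)
    have "continuous_on UNIV (\<lambda>t. integral {0..max 0 t} (h z))"
      by (rule continuous_on_compose2[OF lipschitz_on_continuous_on[OF primitive_lipschitz[OF ch[OF z] hF]]])
        (auto intro!: continuous_intros)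
    then show "continuous_on UNIV (\<Phi> z)"
      unfolding \<Phi>_def by (intro continuous_intros)
    fix t :: real
    define m where "m = max 0 t"
    have m: "m \<ge> 0" by (simp add: m_def)
    have "norm (integral {0..m} (h z)) \<le> F * (m - 0)"
      by (rule integral_bound[OF m ch[OF z] hF])
    then have "norm (\<Phi> z t) \<le> exp (- \<Lambda> * m) * (F * m)"
      by (simp add: \<Phi>_def m_def mult_left_mono)
    also have "\<dots> \<le> F / \<Lambda>"
    proof -
      have "\<Lambda> * m \<le> exp (\<Lambda> * m)" using exp_ge_add_one_self[of "\<Lambda> * m"] by linarith
      then have "exp (- \<Lambda> * m) * (\<Lambda> * m) \<le> 1" by (simp add: exp_minus field_simps)
      from mult_left_mono[OF this F0] show ?thesis using \<Lambda>(1) by (simp add: field_simps)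
    qed
    finally show "norm (\<Phi> z t) \<le> F / \<Lambda>" .
  qed
  \<comment> \<open>The integrands differ by at most \<open>K * d * exp (\<Lambda> * s)\<close>.
    Integration gains \<open>1 / \<Lambda>\<close>, and the weight cancels the remaining
    exponential.\<close>
  have contr: "norm (\<Phi> z t - \<Phi> w t) \<le> (K / \<Lambda>) * d"
    if z: "continuous_on UNIV z" and w: "continuous_on UNIV w" and d: "\<And>s. dist (z s) (w s) \<le> d" for z w t d
  proof -
    have d0: "d \<ge> 0" using d[of 0] zero_le_dist order_trans by blast
    define m where "m = max 0 t"
    have m: "m \<ge> 0" by (simp add: m_def)
    have iz: "h z integrable_on {0..m}" "h w integrable_on {0..m}"
      by (intro integrable_continuous_real ch z w)+
    have ex: "((\<lambda>s. (K * d) * exp (\<Lambda> * s)) has_integral ((K * d) * (exp (\<Lambda> * m) / \<Lambda> - 1 / \<Lambda>))) {0..m}"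
      by (intro has_integral_mult_right exp_has_integral_Icc m) (use \<Lambda> in auto)
    have "norm (integral {0..m} (\<lambda>s. h z s - h w s)) \<le> integral {0..m} (\<lambda>s. (K * d) * exp (\<Lambda> * s))"
    proof (rule Henstock_Kurzweil_Integration.integral_norm_bound_integral)
      fix s
      have "norm (h z s - h w s) \<le> K * dist (x0 + exp (\<Lambda> * s) *\<^sub>R z s, b (max 0 s)) (x0 + exp (\<Lambda> * s) *\<^sub>R w s, b (max 0 s))"
        unfolding h_def dist_norm[symmetric] by (rule lipschitz_onD[OF lip]) auto
      also have "\<dots> = K * (exp (\<Lambda> * s) * dist (z s) (w s))"
        by (simp add: dist_Pair_Pair dist_norm flip: scaleR_diff_right)
      also have "\<dots> \<le> K * (exp (\<Lambda> * s) * d)"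
        using K0 d by (intro mult_left_mono) auto
      finally show "norm (h z s - h w s) \<le> (K * d) * exp (\<Lambda> * s)" by (simp add: mult_ac)
    qed (use iz ex in \<open>auto intro: integrable_diff\<close>)
    also have "\<dots> = (K * d) * (exp (\<Lambda> * m) / \<Lambda> - 1 / \<Lambda>)" by (rule integral_unique[OF ex])
    also have "\<dots> \<le> (K * d) * (exp (\<Lambda> * m) / \<Lambda>)"
      using K0 d0 \<Lambda> by (intro mult_left_mono) auto
    finally have *: "norm (integral {0..m} (h z) - integral {0..m} (h w)) \<le> (K * d) * (exp (\<Lambda> * m) / \<Lambda>)"
      using iz by (simp add: Henstock_Kurzweil_Integration.integral_diff)
    have "norm (\<Phi> z t - \<Phi> w t) = exp (- \<Lambda> * m) * norm (integral {0..m} (h z) - integral {0..m} (h w))"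
      by (simp add: \<Phi>_def m_def flip: scaleR_diff_right)
    also have "\<dots> \<le> exp (- \<Lambda> * m) * ((K * d) * (exp (\<Lambda> * m) / \<Lambda>))"
      by (rule mult_left_mono[OF *]) simp
    also have "\<dots> = (K / \<Lambda>) * d" by (simp add: exp_minus field_simps)
    finally show ?thesis .
  qed
  define \<Psi> where "\<Psi> z = Bcontfun (\<Phi> (apply_bcontfun z))" for z :: "real \<Rightarrow>\<^sub>C (real ^ 'n)"
  have ap: "apply_bcontfun (\<Psi> z) = \<Phi> (apply_bcontfun z)" for z
    unfolding \<Psi>_def by (rule Bcontfun_inverse[OF \<Phi>b]) simp
  have "\<exists>!z. \<Psi> z = z"
  proof (rule banach_fix_type[of "K / \<Lambda>"])
    show "\<forall>z w. dist (\<Psi> z) (\<Psi> w) \<le> K / \<Lambda> * dist z w"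
    proof (intro allI dist_bound)
      fix z w :: "real \<Rightarrow>\<^sub>C (real ^ 'n)" and t
      show "dist (apply_bcontfun (\<Psi> z) t) (apply_bcontfun (\<Psi> w) t) \<le> K / \<Lambda> * dist z w"
        unfolding ap dist_norm[of "\<Phi> _ _"] by (rule contr) (auto intro: dist_bounded)
    qed
  qed (use K0 \<Lambda> in auto)
  then obtain z where "\<Psi> z = z" by blast
  then have fix_z: "apply_bcontfun z t = \<Phi> (apply_bcontfun z) t" for t using ap by metis
  let ?z = "apply_bcontfun z"
  define x where "x t = x0 + exp (\<Lambda> * t) *\<^sub>R ?z t" for t
  have hx: "h ?z s = f (x s, b s)" if "s \<ge> 0" for s using that by (simp add: h_def x_def max_def)
  have "set_integrable lebesgue {0..t} (\<lambda>s. f (x s, b s)) \<and> x t = x0 + (LINT s:{0..t}|lebesgue. f (x s, b s))"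
    if t: "t \<ge> 0" for t
  proof -
    have "set_integrable lborel {0..t} (h ?z)"
      by (intro borel_integrable_atLeastAtMost' ch) simp
    then have "integrable lborel (\<lambda>s. indicator {0..t} s *\<^sub>R h ?z s)"
      by (simp add: set_integrable_def)
    then have "integrable lebesgue (\<lambda>s. indicator {0..t} s *\<^sub>R h ?z s)"
      using borel_measurable_integrable integrable_completion by blast
    also have "(\<lambda>s. indicator {0..t} s *\<^sub>R h ?z s) = (\<lambda>s. indicator {0..t} s *\<^sub>R f (x s, b s))"
      using hx by (auto simp: indicator_def)
    finally have si: "set_integrable lebesgue {0..t} (\<lambda>s. f (x s, b s))"
      by (simp add: set_integrable_def)
    have "(LINT s:{0..t}|lebesgue. f (x s, b s)) = integral {0..t} (\<lambda>s. f (x s, b s))"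
      by (rule set_lebesgue_integral_eq_integral(2)[OF si])
    also have "\<dots> = integral {0..t} (h ?z)"
      by (rule Henstock_Kurzweil_Integration.integral_cong) (simp add: hx)
    also have "\<dots> = exp (\<Lambda> * t) *\<^sub>R ?z t"
      unfolding fix_z[of t] \<Phi>_def using t by (simp add: max_def flip: exp_add)
    finally show ?thesis using si by (simp add: x_def)
  qed
  then show ?thesis unfolding trajectory_def by blast
qed

text \<open>Increments of \<open>x\<close> are integrals of a field bounded by \<open>F\<close>.
  This supplies the continuity of trajectories behind the later measurability arguments.\<close>

lemma trajectory_lipschitz:
  assumes tr: "trajectory f x0 a x" and F: "\<And>p. norm (f p) \<le> F"
  shows "F-lipschitz_on {0..} x"
proof -
  have F0: "F \<ge> 0" using norm_ge_zero[of "f undefined"] F[of undefined] by linarith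
  have int: "(\<lambda>s. f (x s, a s)) integrable_on {0..t}" and
    xt: "x t = x0 + integral {0..t} (\<lambda>s. f (x s, a s))" if "t \<ge> 0" for t
    using tr that set_lebesgue_integral_eq_integral[of "{0..t}" "\<lambda>s. f (x s, a s)"]
    by (auto simp: trajectory_def)
  have le: "norm (x n - x m) \<le> F * (n - m)" if "0 \<le> m" "m \<le> n" for m n
  proof -
    let ?h = "\<lambda>s. f (x s, a s)"
    have n0: "0 \<le> n" using that by simp
    have "x n - x m = integral {0..n} ?h - integral {0..m} ?h"
      using xt[OF n0] xt[OF that(1)] by simp
    also have "\<dots> = integral {m..n} ?h"
      by (simp add: Henstock_Kurzweil_Integration.integral_combine[OF that int[OF n0], symmetric])
    finally have eq: "x n - x m = integral {m..n} ?h" .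
    have "?h integrable_on {m..n}"
      by (rule integrable_on_subinterval[OF int[OF n0]]) (use that in auto)
    then have "(?h has_integral (x n - x m)) {m..n}"
      unfolding eq by (rule integrable_integral)
    then have "norm (x n - x m) \<le> F * measure lborel {m..n}"
      by (rule has_integral_bound_real[OF F0 finite.emptyI]) (simp add: F)
    then show ?thesis using that by simp
  qed
  show ?thesis
  proof (rule lipschitz_onI[OF _ F0])
    fix m n :: real assume "m \<in> {0..}" "n \<in> {0..}"
    then show "dist (x m) (x n) \<le> F * dist m n"
      using le[of m n] le[of n m] by (cases "m \<le> n") (auto simp: dist_norm norm_minus_commute)
  qed
qed

section \<open>Discounted integrals on the half-line\<close>

lemma integrable_exp_tail:
  assumes "(\<gamma>::real) > 0"
  shows "integrable lborel (\<lambda>t. indicator {c..} t * exp (- \<gamma> * t))"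
    "(LINT t|lborel. indicator {c..} t * exp (- \<gamma> * t)) = exp (- \<gamma> * c) / \<gamma>"
proof -
  have hi: "((\<lambda>t. exp (- \<gamma> * t)) has_integral exp (- \<gamma> * c) / \<gamma>) {c..}"
    by (rule has_integral_exp_minus_to_infinity[OF assms])
  then have ai: "(\<lambda>t. exp (- \<gamma> * t)) absolutely_integrable_on {c..}"
    by (intro nonnegative_absolutely_integrable_1) (auto simp: integrable_on_def)
  have m: "(\<lambda>t. indicator {c..} t * exp (- \<gamma> * t)) \<in> borel_measurable borel" by measurable
  show "integrable lborel (\<lambda>t. indicator {c..} t * exp (- \<gamma> * t))"
    using ai m by (simp add: set_integrable_def integrable_completion)
  have "(LINT t|lborel. indicator {c..} t * exp (- \<gamma> * t)) = (LINT t:{c..}|lebesgue. exp (- \<gamma> * t))"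
    using m by (simp add: set_lebesgue_integral_def integral_completion)
  also have "\<dots> = exp (- \<gamma> * c) / \<gamma>"
    using set_lebesgue_integral_eq_integral(2)[OF ai] integral_unique[OF hi] by simp
  finally show "(LINT t|lborel. indicator {c..} t * exp (- \<gamma> * t)) = exp (- \<gamma> * c) / \<gamma>" .
qed

lemma discounted_integrable:
  assumes "(\<gamma>::real) > 0" and m: "H \<in> borel_measurable (lebesgue_on {0..})"
    and H: "\<And>s. s \<ge> 0 \<Longrightarrow> \<bar>H s\<bar> \<le> M"
  shows "set_integrable lebesgue {0..} (\<lambda>s. exp (- \<gamma> * s) * H s)"
    and "\<bar>LINT s:{0..}|lebesgue. exp (- \<gamma> * s) * H s\<bar> \<le> M / \<gamma>"
proof -
  let ?e = "\<lambda>t::real. M * (indicator {0..} t * exp (- \<gamma> * t))"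
  have i0: "integrable lborel ?e" by (intro integrable_mult_right integrable_exp_tail assms)
  then have ei: "integrable lebesgue ?e"
    using borel_measurable_integrable integrable_completion by blast
  have le: "norm (indicator {0..} s *\<^sub>R (exp (- \<gamma> * s) * H s)) \<le> ?e s" for s
  proof (cases "s \<ge> 0")
    case True
    then have "exp (- \<gamma> * s) * \<bar>H s\<bar> \<le> exp (- \<gamma> * s) * M" by (intro mult_left_mono H) auto
    then show ?thesis using True by (simp add: abs_mult mult.commute)
  qed simp
  have "(\<lambda>s. exp (- \<gamma> * s) * H s) \<in> borel_measurable (lebesgue_on {0..})"
    by (intro borel_measurable_times m continuous_imp_measurable_on_sets_lebesgue continuous_intros) auto
  then have meas: "(\<lambda>s. indicator {0..} s *\<^sub>R (exp (- \<gamma> * s) * H s)) \<in> borel_measurable lebesgue"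
    by (simp add: borel_measurable_restrict_space_iff)
  have int: "integrable lebesgue (\<lambda>s. indicator {0..} s *\<^sub>R (exp (- \<gamma> * s) * H s))"
  proof (rule Bochner_Integration.integrable_bound[OF ei meas])
    show "AE s in lebesgue. norm (indicator {0..} s *\<^sub>R (exp (- \<gamma> * s) * H s)) \<le> norm (?e s)"
      using le by (intro AE_I2) (metis abs_ge_self order_trans real_norm_def)
  qed
  then show "set_integrable lebesgue {0..} (\<lambda>s. exp (- \<gamma> * s) * H s)"
    by (simp add: set_integrable_def)
  have "norm (LINT s|lebesgue. indicator {0..} s *\<^sub>R (exp (- \<gamma> * s) * H s)) \<le> (LINT s|lebesgue. ?e s)"
    by (rule Bochner_Integration.integral_norm_bound_integral[OF int ei le])
  also have "\<dots> = (LINT s|lborel. ?e s)"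
    by (rule integral_completion) measurable
  also have "\<dots> = M / \<gamma>"
    using integrable_exp_tail(2)[OF assms(1), of 0] by (subst integral_mult_right_zero) simp
  finally show "\<bar>LINT s:{0..}|lebesgue. exp (- \<gamma> * s) * H s\<bar> \<le> M / \<gamma>"
    by (simp add: set_lebesgue_integral_def)
qed

text \<open>Fubini on the region \<open>0 \<le> s \<le> t\<close>: integrating
  \<open>exp (- \<gamma> * t)\<close> over \<open>t \<ge> s\<close> leaves
  \<open>exp (- \<gamma> * s) / \<gamma>\<close>. This identity takes the place of Gronwall's
  lemma.\<close>

lemma discounted_primitive_lborel:
  assumes \<gamma>: "(\<gamma>::real) > 0" and H[measurable]: "H \<in> borel_measurable borel"
    and b: "\<And>s. 0 \<le> H s" "\<And>s. H s \<le> M"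
  shows "integrable lborel (\<lambda>t. indicator {0..} t * (exp (- \<gamma> * t) * (LINT s|lborel. indicator {0..t} s * H s)))"
    and "(LINT t|lborel. indicator {0..} t * (exp (- \<gamma> * t) * (LINT s|lborel. indicator {0..t} s * H s)))
      = (LINT s|lborel. indicator {0..} s * (exp (- \<gamma> * s) * H s)) / \<gamma>"
proof -
  let ?G = "\<lambda>s t. indicator {0..} s * H s * (indicator {s..} t * exp (- \<gamma> * t))"
  have tail: "(LINT t|lborel. ?G s t) = indicator {0..} s * (exp (- \<gamma> * s) * H s) / \<gamma>" for s
    using integrable_exp_tail(2)[OF \<gamma>, of s] by (subst integral_mult_right_zero) simp
  have li: "integrable lborel (\<lambda>s. indicator {0..} s * (exp (- \<gamma> * s) * H s))"
  proof (rule Bochner_Integration.integrable_bound)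
    show "integrable lborel (\<lambda>t. M * (indicator {0..} t * exp (- \<gamma> * t)))"
      by (intro integrable_mult_right integrable_exp_tail \<gamma>)
    show "AE s in lborel. norm (indicator {0..} s * (exp (- \<gamma> * s) * H s)) \<le> norm (M * (indicator {0..} s * exp (- \<gamma> * s)))"
      using b order_trans[OF b(1) b(2)] by (intro AE_I2) (auto simp: abs_mult indicator_def)
  qed measurable
  have mG: "(\<lambda>(s, t). ?G s t) \<in> borel_measurable (lborel \<Otimes>\<^sub>M lborel)"
  proof -
    have [measurable]: "Measurable.pred (lborel \<Otimes>\<^sub>M lborel) (\<lambda>(s, t). (s::real) \<le> t)" by measurable
    have "(\<lambda>(s, t). indicator {0..} s * H s * ((if s \<le> t then 1 else 0) * exp (- \<gamma> * t))) \<in> borel_measurable (lborel \<Otimes>\<^sub>M lborel)"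
      by measurable
    also have "(\<lambda>(s, t). indicator {0..} s * H s * ((if s \<le> t then 1 else 0) * exp (- \<gamma> * t))) = (\<lambda>(s, t). ?G s t)"
      by (auto simp: indicator_def fun_eq_iff)
    finally show ?thesis .
  qed
  have nonneg: "norm (?G s t) = ?G s t" for s t using b(1)[of s] by (simp add: abs_mult)
  have iG: "integrable (lborel \<Otimes>\<^sub>M lborel) (\<lambda>(s, t). ?G s t)"
  proof (rule lborel_pair.Fubini_integrable[OF mG])
    show "integrable lborel (\<lambda>s. LINT t|lborel. norm (case (s, t) of (s, t) \<Rightarrow> ?G s t))"
      unfolding prod.case nonneg tail using li by simp
    show "AE s in lborel. integrable lborel (\<lambda>t. case (s, t) of (s, t) \<Rightarrow> ?G s t)"
      unfolding prod.case by (intro AE_I2 integrable_mult_right integrable_exp_tail \<gamma>)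
  qed
  have sw: "(LINT s|lborel. ?G s t) = indicator {0..} t * (exp (- \<gamma> * t) * (LINT s|lborel. indicator {0..t} s * H s))" for t
  proof -
    have "(LINT s|lborel. ?G s t) = (LINT s|lborel. (indicator {0..} t * exp (- \<gamma> * t)) * (indicator {0..t} s * H s))"
      by (rule Bochner_Integration.integral_cong) (auto simp: indicator_def)
    also have "\<dots> = (indicator {0..} t * exp (- \<gamma> * t)) * (LINT s|lborel. indicator {0..t} s * H s)"
      by (rule integral_mult_right_zero)
    finally show ?thesis by simp
  qed
  show "integrable lborel (\<lambda>t. indicator {0..} t * (exp (- \<gamma> * t) * (LINT s|lborel. indicator {0..t} s * H s)))"
    using lborel_pair.integrable_snd[OF iG] by (simp only: sw)
  have "(LINT t|lborel. LINT s|lborel. ?G s t) = (LINT s|lborel. LINT t|lborel. ?G s t)"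
    using lborel_pair.Fubini_integral[OF iG] by simp
  then show "(LINT t|lborel. indicator {0..} t * (exp (- \<gamma> * t) * (LINT s|lborel. indicator {0..t} s * H s)))
      = (LINT s|lborel. indicator {0..} s * (exp (- \<gamma> * s) * H s)) / \<gamma>"
    unfolding sw tail by simp
qed

lemma discounted_primitive:
  assumes \<gamma>: "(\<gamma>::real) > 0" and H: "H \<in> borel_measurable lebesgue"
    and b: "\<And>s. 0 \<le> H s" "\<And>s. H s \<le> M"
  shows "set_integrable lebesgue {0..} (\<lambda>t. exp (- \<gamma> * t) * (LINT s:{0..t}|lebesgue. H s))"
    and "(LINT t:{0..}|lebesgue. exp (- \<gamma> * t) * (LINT s:{0..t}|lebesgue. H s))
      = (LINT s:{0..}|lebesgue. exp (- \<gamma> * s) * H s) / \<gamma>"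
proof -
  obtain H0 where H0: "H0 \<in> borel_measurable lborel" "AE s in lborel. H s = H0 s"
    using completion_ex_borel_measurable_real[OF H] by auto
  \<comment> \<open>Clipping the Borel representative to \<open>[0, M]\<close> restores the bounds
    at every point without changing it almost everywhere.\<close>
  define H' where "H' s = max 0 (min M (H0 s))" for s
  have M: "M \<ge> 0" using order_trans[OF b(1) b(2)] .
  have mH[measurable]: "H' \<in> borel_measurable borel" unfolding H'_def using H0(1) by measurable
  have "AE s in lborel. H s = H' s"
    using H0(2) by eventually_elim (metis H'_def b max.absorb2 min.absorb2)
  then have ae: "AE s in lebesgue. H s = H' s" by (rule AE_completion)
  have b': "0 \<le> H' s" "H' s \<le> M" for s using M by (auto simp: H'_def)
  have e1: "(LINT s:{0..t}|lebesgue. H s) = (LINT s|lborel. indicator {0..t} s * H' s)" for t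
  proof -
    have "(LINT s:{0..t}|lebesgue. H s) = (LINT s|lebesgue. indicator {0..t} s * H' s)"
      unfolding set_lebesgue_integral_def
    proof (rule integral_cong_AE)
      show "(\<lambda>s. indicator {0..t} s *\<^sub>R H s) \<in> borel_measurable lebesgue"
        by (intro borel_measurable_scaleR borel_measurable_indicator H) auto
      show "(\<lambda>s. indicator {0..t} s * H' s) \<in> borel_measurable lebesgue"
        by (intro measurable_completion) measurable
    qed (use ae in \<open>eventually_elim, simp\<close>)
    also have "\<dots> = (LINT s|lborel. indicator {0..t} s * H' s)"
      by (rule integral_completion) measurable
    finally show ?thesis .
  qed
  have e2: "(LINT s:{0..}|lebesgue. exp (- \<gamma> * s) * H s) = (LINT s|lborel. indicator {0..} s * (exp (- \<gamma> * s) * H' s))"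
  proof -
    have em: "(\<lambda>s::real. exp (- \<gamma> * s)) \<in> borel_measurable lebesgue"
      by (intro measurable_completion) measurable
    have "(LINT s:{0..}|lebesgue. exp (- \<gamma> * s) * H s) = (LINT s|lebesgue. indicator {0..} s * (exp (- \<gamma> * s) * H' s))"
      unfolding set_lebesgue_integral_def
    proof (rule integral_cong_AE)
      show "(\<lambda>s. indicator {0..} s *\<^sub>R (exp (- \<gamma> * s) * H s)) \<in> borel_measurable lebesgue"
        by (intro borel_measurable_scaleR borel_measurable_times em borel_measurable_indicator H) auto
      show "(\<lambda>s. indicator {0..} s * (exp (- \<gamma> * s) * H' s)) \<in> borel_measurable lebesgue"
        by (intro measurable_completion) measurable
    qed (use ae in \<open>eventually_elim, simp\<close>)
    also have "\<dots> = (LINT s|lborel. indicator {0..} s * (exp (- \<gamma> * s) * H' s))"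
      by (rule integral_completion) measurable
    finally show ?thesis .
  qed
  note L = discounted_primitive_lborel[OF \<gamma> mH b']
  have mb: "(\<lambda>t. indicator {0..} t * (exp (- \<gamma> * t) * (LINT s|lborel. indicator {0..t} s * H' s))) \<in> borel_measurable lborel"
    by (rule borel_measurable_integrable[OF L(1)])
  show "set_integrable lebesgue {0..} (\<lambda>t. exp (- \<gamma> * t) * (LINT s:{0..t}|lebesgue. H s))"
    using L(1) mb by (simp add: set_integrable_def e1 integrable_completion)
  show "(LINT t:{0..}|lebesgue. exp (- \<gamma> * t) * (LINT s:{0..t}|lebesgue. H s))
      = (LINT s:{0..}|lebesgue. exp (- \<gamma> * s) * H s) / \<gamma>"
    unfolding e1 e2 using L(2) mb by (simp add: set_lebesgue_integral_def integral_completion)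
qed

section \<open>Dependence of the payoff on the control\<close>

lemma measurable_along_trajectory:
  fixes a :: "real \<Rightarrow> real ^ 'm" and x :: "real \<Rightarrow> real ^ 'n"
    and g :: "(real ^ 'n) \<times> (real ^ 'm) \<Rightarrow> 'k::topological_space"
  assumes "a \<in> controls" "continuous_on {0..} x" "continuous_on UNIV g"
  shows "(\<lambda>s. g (x s, a s)) \<in> borel_measurable (lebesgue_on {0..})"
proof -
  have "x \<in> borel_measurable (lebesgue_on {0..})"
    by (rule continuous_imp_measurable_on_sets_lebesgue[OF assms(2)]) auto
  moreover have "a \<in> borel_measurable (lebesgue_on {0..})"
    using assms(1) by (simp add: controls_def)
  ultimately have "(\<lambda>s. (x s, a s)) \<in> borel_measurable (lebesgue_on {0..})"
    by (rule borel_measurable_Pair)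
  from measurable_compose[OF this borel_measurable_continuous_onI[OF assms(3)]] show ?thesis .
qed

text \<open>The Lipschitz bound covers controls at distance at most \<open>1\<close>, and
  boundedness covers larger distances. The cap at \<open>1\<close> keeps discounted integrals finite
  for unbounded controls.\<close>

lemma bounded_lipschitz_le_min:
  fixes g :: "'a::real_normed_vector \<times> 'b::real_normed_vector \<Rightarrow> 'c::real_normed_vector"
  assumes B: "\<And>p. norm (g p) \<le> B" and lip: "K-lipschitz_on UNIV g"
  shows "norm (g (x, a) - g (y, b)) \<le> K * norm (x - y) + (2 * B + K) * min 1 (norm (a - b))"
proof -
  have K: "K \<ge> 0" using lip lipschitz_on_nonneg by blast
  have B0: "B \<ge> 0" using norm_ge_zero[of "g undefined"] B[of undefined] by linarith
  have 1: "norm (g (x, a) - g (y, a)) \<le> K * norm (x - y)"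
    using lipschitz_onD[OF lip, of "(x, a)" "(y, a)"] by (simp add: dist_Pair_Pair dist_norm)
  have 2: "norm (g (y, a) - g (y, b)) \<le> K * norm (a - b)"
    using lipschitz_onD[OF lip, of "(y, a)" "(y, b)"] by (simp add: dist_Pair_Pair dist_norm)
  have 3: "norm (g (y, a) - g (y, b)) \<le> 2 * B"
    using norm_triangle_ineq4[of "g (y, a)" "g (y, b)"] B[of "(y, a)"] B[of "(y, b)"] by linarith
  have "norm (g (y, a) - g (y, b)) \<le> (2 * B + K) * min 1 (norm (a - b))"
  proof (cases "norm (a - b) \<le> 1")
    case True
    have "0 \<le> 2 * B * norm (a - b)" using B0 by simp
    then show ?thesis using 2 True by (simp add: distrib_right)
  next
    case False
    then show ?thesis using 3 K by simp
  qed
  then show ?thesis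
    using 1 norm_triangle_ineq[of "g (x, a) - g (y, a)" "g (y, a) - g (y, b)"] by simp
qed

text \<open>Write \<open>W\<close> for the discounted integral. The trajectory equation and
  \<open>discounted_primitive\<close> give \<open>\<gamma> * W D \<le> W H\<close>, while regularity
  of \<open>f\<close> gives \<open>W H \<le> K * W D + N * W \<mu>\<close>. As
  \<open>\<gamma>\<close> exceeds \<open>K\<close>, the distance \<open>W D\<close> is absorbed and
  is bounded by \<open>W \<mu>\<close>; the bounds on \<open>r\<close> then carry this over to the
  payoffs.\<close>

lemma payoff_difference:
  fixes f :: "(real ^ 'n) \<times> (real ^ 'm) \<Rightarrow> real ^ 'n" and r :: "(real ^ 'n) \<times> (real ^ 'm) \<Rightarrow> real"
  assumes F: "\<And>p. norm (f p) \<le> F" and R: "\<And>p. \<bar>r p\<bar> \<le> R"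
    and lf: "K-lipschitz_on UNIV f" and lr: "K'-lipschitz_on UNIV r"
    and \<gamma>: "\<gamma> \<ge> K + 1 / 2"
    and a: "a \<in> controls" and b: "b \<in> controls"
    and x: "trajectory f x0 a x" and y: "trajectory f x0 b y"
  shows "\<bar>payoff r \<gamma> x a - payoff r \<gamma> y b\<bar> \<le> (2 * K' * (2 * F + K) + (2 * R + K')) *
    (LINT s:{0..}|lebesgue. exp (- \<gamma> * s) * min 1 (norm (a s - b s)))"
proof -
  have K: "K \<ge> 0" "K' \<ge> 0" using lf lr lipschitz_on_nonneg by blast+
  have \<gamma>0: "\<gamma> > 0" using \<gamma> K by linarith
  have cf: "continuous_on UNIV f" and cr: "continuous_on UNIV r"
    using lf lr lipschitz_on_continuous_on by blast+
  have cx: "continuous_on {0..} x" and cy: "continuous_on {0..} y"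
    using trajectory_lipschitz[OF x F] trajectory_lipschitz[OF y F] lipschitz_on_continuous_on by blast+
  define W where "W h = (LINT s:{0..}|lebesgue. exp (- \<gamma> * s) * h s)" for h :: "real \<Rightarrow> real"
  define H where "H s = norm (f (x s, a s) - f (y s, b s))" for s
  define D where "D s = norm (x s - y s)" for s
  define \<mu> where "\<mu> s = min 1 (norm (a s - b s))" for s
  define N where "N = 2 * F + K"
  note mf = measurable_along_trajectory[OF a cx cf] measurable_along_trajectory[OF b cy cf]
  note mr = measurable_along_trajectory[OF a cx cr] measurable_along_trajectory[OF b cy cr]
  have mab: "(\<lambda>s. a s) \<in> borel_measurable (lebesgue_on {0..})" "(\<lambda>s. b s) \<in> borel_measurable (lebesgue_on {0..})"
    using a b by (auto simp: controls_def)
  have m\<mu>: "\<mu> \<in> borel_measurable (lebesgue_on {0..})"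
    unfolding \<mu>_def using mab by measurable
  have mH: "H \<in> borel_measurable (lebesgue_on {0..})"
    unfolding H_def using mf by measurable
  have H: "0 \<le> H s" "H s \<le> 2 * F" for s
    using norm_triangle_ineq4[of "f (x s, a s)" "f (y s, b s)"] F[of "(x s, a s)"] F[of "(y s, b s)"]
    by (auto simp: H_def)
  have iH: "set_integrable lebesgue {0..} (\<lambda>s. exp (- \<gamma> * s) * H s)"
    by (rule discounted_integrable(1)[OF \<gamma>0 mH, of "2 * F"]) (use H in auto)
  have i\<mu>: "set_integrable lebesgue {0..} (\<lambda>s. exp (- \<gamma> * s) * \<mu> s)"
    by (rule discounted_integrable(1)[OF \<gamma>0 m\<mu>, of 1]) (auto simp: \<mu>_def)
  \<comment> \<open>\<open>discounted_primitive\<close> expects a measurable function on the whole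
    line, whereas measurability of \<open>H\<close> is available on nonnegative times only.\<close>
  define H1 where "H1 s = indicator {0..} s * H s" for s
  have mH1: "H1 \<in> borel_measurable lebesgue"
    using mH unfolding H1_def by (simp add: borel_measurable_restrict_space_iff)
  have H1: "0 \<le> H1 s" "H1 s \<le> 2 * F" for s
    using H[of s] by (auto simp: H1_def indicator_def)
  note prim = discounted_primitive[OF \<gamma>0 mH1 H1]
  have D_le: "D t \<le> (LINT s:{0..t}|lebesgue. H1 s)" if t: "t \<ge> 0" for t
  proof -
    have fi: "set_integrable lebesgue {0..t} (\<lambda>s. f (x s, a s))" "set_integrable lebesgue {0..t} (\<lambda>s. f (y s, b s))"
      using x y t by (auto simp: trajectory_def)
    have "x t - y t = (LINT s:{0..t}|lebesgue. f (x s, a s)) - (LINT s:{0..t}|lebesgue. f (y s, b s))"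
      using x y t by (simp add: trajectory_def)
    also have "\<dots> = (LINT s:{0..t}|lebesgue. f (x s, a s) - f (y s, b s))"
      by (rule set_integral_diff(2)[symmetric, OF fi])
    finally have "D t = norm (LINT s:{0..t}|lebesgue. f (x s, a s) - f (y s, b s))"
      by (simp add: D_def)
    also have "\<dots> \<le> (LINT s:{0..t}|lebesgue. norm (f (x s, a s) - f (y s, b s)))"
      by (rule set_integral_norm_bound[OF set_integral_diff(1)[OF fi]])
    also have "\<dots> = (LINT s:{0..t}|lebesgue. H1 s)"
      by (rule set_lebesgue_integral_cong) (auto simp: H1_def H_def)
    finally show ?thesis .
  qed
  have D0: "D s \<ge> 0" for s by (simp add: D_def)
  \<comment> \<open>Absorbing \<open>W D\<close> requires it to be a genuine finite integral; the
    discounted primitive of \<open>H1\<close> is an integrable majorant.\<close>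
  have iD: "set_integrable lebesgue {0..} (\<lambda>s. exp (- \<gamma> * s) * D s)"
  proof (rule set_integrable_bound[OF prim(1)])
    have "(\<lambda>s. exp (- \<gamma> * s) * D s) \<in> borel_measurable (lebesgue_on {0..})"
      unfolding D_def
      by (intro continuous_imp_measurable_on_sets_lebesgue continuous_intros cx cy) auto
    then show "set_borel_measurable lebesgue {0..} (\<lambda>s. exp (- \<gamma> * s) * D s)"
      by (simp add: set_borel_measurable_def borel_measurable_restrict_space_iff)
    show "AE t in lebesgue. t \<in> {0..} \<longrightarrow>
        norm (exp (- \<gamma> * t) * D t) \<le> norm (exp (- \<gamma> * t) * (LINT s:{0..t}|lebesgue. H1 s))"
    proof (intro AE_I2 impI)
      fix t :: real assume "t \<in> {0..}"
      then have "D t \<le> \<bar>LINT s:{0..t}|lebesgue. H1 s\<bar>" using D_le[of t] by auto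
      then show "norm (exp (- \<gamma> * t) * D t) \<le> norm (exp (- \<gamma> * t) * (LINT s:{0..t}|lebesgue. H1 s))"
        using D0[of t] by (simp add: abs_mult)
    qed
  qed
  have WD0: "W D \<ge> 0" and W\<mu>0: "W \<mu> \<ge> 0"
    unfolding W_def set_lebesgue_integral_def by (simp_all add: D0 \<mu>_def)
  have lin: "W h \<le> c * W D + d * W \<mu>"
    if ih: "set_integrable lebesgue {0..} (\<lambda>s. exp (- \<gamma> * s) * h s)"
      and le: "\<And>s. h s \<le> c * D s + d * \<mu> s" for h c d
  proof -
    have i: "set_integrable lebesgue {0..} (\<lambda>s. c * (exp (- \<gamma> * s) * D s) + d * (exp (- \<gamma> * s) * \<mu> s))"
      by (intro set_integral_add set_integrable_mult_right iD i\<mu>)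
    have "W h \<le> (LINT s:{0..}|lebesgue. c * (exp (- \<gamma> * s) * D s) + d * (exp (- \<gamma> * s) * \<mu> s))"
      unfolding W_def
    proof (rule set_integral_mono[OF ih i])
      fix s
      have "exp (- \<gamma> * s) * h s \<le> exp (- \<gamma> * s) * (c * D s + d * \<mu> s)"
        by (rule mult_left_mono[OF le]) simp
      then show "exp (- \<gamma> * s) * h s \<le> c * (exp (- \<gamma> * s) * D s) + d * (exp (- \<gamma> * s) * \<mu> s)"
        by (simp add: algebra_simps)
    qed
    also have "\<dots> = c * W D + d * W \<mu>"
      unfolding W_def using iD i\<mu> by (simp add: set_integral_add(2))
    finally show ?thesis .
  qed
  have "W D \<le> (LINT t:{0..}|lebesgue. exp (- \<gamma> * t) * (LINT s:{0..t}|lebesgue. H1 s))"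
    unfolding W_def by (rule set_integral_mono[OF iD prim(1)]) (simp add: D_le)
  also have "\<dots> = (LINT s:{0..}|lebesgue. exp (- \<gamma> * s) * H1 s) / \<gamma>"
    by (rule prim(2))
  also have "(LINT s:{0..}|lebesgue. exp (- \<gamma> * s) * H1 s) = W H"
    unfolding W_def by (rule set_lebesgue_integral_cong) (auto simp: H1_def)
  finally have "\<gamma> * W D \<le> W H" using \<gamma>0 by (simp add: field_simps)
  also have "W H \<le> K * W D + N * W \<mu>"
    by (rule lin[OF iH]) (auto simp: H_def D_def \<mu>_def N_def intro: bounded_lipschitz_le_min[OF F lf])
  finally have 1: "(\<gamma> - K) * W D \<le> N * W \<mu>" by (simp add: algebra_simps)
  \<comment> \<open>The margin \<open>1 / 2\<close> between \<open>\<gamma>\<close> and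
    \<open>K\<close> gives a bound independent of \<open>\<gamma>\<close>.\<close>
  have "(1 / 2) * W D \<le> (\<gamma> - K) * W D"
    using \<gamma> WD0 by (intro mult_right_mono) auto
  with 1 have WD: "W D \<le> 2 * N * W \<mu>" by linarith
  have ir: "set_integrable lebesgue {0..} (\<lambda>s. exp (- \<gamma> * s) * r (x s, a s))"
    "set_integrable lebesgue {0..} (\<lambda>s. exp (- \<gamma> * s) * r (y s, b s))"
    by (rule discounted_integrable(1)[OF \<gamma>0 mr(1) R] discounted_integrable(1)[OF \<gamma>0 mr(2) R])+
  have id: "set_integrable lebesgue {0..} (\<lambda>s. exp (- \<gamma> * s) * \<bar>r (x s, a s) - r (y s, b s)\<bar>)"
  proof (rule discounted_integrable(1)[OF \<gamma>0])
    show "(\<lambda>s. \<bar>r (x s, a s) - r (y s, b s)\<bar>) \<in> borel_measurable (lebesgue_on {0..})"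
      by (intro borel_measurable_abs borel_measurable_diff mr)
    show "\<bar>\<bar>r (x s, a s) - r (y s, b s)\<bar>\<bar> \<le> 2 * R" for s
      using abs_triangle_ineq4[of "r (x s, a s)" "r (y s, b s)"] R[of "(x s, a s)"] R[of "(y s, b s)"] by simp
  qed
  have "\<bar>payoff r \<gamma> x a - payoff r \<gamma> y b\<bar>
      = norm (LINT s:{0..}|lebesgue. exp (- \<gamma> * s) * r (x s, a s) - exp (- \<gamma> * s) * r (y s, b s))"
    unfolding payoff_def by (simp only: set_integral_diff(2)[OF ir] real_norm_def)
  also have "\<dots> \<le> (LINT s:{0..}|lebesgue. norm (exp (- \<gamma> * s) * r (x s, a s) - exp (- \<gamma> * s) * r (y s, b s)))"
    by (rule set_integral_norm_bound[OF set_integral_diff(1)[OF ir]])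
  also have "\<dots> = W (\<lambda>s. \<bar>r (x s, a s) - r (y s, b s)\<bar>)"
    unfolding W_def by (simp add: abs_mult flip: right_diff_distrib)
  also have "\<dots> \<le> K' * W D + (2 * R + K') * W \<mu>"
  proof (rule lin[OF id])
    fix s
    show "\<bar>r (x s, a s) - r (y s, b s)\<bar> \<le> K' * D s + (2 * R + K') * \<mu> s"
      using bounded_lipschitz_le_min[of r R K' "x s" "a s" "y s" "b s"] R lr by (simp add: D_def \<mu>_def)
  qed
  also have "\<dots> \<le> K' * (2 * N * W \<mu>) + (2 * R + K') * W \<mu>"
    using WD K(2) by (intro add_right_mono mult_left_mono)
  also have "\<dots> = (2 * K' * (2 * F + K) + (2 * R + K')) * W \<mu>"
    by (simp add: N_def algebra_simps)
  finally show ?thesis by (simp add: W_def \<mu>_def)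
qed

lemma payoff_bounded:
  fixes r :: "(real ^ 'n) \<times> (real ^ 'm) \<Rightarrow> real" and f :: "(real ^ 'n) \<times> (real ^ 'm) \<Rightarrow> real ^ 'n"
  assumes F: "\<And>p. norm (f p) \<le> F" and R: "\<And>p. \<bar>r p\<bar> \<le> R" and r: "continuous_on UNIV r"
    and "\<gamma> > 0" and "a \<in> controls" and x: "trajectory f x0 a x"
  shows "\<bar>payoff r \<gamma> x a\<bar> \<le> R / \<gamma>"
  unfolding payoff_def
  using trajectory_lipschitz[OF x F] lipschitz_on_continuous_on
  by (intro discounted_integrable(2) assms measurable_along_trajectory) blast

section \<open>Approximating the optimal control\<close>

text \<open>Values of a control at negative times are arbitrary, so the extension is assembled from
  the zero extension of \<open>a\<close> and its reflection, both measurable on the line.\<close>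

lemma odd_ext_measurable:
  assumes "a \<in> controls"
  shows "odd_ext a \<in> borel_measurable lebesgue"
proof -
  have m: "(\<lambda>s. indicator {0..} s *\<^sub>R a s) \<in> borel_measurable lebesgue"
    using assms by (simp add: controls_def borel_measurable_restrict_space_iff)
  have "(\<lambda>s::real. - s) \<in> lebesgue \<rightarrow>\<^sub>M lebesgue"
    using lebesgue_affine_measurable[of "\<lambda>_::real. - 1" 0] by (simp add: Basis_real_def)
  from measurable_compose[OF this m]
  have m': "(\<lambda>s. indicator {0..} (- s) *\<^sub>R a (- s)) \<in> borel_measurable lebesgue" .
  have "(\<lambda>s. indicator {0<..} s *\<^sub>R (indicator {0..} s *\<^sub>R a s)
      - indicator {..<0} s *\<^sub>R (indicator {0..} (- s) *\<^sub>R a (- s))) \<in> borel_measurable lebesgue"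
    by (intro borel_measurable_diff borel_measurable_scaleR borel_measurable_indicator m m') auto
  also have "(\<lambda>s. indicator {0<..} s *\<^sub>R (indicator {0..} s *\<^sub>R a s)
      - indicator {..<0} s *\<^sub>R (indicator {0..} (- s) *\<^sub>R a (- s))) = odd_ext a"
    by (auto simp: odd_ext_def indicator_def fun_eq_iff)
  finally show ?thesis .
qed

text \<open>Up to time \<open>h\<close> the capped integrand is at most \<open>1\<close>, after time
  \<open>T\<close> the discount leaves \<open>exp (- T)\<close>, and in between Cauchy-Schwarz pairs
  the discount with the \<open>L2\<close> distance to \<open>w\<close>.\<close>

lemma discounted_control_error:
  fixes a b w :: "real \<Rightarrow> real ^ 'm"
  assumes \<gamma>: "\<gamma> \<ge> 1" and a: "a \<in> controls" and b: "b \<in> controls" and h: "h > 0"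
    and sq: "square_integrable (\<lambda>s. odd_ext a s - w s)"
    and bw: "\<And>s. s \<in> {h..T} \<Longrightarrow> b s = w s"
  shows "(LINT s:{0..}|lebesgue. exp (- \<gamma> * s) * min 1 (norm (a s - b s)))
    \<le> h + L2_norm (\<lambda>s. odd_ext a s - w s) + exp (- T)"
proof -
  define g where "g s = norm (odd_ext a s - w s)" for s
  \<comment> \<open>Because \<open>\<gamma> \<ge> 1\<close>, the discount may be replaced by rate
    \<open>1\<close>; the squared \<open>L2\<close> norm of \<open>E\<close> is then
    \<open>1 / 2\<close>.\<close>
  define E where "E s = indicator {0..} s * exp (- 1 * s)" for s :: real
  have mg: "g \<in> borel_measurable lebesgue" and g2: "integrable lebesgue (\<lambda>s. (g s)\<^sup>2)"
    using sq unfolding g_def square_integrable_def by auto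
  have mE0: "E \<in> borel_measurable borel" unfolding E_def by measurable
  then have mE: "E \<in> borel_measurable lebesgue" by (simp add: measurable_completion)
  have E2: "(E s)\<^sup>2 = indicator {0..} s * exp (- 2 * s)" for s
    by (auto simp: E_def indicator_def power2_eq_square simp flip: exp_add)
  have iE2: "integrable lebesgue (\<lambda>s. (E s)\<^sup>2)"
    using integrable_exp_tail(1)[of 2 0] mE0 unfolding E2 by (subst integrable_completion) auto
  have "(LINT s|lebesgue. (E s)\<^sup>2) = (LINT s|lborel. (E s)\<^sup>2)"
    using mE0 by (intro integral_completion) measurable
  also have "\<dots> = 1 / 2" unfolding E2 using integrable_exp_tail(2)[of 2 0] by simp
  finally have E1: "sqrt (LINT s|lebesgue. (E s)\<^sup>2) \<le> 1" by simp
  note cs = integral_Cauchy_Schwarz[OF mE mg iE2 g2]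
  have L2: "sqrt (LINT s|lebesgue. (g s)\<^sup>2) = L2_norm (\<lambda>s. odd_ext a s - w s)"
    by (simp add: L2_norm_def g_def)
  have mid: "(LINT s|lebesgue. E s * g s) \<le> L2_norm (\<lambda>s. odd_ext a s - w s)"
  proof -
    have "(LINT s|lebesgue. E s * g s) \<le> sqrt (LINT s|lebesgue. (E s)\<^sup>2) * sqrt (LINT s|lebesgue. (g s)\<^sup>2)"
      using cs(2) by linarith
    also have "\<dots> \<le> 1 * sqrt (LINT s|lebesgue. (g s)\<^sup>2)"
      using E1 by (intro mult_right_mono) auto
    finally show ?thesis by (simp add: L2)
  qed
  define X where "X s = indicator {T..} s * exp (- 1 * s)" for s :: real
  have mX: "X \<in> borel_measurable borel" unfolding X_def by measurable
  have iX: "integrable lebesgue X" "(LINT s|lebesgue. X s) = exp (- T)"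
    using integrable_exp_tail[of 1 T] mX
    by (auto simp: X_def[abs_def] integrable_completion integral_completion)
  have iI: "integrable lebesgue (indicator {0..h} :: real \<Rightarrow> real)" "(LINT s|lebesgue. indicator {0..h} s) = h"
    using h by (auto simp: integrable_completion integral_completion emeasure_lborel_Icc_eq)
  have ia: "set_integrable lebesgue {0..} (\<lambda>s. exp (- \<gamma> * s) * min 1 (norm (a s - b s)))"
  proof (rule discounted_integrable(1)[where M = 1])
    show "(\<lambda>s. min 1 (norm (a s - b s))) \<in> borel_measurable (lebesgue_on {0..})"
      using a b unfolding controls_def by measurable
  qed (use \<gamma> in auto)
  have "(LINT s:{0..}|lebesgue. exp (- \<gamma> * s) * min 1 (norm (a s - b s)))
      \<le> (LINT s|lebesgue. indicator {0..h} s + E s * g s + X s)"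
    unfolding set_lebesgue_integral_def
  proof (rule integral_mono)
    show "integrable lebesgue (\<lambda>s. indicator {0..} s *\<^sub>R (exp (- \<gamma> * s) * min 1 (norm (a s - b s))))"
      using ia by (simp add: set_integrable_def)
    show "integrable lebesgue (\<lambda>s. indicator {0..h} s + E s * g s + X s)"
      by (intro Bochner_Integration.integrable_add iI iX cs)
    fix s
    show "indicator {0..} s *\<^sub>R (exp (- \<gamma> * s) * min 1 (norm (a s - b s))) \<le> indicator {0..h} s + E s * g s + X s"
    proof (cases "s \<ge> 0")
      case False
      then show ?thesis by (simp add: E_def X_def indicator_def)
    next
      case True
      have e1: "exp (- \<gamma> * s) \<le> exp (- s)" using \<gamma> True by (simp add: mult_le_cancel_right1)
      have e2: "exp (- s) \<le> 1" using True by simp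
      have nn: "0 \<le> E s * g s" "0 \<le> X s" "0 \<le> min 1 (norm (a s - b s))" by (auto simp: E_def X_def g_def)
      have le: "exp (- \<gamma> * s) * min 1 (norm (a s - b s)) \<le> exp (- s) * min 1 (norm (a s - b s))"
        by (rule mult_right_mono[OF e1 nn(3)])
      have le1: "exp (- s) * min 1 (norm (a s - b s)) \<le> exp (- s)"
        by (rule mult_left_le) auto
      consider "s \<le> h" | "s > T" | "h < s" "s \<le> T" by linarith
      then have "exp (- s) * min 1 (norm (a s - b s)) \<le> indicator {0..h} s + E s * g s + X s"
      proof cases
        case 1
        then have "indicator {0..h} s = (1::real)" using True by simp
        then show ?thesis using le1 e2 nn by linarith
      next
        case 2
        then have "X s = exp (- s)" by (simp add: X_def)
        moreover have "(0::real) \<le> indicator {0..h} s" by simp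
        ultimately show ?thesis using le1 nn by linarith
      next
        \<comment> \<open>Here \<open>s > h > 0\<close>, so the odd extension agrees with
          \<open>a\<close>, while \<open>b\<close> agrees with \<open>w\<close>.\<close>
        case 3
        then have "a s - b s = odd_ext a s - w s" using h bw[of s] by (simp add: odd_ext_def)
        then have "exp (- s) * min 1 (norm (a s - b s)) \<le> E s * g s"
          using True by (auto simp: E_def g_def)
        moreover have "(0::real) \<le> indicator {0..h} s" by simp
        ultimately show ?thesis using nn by linarith
      qed
      with le True show ?thesis by simp
    qed
  qed
  also have "\<dots> = h + (LINT s|lebesgue. E s * g s) + exp (- T)"
    using iI iX cs(1) by simp
  finally show ?thesis using mid by linarith
qed

text \<open>Stopping time at \<open>T\<close> does not increase distances, and the ramp has slope at
  most \<open>m\<close>. The ramp adds \<open>c\<close> at time \<open>0\<close> and, for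
  \<open>m > 0\<close>, nothing from time \<open>1 / m\<close> on, which allows a prescribed initial
  value.\<close>

lemma capped_control_lipschitz:
  fixes w :: "real \<Rightarrow> 'a::real_normed_vector"
  assumes w: "\<And>s t. s \<in> {0..T} \<Longrightarrow> t \<in> {0..T} \<Longrightarrow> norm (w s - w t) \<le> \<Lambda> * \<bar>s - t\<bar>"
    and T: "T \<ge> 0" and m: "m \<ge> 0" and \<Lambda>: "\<Lambda> \<ge> 0" and L: "\<Lambda> + m * norm c \<le> L"
  shows "L-lipschitz_on {0..} (\<lambda>s. w (min s T) + max 0 (1 - m * s) *\<^sub>R c)"
proof (rule lipschitz_onI)
  have mc: "m * norm c \<ge> 0" using m by simp
  with L \<Lambda> show "L \<ge> 0" by linarith
  fix s t :: real assume st: "s \<in> {0..}" "t \<in> {0..}"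
  have "norm (w (min s T) - w (min t T)) \<le> \<Lambda> * \<bar>min s T - min t T\<bar>"
    using st T by (intro w) auto
  also have "\<dots> \<le> \<Lambda> * \<bar>s - t\<bar>" by (intro mult_left_mono \<Lambda>) auto
  finally have 1: "norm (w (min s T) - w (min t T)) \<le> \<Lambda> * \<bar>s - t\<bar>" .
  have "\<bar>max 0 (1 - m * s) - max 0 (1 - m * t)\<bar> \<le> \<bar>m * s - m * t\<bar>" by auto
  also have "\<dots> = m * \<bar>s - t\<bar>" using m by (simp add: abs_mult flip: right_diff_distrib)
  finally have "\<bar>max 0 (1 - m * s) - max 0 (1 - m * t)\<bar> * norm c \<le> m * \<bar>s - t\<bar> * norm c"
    by (rule mult_right_mono) simp
  then have 2: "norm (max 0 (1 - m * s) *\<^sub>R c - max 0 (1 - m * t) *\<^sub>R c) \<le> m * norm c * \<bar>s - t\<bar>"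
    by (simp add: mult_ac flip: scaleR_diff_left)
  have "dist (w (min s T) + max 0 (1 - m * s) *\<^sub>R c) (w (min t T) + max 0 (1 - m * t) *\<^sub>R c)
      \<le> norm (w (min s T) - w (min t T)) + norm (max 0 (1 - m * s) *\<^sub>R c - max 0 (1 - m * t) *\<^sub>R c)"
    unfolding dist_norm by (rule norm_diff_triangle_ineq)
  also have "\<dots> \<le> (\<Lambda> + m * norm c) * \<bar>s - t\<bar>" using 1 2 by (simp add: distrib_right)
  also have "\<dots> \<le> L * \<bar>s - t\<bar>" by (intro mult_right_mono L) simp
  finally show "dist (w (min s T) + max 0 (1 - m * s) *\<^sub>R c) (w (min t T) + max 0 (1 - m * t) *\<^sub>R c) \<le> L * dist s t"
    by (simp add: dist_real_def)
qed

section \<open>The convergence rate of the value functions\<close>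

lemma lip_const_less:
  assumes "\<exists>K. K-lipschitz_on UNIV g" "\<delta> > 0"
  obtains K where "K-lipschitz_on UNIV g" "K < lip_const g + \<delta>"
proof -
  have "Inf {K. K-lipschitz_on UNIV g} < lip_const g + \<delta>" using assms(2) by (simp add: lip_const_def)
  from cInf_lessD[OF _ this] assms(1) show ?thesis using that by blast
qed

lemma lip_const_nonneg:
  assumes "\<exists>K. K-lipschitz_on UNIV g"
  shows "lip_const g \<ge> 0"
  unfolding lip_const_def using assms lipschitz_on_nonneg by (intro cInf_greatest) auto

theorem theorem4p9:
  fixes f :: "(real ^ 'n) \<times> (real ^ 'm) \<Rightarrow> real ^ 'n"
    and r :: "(real ^ 'n) \<times> (real ^ 'm) \<Rightarrow> real"
    and \<gamma> \<sigma> \<beta> :: real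
    and x0 :: "real ^ 'n" and a0 :: "real ^ 'm"
    and a_opt :: "real \<Rightarrow> real ^ 'm"
  assumes f_bounded: "bounded (range f)"
    and f_lipschitz: "\<exists>K. K-lipschitz_on UNIV f"
    and r_bounded: "bounded (range r)"
    and r_lipschitz: "\<exists>K. K-lipschitz_on UNIV r"
    and discount: "\<gamma> \<ge> lip_const f + 1"
    and sigma_pos: "\<sigma> > 0"
    and decay: "\<exists>C>0. \<forall>y b. b \<noteq> 0 \<longrightarrow> norm (f (y, b)) + \<bar>r (y, b)\<bar> \<le> C / norm b powr \<sigma>"
    and optimal: "optimal_control f r \<gamma> x0 a_opt"
    and beta_pos: "\<beta> > 0"
    and rate: "mollification_rate (odd_ext a_opt) \<beta>"
  shows "(\<lambda>L. \<bar>lip_value_fn f r \<gamma> L x0 a0 - value_fn f r \<gamma> x0\<bar>)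
    \<in> O[at_top](\<lambda>L. ln L / L powr (\<sigma> / 2) + (ln L / sqrt L) powr \<beta> + 1 / sqrt L)"
proof -
  obtain F where F: "\<And>p. norm (f p) \<le> F" using f_bounded unfolding bounded_iff by auto
  obtain R where R: "\<And>p. \<bar>r p\<bar> \<le> R" using r_bounded unfolding bounded_iff by auto
  \<comment> \<open>Half of the unit gap in \<open>discount\<close> pays for replacing the infimum
    \<open>lip_const f\<close> by an actual Lipschitz constant; the other half is the margin in
    \<open>payoff_difference\<close>.\<close>
  obtain K where lf: "K-lipschitz_on UNIV f" and "K < lip_const f + 1 / 2"
    by (rule lip_const_less[OF f_lipschitz, of "1 / 2"]) auto
  with discount have \<gamma>K: "\<gamma> \<ge> K + 1 / 2" by linarith
  obtain K' where lr: "K'-lipschitz_on UNIV r" using r_lipschitz by blast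
  have cr: "continuous_on UNIV r" by (rule lipschitz_on_continuous_on[OF lr])
  have \<gamma>1: "\<gamma> \<ge> 1" using discount lip_const_nonneg[OF f_lipschitz] by linarith
  then have \<gamma>0: "\<gamma> > 0" by linarith
  obtain x where a: "a_opt \<in> controls" and x: "trajectory f x0 a_opt x"
    and opt: "value_fn f r \<gamma> x0 = payoff r \<gamma> x a_opt"
    using optimal by (auto simp: optimal_control_def)
  let ?u = "odd_ext a_opt"
  let ?w = "\<lambda>\<epsilon>. convolution ?u (mollifier \<epsilon>)"
  obtain e M where e: "0 < e" "e \<le> 1" and M: "M \<ge> 0"
    and sq: "\<And>\<epsilon>. 0 < \<epsilon> \<Longrightarrow> \<epsilon> \<le> e \<Longrightarrow> square_integrable (\<lambda>t. ?u t - ?w \<epsilon> t)"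
    and L2: "\<And>\<epsilon>. 0 < \<epsilon> \<Longrightarrow> \<epsilon> \<le> e \<Longrightarrow> L2_norm (\<lambda>t. ?u t - ?w \<epsilon> t) \<le> M * \<epsilon> powr \<beta>"
    by (rule mollification_rateE[OF rate]) blast
  \<comment> \<open>Besides the rate, the Lipschitz estimate for mollified controls needs a bound
    uniform in the scale.\<close>
  have L2': "L2_norm (\<lambda>t. ?u t - ?w \<epsilon> t) \<le> M" if \<epsilon>: "0 < \<epsilon>" "\<epsilon> \<le> e" for \<epsilon>
  proof -
    have "\<epsilon> powr \<beta> \<le> 1" using \<epsilon> e beta_pos by (intro powr_le1) auto
    then have "M * \<epsilon> powr \<beta> \<le> M" using M by (intro mult_left_le) auto
    with L2[OF \<epsilon>] show ?thesis by linarith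
  qed
  obtain C where C: "C \<ge> 0"
    "\<And>\<epsilon> T s t. 0 < \<epsilon> \<Longrightarrow> \<epsilon> \<le> 1 \<Longrightarrow> s \<in> {0..T} \<Longrightarrow> t \<in> {0..T} \<Longrightarrow>
      norm (?w \<epsilon> s - ?w \<epsilon> t) \<le> C * (1 + T + 1 / (\<epsilon> * sqrt \<epsilon>)) * \<bar>s - t\<bar>"
    "\<And>\<epsilon>. 0 < \<epsilon> \<Longrightarrow> \<epsilon> \<le> 1 \<Longrightarrow> norm (?w \<epsilon> 0) \<le> C * (1 + 1 / sqrt \<epsilon>)"
    by (rule convolution_lipschitz_rate[OF odd_ext_measurable[OF a] e M sq L2']) (assumption | rule that)+
  define N where "N = 2 * K' * (2 * F + K) + (2 * R + K')"
  have N: "N \<ge> 0"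
  proof -
    have "K \<ge> 0" "K' \<ge> 0" "F \<ge> 0" "R \<ge> 0"
      using lf lr lipschitz_on_nonneg norm_ge_zero[of "f 0"] F[of 0] abs_ge_zero[of "r 0"] R[of 0]
      by (blast, blast, linarith, linarith)
    then show ?thesis by (simp add: N_def)
  qed
  let ?S = "{payoff r \<gamma> y b | y b. b \<in> controls \<and> trajectory f x0 b y}"
  have bdd: "bdd_above ?S"
    using payoff_bounded[OF F R cr \<gamma>0] by (intro bdd_aboveI[of _ "R / \<gamma>"]) (auto simp: abs_le_iff)
  \<comment> \<open>The three side conditions hold for all large \<open>L\<close>. The last is
    exactly the requirement that the approximating control be \<open>L\<close>-Lipschitz.\<close>
  have gap: "\<bar>lip_value_fn f r \<gamma> L x0 a0 - value_fn f r \<gamma> x0\<bar>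
      \<le> N * (2 / sqrt L + M * (ln L / sqrt L) powr \<beta>)"
    if L1: "L \<ge> exp 1" and Le: "1 / sqrt L \<le> e"
      and LL: "C * (1 + ln L + 1 / (1 / sqrt L * sqrt (1 / sqrt L)))
        + sqrt L * (norm a0 + C * (1 + 1 / sqrt (1 / sqrt L))) \<le> L" for L
  proof -
    \<comment> \<open>The initial layer then costs \<open>1 / sqrt L\<close>, and the tail after
      \<open>T\<close> costs \<open>exp (- T) = 1 / L\<close>.\<close>
    define \<epsilon> T where "\<epsilon> = 1 / sqrt L" and "T = ln L"
    have L0: "L > 0" "L \<ge> 1"
      using L1 exp_gt_zero[of 1] exp_ge_add_one_self[of 1] by linarith+
    have T: "T \<ge> 1" unfolding T_def using L1 L0 by (simp add: ln_ge_iff)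
    have \<epsilon>: "0 < \<epsilon>" "\<epsilon> \<le> e" "\<epsilon> \<le> 1" using Le L0 e by (auto simp: \<epsilon>_def)
    \<comment> \<open>The ramp of slope \<open>sqrt L\<close> moves the initial value to
      \<open>a0\<close> and has died out at time \<open>\<epsilon>\<close>.\<close>
    define b where "b s = ?w \<epsilon> (min s T) + max 0 (1 - sqrt L * s) *\<^sub>R (a0 - ?w \<epsilon> 0)" for s
    have lip: "L-lipschitz_on {0..} b"
      unfolding b_def
    proof (rule capped_control_lipschitz[OF C(2)[OF \<epsilon>(1,3)]])
      have "norm (a0 - ?w \<epsilon> 0) \<le> norm a0 + C * (1 + 1 / sqrt \<epsilon>)"
        using norm_triangle_ineq4[of a0 "?w \<epsilon> 0"] C(3)[OF \<epsilon>(1,3)] by linarith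
      then have "sqrt L * norm (a0 - ?w \<epsilon> 0) \<le> sqrt L * (norm a0 + C * (1 + 1 / sqrt \<epsilon>))"
        using L0 by (intro mult_left_mono) auto
      then show "C * (1 + T + 1 / (\<epsilon> * sqrt \<epsilon>)) + sqrt L * norm (a0 - ?w \<epsilon> 0) \<le> L"
        using LL unfolding \<epsilon>_def T_def by linarith
    qed (use T L0 C(1) \<epsilon> in auto)
    have cb: "continuous_on {0..} b" by (rule lipschitz_on_continuous_on[OF lip])
    have b: "b \<in> controls"
      unfolding controls_def by (rule continuous_imp_measurable_on_sets_lebesgue[OF cb]) auto
    have b0: "b 0 = a0" using T by (simp add: b_def)
    obtain y where y: "trajectory f x0 b y" using trajectory_exists[OF F lf cb] by blast
    have bw: "b s = ?w \<epsilon> s" if "s \<in> {\<epsilon>..T}" for s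
    proof -
      have "1 \<le> sqrt L * s" using that L0 by (simp add: \<epsilon>_def field_simps)
      then show ?thesis using that by (simp add: b_def)
    qed
    have "\<bar>payoff r \<gamma> x a_opt - payoff r \<gamma> y b\<bar>
        \<le> N * (LINT s:{0..}|lebesgue. exp (- \<gamma> * s) * min 1 (norm (a_opt s - b s)))"
      unfolding N_def by (rule payoff_difference[OF F R lf lr \<gamma>K a b x y])
    also have "\<dots> \<le> N * (\<epsilon> + L2_norm (\<lambda>t. ?u t - ?w \<epsilon> t) + exp (- T))"
      by (intro mult_left_mono discounted_control_error[OF \<gamma>1 a b] sq bw \<epsilon> N)
    also have "\<dots> \<le> N * (2 / sqrt L + M * (ln L / sqrt L) powr \<beta>)"
    proof (intro mult_left_mono N)
      have "sqrt L \<le> L" using L0 by (intro real_le_lsqrt) (auto simp: power2_eq_square)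
      have "exp (- T) = 1 / L" using L0 by (simp add: T_def exp_minus inverse_eq_divide)
      also have "\<dots> \<le> 1 / sqrt L" using L0 \<open>sqrt L \<le> L\<close> by (intro divide_left_mono) auto
      finally have 1: "exp (- T) \<le> 1 / sqrt L" .
      \<comment> \<open>From \<open>L \<ge> exp 1\<close> it follows that
        \<open>ln L \<ge> 1\<close>, hence \<open>\<epsilon> \<le> ln L / sqrt L\<close>.\<close>
      have "\<epsilon> powr \<beta> \<le> (ln L / sqrt L) powr \<beta>"
        using T L0 beta_pos unfolding \<epsilon>_def T_def by (intro powr_mono2 divide_right_mono) auto
      then have "M * \<epsilon> powr \<beta> \<le> M * (ln L / sqrt L) powr \<beta>" using M by (rule mult_left_mono)
      with L2[OF \<epsilon>(1,2)] 1
      show "\<epsilon> + L2_norm (\<lambda>t. ?u t - ?w \<epsilon> t) + exp (- T) \<le> 2 / sqrt L + M * (ln L / sqrt L) powr \<beta>"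
        unfolding \<epsilon>_def by simp
    qed
    finally have diff: "\<bar>payoff r \<gamma> x a_opt - payoff r \<gamma> y b\<bar> \<le> N * (2 / sqrt L + M * (ln L / sqrt L) powr \<beta>)" .
    \<comment> \<open>Fewer controls compete in \<open>lip_value_fn\<close>, so it is at most
      \<open>value_fn\<close>; the control \<open>b\<close> gives the reverse estimate and shows
      that the set is nonempty.\<close>
    let ?SL = "{payoff r \<gamma> y b | y b. b \<in> lip_controls L \<and> b 0 = a0 \<and> trajectory f x0 b y}"
    have mem: "payoff r \<gamma> y b \<in> ?SL" using b lip b0 y by (auto simp: lip_controls_def)
    have sub: "?SL \<subseteq> ?S" by (auto simp: lip_controls_def)
    have "payoff r \<gamma> y b \<le> lip_value_fn f r \<gamma> L x0 a0"
      unfolding lip_value_fn_def by (rule cSup_upper[OF mem bdd_above_mono[OF bdd sub]])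
    moreover have "lip_value_fn f r \<gamma> L x0 a0 \<le> value_fn f r \<gamma> x0"
      unfolding lip_value_fn_def value_fn_def by (rule cSup_subset_mono[OF _ bdd sub]) (use mem in blast)
    ultimately show ?thesis using diff unfolding opt by linarith
  qed
  have ev1: "\<forall>\<^sub>F L in at_top. L \<ge> exp (1::real)" by (rule eventually_ge_at_top)
  have ev2: "\<forall>\<^sub>F L in at_top. 1 / sqrt L \<le> e" using e(1) by real_asymp
  \<comment> \<open>Both \<open>1 / (\<epsilon> * sqrt \<epsilon>)\<close> and the cost of joining
    to \<open>a0\<close> are of order at most \<open>L powr (3 / 4)\<close>, hence of smaller order
    than \<open>L\<close>.\<close>
  have ev3: "\<forall>\<^sub>F L in at_top. C * (1 + ln L + 1 / (1 / sqrt L * sqrt (1 / sqrt L)))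
        + sqrt L * (norm a0 + C * (1 + 1 / sqrt (1 / sqrt L))) \<le> L"
  proof -
    define A where "A = norm a0"
    have "((\<lambda>L. (C * (1 + ln L + 1 / (1 / sqrt L * sqrt (1 / sqrt L)))
        + sqrt L * (A + C * (1 + 1 / sqrt (1 / sqrt L)))) / L) \<longlongrightarrow> 0) at_top"
      by real_asymp
    then have "\<forall>\<^sub>F L in at_top. (C * (1 + ln L + 1 / (1 / sqrt L * sqrt (1 / sqrt L)))
        + sqrt L * (A + C * (1 + 1 / sqrt (1 / sqrt L)))) / L < 1"
      by (rule order_tendstoD) simp
    with eventually_gt_at_top[of 0] show ?thesis
      by eventually_elim (simp add: A_def divide_less_eq)
  qed
  show ?thesis
  proof (rule bigoI[of _ "N * (2 + M)"])
    show "\<forall>\<^sub>F L in at_top. norm \<bar>lip_value_fn f r \<gamma> L x0 a0 - value_fn f r \<gamma> x0\<bar>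
      \<le> N * (2 + M) * norm (ln L / L powr (\<sigma> / 2) + (ln L / sqrt L) powr \<beta> + 1 / sqrt L)"
      using ev1 ev2 ev3
    proof eventually_elim
      case (elim L)
      have L0: "L \<ge> 1" using elim(1) exp_ge_add_one_self[of 1] by linarith
      define A B D where "A = ln L / L powr (\<sigma> / 2)" and "B = (ln L / sqrt L) powr \<beta>" and "D = 1 / sqrt L"
      have nn: "A \<ge> 0" "B \<ge> 0" "D \<ge> 0" using L0 by (auto simp: A_def B_def D_def)
      have "\<bar>lip_value_fn f r \<gamma> L x0 a0 - value_fn f r \<gamma> x0\<bar> \<le> N * (2 * D + M * B)"
        using gap[OF elim] by (simp add: B_def D_def)
      also have "\<dots> \<le> N * ((2 + M) * (A + B + D))"
      proof (intro mult_left_mono N)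
        have "0 \<le> (2 + M) * A + 2 * B + M * D" using nn M by simp
        then show "2 * D + M * B \<le> (2 + M) * (A + B + D)" by (simp add: algebra_simps)
      qed
      finally show ?case using nn by (simp add: A_def B_def D_def mult.assoc)
    qed
  qed
qed

end
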